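(* Let $k$ be a field and let $S=k\langle X:Y\rangle$ be a finitely presented $k$-algebra, with finite generating set $X=\{x_1,\dots,x_a\}$ and finite set of relations $Y=\{y_1,\dots,y_b\}\subset k\langle X\rangle$. Let $A$ be the finite dimensional path algebra of the quiver with relations constructed from this presentation as described in the context. Then $A$ has global dimension $\le 2$.
   Context: Algebras are associative with $1$. $k\langle X:Y\rangle$ denotes the quotient of the free algebra $k\langle X\rangle$ by the two-sided ideal generated by $Y$. Quivers with relations. A quiver has a finite set of vertices and a finite set of arrows, each arrow $c$ having a tail $tc$ and a head $hc$. A path of length $i$ from $v$ to $w$ is a word $c_1\cdots c_i$ in the arrows with $hc_j=tc_{j+1}$ for $1\le j<i$, $tc_1=v$, $hc_i=w$; at each vertex $v$ there is a path $f_v$ of length $0$. The path algebra $\Lambda(Q)$ has the set of all paths as $k$-basis, with product given by concatenation of paths (written left to right, and zero if the head of the first path is not the tail of the second) and $1=\sum_v f_v$. Given a finite set $R$ of relations, each a linear combination of paths with common tail and common head, the path algebra of the quiver with relations $(Q,R)$ is $\Lambda(Q)$ modulo the two-sided ideal generated by $R$. Construction of $A$. Write each $y_j$ uniquely as $y_j=\sum_{\ell=1}^{c_j}\lambda_{j\ell}w_{j\ell}$ with $0\ne\lambda_{j\ell}\in k$ and $w_{j\ell}$ distinct words in $X$. Let $n-1$ be the maximal length of the words $w_{j\ell}$ (if no word occurs, i.e. there are no nonzero relations, put $n=2$). Let $Q$ be the quiver with vertices $1,\dots,n$ and, for each $1\le m\le n-1$, arrows $e_m$ and $a_{mi}$ ($1\le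 i\le a$), all from $m$ to $m+1$. For $1\le s<t\le n$ put $e_{s,t}=e_s e_{s+1}\cdots e_{t-1}$, and let $e_{m,m}$ be the path of length $0$ at $m$. Let $$T=\{\,a_{1i}e_{2,n}-e_{1,m}a_{mi}e_{m+1,n} : 1<m<n,\ 1\le i\le a\,\}.$$ For a word $w=x_{i_1}\cdots x_{i_u}$ of length $u<n$ put $w'=a_{1,i_1}a_{2,i_2}\cdots a_{u,i_u}e_{u+1,n}$, a path from $1$ to $n$, and let $Y'=\{y'_j:1\le j\le b\}$ with $y_j'=\sum_{\ell=1}^{c_j}\lambda_{j\ell}w'_{j\ell}$. Then $A$ is the path algebra of the quiver with relations $(Q,T\cup Y')$. *)

theory Defs
  imports "HOL-Algebra.QuotRing" "HOL-Algebra.Module" "HOL-Library.Extended_Nat"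
    "Graph_Theory.Arc_Walk"
begin

section \<open>Free algebras and path algebras\<close>

text \<open>
  The vector space with basis \<open>B\<close>, realised as finitely supported functions.  The product is the
  bilinear extension of a partial product \<open>c\<close> of basis elements, where \<open>None\<close> means that the
  product is zero, and the unit is the sum of the elements of \<open>U\<close>.
\<close>

definition basis_mult ::
    "('p \<Rightarrow> 'p \<Rightarrow> 'p option) \<Rightarrow> ('p \<Rightarrow> 'k::field) \<Rightarrow> ('p \<Rightarrow> 'k) \<Rightarrow> 'p \<Rightarrow> 'k" where
  "basis_mult c f g =
     (\<lambda>z. \<Sum>(x, y) \<in> {(x, y). f x \<noteq> 0 \<and> g y \<noteq> 0 \<and> c x y = Some z}. f x * g y)"

definition basis_algebra ::
    "'p set \<Rightarrow> ('p \<Rightarrow> 'p \<Rightarrow> 'p option) \<Rightarrow> 'p set \<Rightarrow> ('p \<Rightarrow> 'k::field) ring" where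
  "basis_algebra B c U =
     \<lparr>carrier = {f. finite {x. f x \<noteq> 0} \<and> {x. f x \<noteq> 0} \<subseteq> B},
      mult = basis_mult c,
      one = (\<lambda>x. if x \<in> U then 1 else 0),
      zero = (\<lambda>_. 0),
      add = (\<lambda>f g x. f x + g x)\<rparr>"

definition free_algebra :: "'x set \<Rightarrow> ('x list \<Rightarrow> 'k::field) ring" where
  "free_algebra X = basis_algebra (lists X) (\<lambda>u v. Some (u @ v)) {[]}"

text \<open>
  A quiver is a directed multigraph (\<^typ>\<open>('v, 'c) pre_digraph\<close>).  A path from \<open>v\<close> to \<open>w\<close> is
  the triple \<open>(v, p, w)\<close> with \<open>p\<close> its list of arrows; the path of length 0 at \<open>v\<close> is \<open>(v, [], v)\<close>.
\<close>

type_synonym ('v, 'c) path = "'v \<times> 'c list \<times> 'v"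

definition paths :: "('v, 'c) pre_digraph \<Rightarrow> ('v, 'c) path set" where
  "paths G = {(v, p, w). pre_digraph.awalk G v p w}"

fun path_comp :: "('v, 'c) path \<Rightarrow> ('v, 'c) path \<Rightarrow> ('v, 'c) path option" where
  "path_comp (u, p, v) (v', q, w) = (if v = v' then Some (u, p @ q, w) else None)"

definition path_algebra :: "('v, 'c) pre_digraph \<Rightarrow> (('v, 'c) path \<Rightarrow> 'k::field) ring" where
  "path_algebra G = basis_algebra (paths G) path_comp {(v, [], v) | v. v \<in> verts G}"

definition quiver_algebra ::
    "('v, 'c) pre_digraph \<Rightarrow> (('v, 'c) path \<Rightarrow> 'k::field) set
      \<Rightarrow> (('v, 'c) path \<Rightarrow> 'k) set ring" where
  "quiver_algebra G R = path_algebra G Quot (genideal (path_algebra G) R)"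


section \<open>The algebra of a finite presentation\<close>

text \<open>
  The generators are numbered \<open>1, \<dots>, a\<close>, so that a word is a list over \<open>{1..a}\<close>.  The words
  occurring in \<open>y\<close> are those at which \<open>y\<close> is nonzero, their coefficients being the values of \<open>y\<close>.
\<close>

datatype arrow = E nat | A nat nat

definition num_vertices :: "(nat list \<Rightarrow> 'k::field) set \<Rightarrow> nat" where
  "num_vertices Y =
     (let W = {w. \<exists>y\<in>Y. y w \<noteq> 0} in if W = {} then 2 else Max (length ` W) + 1)"

fun arrow_index :: "arrow \<Rightarrow> nat" where
  "arrow_index (E m) = m"
| "arrow_index (A m i) = m"

definition quiver :: "nat \<Rightarrow> nat \<Rightarrow> (nat, arrow) pre_digraph" where
  "quiver n a =
     \<lparr>verts = {1..n},
      arcs = {E m | m. 1 \<le> m \<and> m < n} \<union> {A m i | m i. 1 \<le> m \<and> m < n \<and> 1 \<le> i \<and> i \<le> a},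
      tail = arrow_index,
      head = (\<lambda>c. arrow_index c + 1)\<rparr>"

text \<open>The arrows of \<open>e\<^sub>s\<^sub>,\<^sub>t\<close>.  The list is empty for \<open>s = t\<close>.\<close>

definition e_arrows :: "nat \<Rightarrow> nat \<Rightarrow> arrow list" where
  "e_arrows s t = map E [s..<t]"

definition single :: "'p \<Rightarrow> 'p \<Rightarrow> 'k::field" where
  "single p = (\<lambda>q. if q = p then 1 else 0)"

definition T_relations :: "nat \<Rightarrow> nat \<Rightarrow> ((nat, arrow) path \<Rightarrow> 'k::field) set" where
  "T_relations n a =
     {(\<lambda>z. single (1, A 1 i # e_arrows 2 n, n) z
         - single (1, e_arrows 1 m @ A m i # e_arrows (m + 1) n, n) z)
      | m i. 1 < m \<and> m < n \<and> 1 \<le> i \<and> i \<le> a}"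

definition word_path :: "nat \<Rightarrow> nat list \<Rightarrow> (nat, arrow) path" where
  "word_path n w =
     (1, map2 A [1..<length w + 1] w @ e_arrows (length w + 1) n, n)"

definition lift_relation ::
    "nat \<Rightarrow> (nat list \<Rightarrow> 'k::field) \<Rightarrow> (nat, arrow) path \<Rightarrow> 'k" where
  "lift_relation n y = (\<lambda>z. \<Sum>w | y w \<noteq> 0. y w * single (word_path n w) z)"

definition presentation_quiver_algebra ::
    "nat \<Rightarrow> (nat list \<Rightarrow> 'k::field) set \<Rightarrow> ((nat, arrow) path \<Rightarrow> 'k) set ring" where
  "presentation_quiver_algebra a Y =
     (let n = num_vertices Y in quiver_algebra (quiver n a) (T_relations n a \<union> lift_relation n ` Y))"


section \<open>Modules and global dimension\<close>

text \<open>
  \<^locale>\<open>module\<close> requires a commutative ring.  As there, the fields \<open>mult\<close> and \<open>one\<close> of the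
  record \<open>M\<close> are irrelevant.
\<close>

locale left_module = R?: ring R + M?: abelian_group M
  for R :: "'a ring" (structure) and M :: "('a, 'm) module" (structure) +
  assumes smult_closed:
      "\<lbrakk>r \<in> carrier R; x \<in> carrier M\<rbrakk> \<Longrightarrow> r \<odot>\<^bsub>M\<^esub> x \<in> carrier M"
    and smult_l_distr:
      "\<lbrakk>r \<in> carrier R; s \<in> carrier R; x \<in> carrier M\<rbrakk> \<Longrightarrow>
       (r \<oplus>\<^bsub>R\<^esub> s) \<odot>\<^bsub>M\<^esub> x = (r \<odot>\<^bsub>M\<^esub> x) \<oplus>\<^bsub>M\<^esub> (s \<odot>\<^bsub>M\<^esub> x)"
    and smult_r_distr:
      "\<lbrakk>r \<in> carrier R; x \<in> carrier M; y \<in> carrier M\<rbrakk> \<Longrightarrow>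
       r \<odot>\<^bsub>M\<^esub> (x \<oplus>\<^bsub>M\<^esub> y) = (r \<odot>\<^bsub>M\<^esub> x) \<oplus>\<^bsub>M\<^esub> (r \<odot>\<^bsub>M\<^esub> y)"
    and smult_assoc:
      "\<lbrakk>r \<in> carrier R; s \<in> carrier R; x \<in> carrier M\<rbrakk> \<Longrightarrow>
       (r \<otimes>\<^bsub>R\<^esub> s) \<odot>\<^bsub>M\<^esub> x = r \<odot>\<^bsub>M\<^esub> (s \<odot>\<^bsub>M\<^esub> x)"
    and smult_one:
      "x \<in> carrier M \<Longrightarrow> \<one>\<^bsub>R\<^esub> \<odot>\<^bsub>M\<^esub> x = x"

definition mod_hom :: "'a ring \<Rightarrow> ('a, 'm) module \<Rightarrow> ('a, 'n) module \<Rightarrow> ('m \<Rightarrow> 'n) set" where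
  "mod_hom R M N =
     {h \<in> carrier M \<rightarrow> carrier N.
        (\<forall>x\<in>carrier M. \<forall>y\<in>carrier M. h (x \<oplus>\<^bsub>M\<^esub> y) = h x \<oplus>\<^bsub>N\<^esub> h y) \<and>
        (\<forall>r\<in>carrier R. \<forall>x\<in>carrier M. h (r \<odot>\<^bsub>M\<^esub> x) = r \<odot>\<^bsub>N\<^esub> h x)}"

definition free_module :: "'a ring \<Rightarrow> 'i set \<Rightarrow> ('a, 'i \<Rightarrow> 'a) module" where
  "free_module R I =
     \<lparr>carrier = {f. (\<forall>i\<in>I. f i \<in> carrier R) \<and> (\<forall>i. i \<notin> I \<longrightarrow> f i = \<zero>\<^bsub>R\<^esub>) \<and>
                    finite {i \<in> I. f i \<noteq> \<zero>\<^bsub>R\<^esub>}},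
      mult = undefined,
      one = undefined,
      zero = (\<lambda>_. \<zero>\<^bsub>R\<^esub>),
      add = (\<lambda>f g i. f i \<oplus>\<^bsub>R\<^esub> g i),
      smult = (\<lambda>r f i. r \<otimes>\<^bsub>R\<^esub> f i)\<rparr>"

text \<open>
  Projective means direct summand of a free module.  Taking the basis \<open>I\<close> from the type of \<open>P\<close> is
  no restriction: a projective module is a direct summand of the free module on its own elements.
\<close>

definition projective :: "'a ring \<Rightarrow> ('a, 'p) module \<Rightarrow> bool" where
  "projective R P \<longleftrightarrow> left_module R P \<and>
     (\<exists>(I :: 'p set) s p.
        s \<in> mod_hom R P (free_module R I) \<and> p \<in> mod_hom R (free_module R I) P \<and>
        (\<forall>x\<in>carrier P. p (s x) = x))"

text \<open>
  Exactness of \<open>0 \<rightarrow> P n \<rightarrow> \<dots> \<rightarrow> P 1 \<rightarrow> P 0 \<rightarrow> M \<rightarrow> 0\<close>, with differentials \<open>d i : P (i + 1) \<rightarrow> P i\<close>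
  and augmentation \<open>\<epsilon> : P 0 \<rightarrow> M\<close>.
\<close>

definition projective_resolution ::
    "'a ring \<Rightarrow> ('a, 'm) module \<Rightarrow> nat \<Rightarrow> (nat \<Rightarrow> ('a, 'p) module) \<Rightarrow> (nat \<Rightarrow> 'p \<Rightarrow> 'p)
      \<Rightarrow> ('p \<Rightarrow> 'm) \<Rightarrow> bool" where
  "projective_resolution R M n P d \<epsilon> \<longleftrightarrow>
     (\<forall>i. projective R (P i)) \<and>
     (\<forall>i>n. carrier (P i) = {\<zero>\<^bsub>P i\<^esub>}) \<and>
     (\<forall>i. d i \<in> mod_hom R (P (Suc i)) (P i)) \<and>
     \<epsilon> \<in> mod_hom R (P 0) M \<and>
     \<epsilon> ` carrier (P 0) = carrier M \<and>
     d 0 ` carrier (P 1) = a_kernel (P 0) M \<epsilon> \<and>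
     (\<forall>i. d (Suc i) ` carrier (P (Suc (Suc i))) = a_kernel (P (Suc i)) (P i) (d i))"

text \<open>
  HOL cannot quantify over the types of the \<open>P i\<close>, so their elements are taken from the type
  \<^typ>\<open>nat \<times> 'm \<Rightarrow> 'a\<close>.  This is no restriction: if \<open>M\<close> has a projective resolution of length \<open>n\<close> at
  all, it has one in which \<open>P i\<close> for \<open>i < n\<close> is free on the elements of the previous kernel and
  \<open>P n\<close> is a kernel.  Unless \<open>R\<close> is zero, these have cardinality at most that of finite lists over
  \<^typ>\<open>'m \<times> 'a\<close>, which embed in \<^typ>\<open>nat \<times> 'm \<Rightarrow> 'a\<close>.
\<close>

definition projective_dim :: "'a ring \<Rightarrow> ('a, 'm) module \<Rightarrow> enat" where
  "projective_dim R M =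
     Inf {enat n | n. \<exists>(P :: nat \<Rightarrow> ('a, nat \<times> 'm \<Rightarrow> 'a) module) d \<epsilon>.
            projective_resolution R M n P d \<epsilon>}"

text \<open>
  The supremum is over the modules whose elements lie in a given type \<open>'m\<close>; a bound on the global
  dimension is to be asserted for arbitrary \<open>'m\<close>.
\<close>

definition left_global_dim :: "'m itself \<Rightarrow> 'a ring \<Rightarrow> enat" where
  "left_global_dim _ R = (SUP M \<in> {M :: ('a, 'm) module. left_module R M}. projective_dim R M)"

text \<open>Right modules are left modules over the opposite ring.\<close>

definition opposite_ring :: "'a ring \<Rightarrow> 'a ring" where
  "opposite_ring R = R\<lparr>mult := (\<lambda>x y. y \<otimes>\<^bsub>R\<^esub> x)\<rparr>"

definition right_global_dim :: "'m itself \<Rightarrow> 'a ring \<Rightarrow> enat" where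
  "right_global_dim t R = left_global_dim t (opposite_ring R)"

end

theory Submission
  imports Defs
begin

text \<open>
  Every relation imposed on the path algebra \<open>\<Lambda>\<close> is a combination of paths from the first vertex
  to the last one.  No arrow enters the vertex \<open>1\<close> and none leaves the vertex \<open>n\<close>, so the ideal \<open>I\<close>
  that the relations generate stays inside \<open>e\<^sub>1 \<Lambda> e\<^sub>n\<close>, where \<open>e\<^sub>v\<close> is the path of length 0 at \<open>v\<close>.
  Write \<open>R = \<Lambda>/I\<close>, and let \<open>x\<^sub>c\<close> be the class of an arrow \<open>c\<close> from \<open>tc\<close> to \<open>hc = tc + 1\<close>.  A path of
  positive length has a unique last arrow, and this leaves two facts about \<open>R\<close>.  The left ideal
  \<open>R e\<^sub>v\<close> is the sum of \<open>k e\<^sub>v\<close> and of the \<open>R x\<^sub>c\<close> with \<open>hc = v\<close>.  And if \<open>\<Sum> \<alpha>\<^sub>c x\<^sub>c = 0\<close>, summed over the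
  arrows with \<open>hc = v\<close> and with \<open>\<alpha>\<^sub>c \<in> R e\<^sub>t\<^sub>c\<close>, then \<open>e\<^sub>1 \<alpha>\<^sub>c = \<alpha>\<^sub>c\<close>, and even \<open>\<alpha>\<^sub>c = 0\<close> unless \<open>v = n\<close>
  (\<open>quotient_almost_hereditary\<close>).

  For a left module \<open>M\<close> put \<open>V\<^sub>v = e\<^sub>v M\<close>, a vector space over \<open>k\<close>, and consider
  \<open>P\<^sub>1 = \<Oplus>\<^sub>c R e\<^sub>t\<^sub>c \<otimes> V\<^sub>h\<^sub>c \<rightarrow> P\<^sub>0 = \<Oplus>\<^sub>v R e\<^sub>v \<otimes> V\<^sub>v \<rightarrow> M \<rightarrow> 0\<close> with the differential
  \<open>r \<otimes> y \<mapsto> r x\<^sub>c \<otimes> y - r \<otimes> x\<^sub>c y\<close>.  Both modules are projective, since \<open>V\<^sub>v\<close> has a basis.  The first fact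
  gives exactness at \<open>P\<^sub>0\<close>: modulo the image of the differential the arrows of a path can be moved
  across the tensor sign one at a time, beginning with the last (\<open>exact_at_P0\<close>).  The second fact
  describes the kernel \<open>K\<close> of the differential.  Comparing components at \<open>v = n, n - 1, \<dots>\<close> shows that
  an element of \<open>K\<close> is determined by its components at the arrows that end in \<open>n\<close>, and that \<open>e\<^sub>1\<close>
  fixes these components; so \<open>e\<^sub>1\<close> acts on \<open>K\<close> as the identity (\<open>first_idem_acts_on_kernel\<close>).  But
  \<open>R e\<^sub>1 = k e\<^sub>1\<close>, and so \<open>K\<close> is a direct sum of copies of \<open>R e\<^sub>1\<close>, one for each element of a basis of
  \<open>K\<close> over \<open>k\<close>.  Hence \<open>0 \<rightarrow> K \<rightarrow> P\<^sub>1 \<rightarrow> P\<^sub>0 \<rightarrow> M \<rightarrow> 0\<close> is a projective resolution of length 2.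

  Right modules are left modules over the opposite algebra, which amounts to reversing all arrows
  and numbering the vertices backwards.  The hypotheses survive this, with the two extreme vertices
  exchanged.  For this reason the path algebra is treated as the algebra of an abstract basis with a
  partial product (\<open>layered_basis\<close>), to be applied to the composition of paths in either order.
\<close>

section \<open>Abelian groups\<close>

lemma (in abelian_group) eq_zero_if_double:
  assumes "y \<in> carrier G" "y = y \<oplus> y"
  shows "y = \<zero>"
  using assms by (metis add.l_cancel_one' zero_closed)

lemma (in abelian_group) minus_add_minus:
  assumes "a \<in> carrier G" "b \<in> carrier G" "c \<in> carrier G" "d \<in> carrier G"
  shows "(a \<oplus> b) \<ominus> (c \<oplus> d) = (a \<ominus> c) \<oplus> (b \<ominus> d)"
  using assms by (simp add: a_minus_def minus_add a_ac)

lemma (in abelian_group) minus_telescope: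
  assumes "a \<in> carrier G" "b \<in> carrier G" "c \<in> carrier G"
  shows "a \<ominus> c = (a \<ominus> b) \<oplus> (b \<ominus> c)"
proof -
  have "(a \<ominus> b) \<oplus> (b \<ominus> c) = a \<oplus> (\<ominus> b \<oplus> b) \<oplus> \<ominus> c"
    using assms by (simp only: a_minus_def a_assoc a_closed a_inv_closed)
  then show ?thesis using assms by (simp add: l_neg a_minus_def)
qed

lemma (in abelian_group) eq_if_minus_zero:
  assumes "a \<in> carrier G" "b \<in> carrier G" "a \<ominus> b = \<zero>"
  shows "a = b"
proof -
  have "\<ominus> (\<ominus> b) = a" using assms by (intro minus_equality) (auto simp: a_minus_def)
  then show ?thesis using assms by simp
qed

lemma (in abelian_group) minus_zero_right: "a \<in> carrier G \<Longrightarrow> a \<ominus> \<zero> = a"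
  by (simp add: a_minus_def)

lemma (in abelian_monoid) finsum_closed_under_add:
  assumes "finite S" "\<And>c. c \<in> S \<Longrightarrow> f c \<in> carrier G" "\<And>c. c \<in> S \<Longrightarrow> P (f c)"
    and "P \<zero>" "\<And>x y. x \<in> carrier G \<Longrightarrow> y \<in> carrier G \<Longrightarrow> P x \<Longrightarrow> P y \<Longrightarrow> P (x \<oplus> y)"
  shows "P (finsum G f S)"
  using assms(1-3)
proof (induction S rule: finite_induct)
  case (insert c S)
  then show ?case
    using assms(4,5) by (subst finsum_insert) (auto intro!: finsum_closed)
qed (use assms(4) in simp)

section \<open>Left modules and their homomorphisms\<close>

text \<open>
  The constructions below build records of type \<open>('a, 'm) module\<close> over a ring without extension
  fields, while \<open>ring\<close> allows an arbitrary ring scheme; this fixes the type.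
\<close>

locale coefficient_ring = ring R for R :: "'a ring" (structure)

sublocale left_module \<subseteq> R?: coefficient_ring R ..

context left_module
begin

lemma smult_l_null: assumes "x \<in> carrier M" shows "\<zero> \<odot>\<^bsub>M\<^esub> x = \<zero>\<^bsub>M\<^esub>"
proof -
  have "\<zero> \<odot>\<^bsub>M\<^esub> x = (\<zero> \<oplus> \<zero>) \<odot>\<^bsub>M\<^esub> x" by simp
  also have "\<dots> = (\<zero> \<odot>\<^bsub>M\<^esub> x) \<oplus>\<^bsub>M\<^esub> (\<zero> \<odot>\<^bsub>M\<^esub> x)"
    using assms by (intro smult_l_distr) auto
  finally show ?thesis
    using assms by (intro M.eq_zero_if_double) (auto intro: smult_closed)
qed

lemma smult_r_null: assumes "r \<in> carrier R" shows "r \<odot>\<^bsub>M\<^esub> \<zero>\<^bsub>M\<^esub> = \<zero>\<^bsub>M\<^esub>"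
proof -
  have "r \<odot>\<^bsub>M\<^esub> \<zero>\<^bsub>M\<^esub> = r \<odot>\<^bsub>M\<^esub> (\<zero>\<^bsub>M\<^esub> \<oplus>\<^bsub>M\<^esub> \<zero>\<^bsub>M\<^esub>)" by simp
  also have "\<dots> = (r \<odot>\<^bsub>M\<^esub> \<zero>\<^bsub>M\<^esub>) \<oplus>\<^bsub>M\<^esub> (r \<odot>\<^bsub>M\<^esub> \<zero>\<^bsub>M\<^esub>)"
    using assms by (intro smult_r_distr) auto
  finally show ?thesis
    using assms by (intro M.eq_zero_if_double) (auto intro: smult_closed)
qed

lemma smult_r_minus:
  assumes "r \<in> carrier R" "x \<in> carrier M"
  shows "r \<odot>\<^bsub>M\<^esub> (\<ominus>\<^bsub>M\<^esub> x) = \<ominus>\<^bsub>M\<^esub> (r \<odot>\<^bsub>M\<^esub> x)"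
proof -
  have "(r \<odot>\<^bsub>M\<^esub> (\<ominus>\<^bsub>M\<^esub> x)) \<oplus>\<^bsub>M\<^esub> (r \<odot>\<^bsub>M\<^esub> x) = r \<odot>\<^bsub>M\<^esub> ((\<ominus>\<^bsub>M\<^esub> x) \<oplus>\<^bsub>M\<^esub> x)"
    using assms by (intro smult_r_distr[symmetric]) auto
  then show ?thesis
    using assms by (intro M.minus_equality[symmetric]) (auto simp: M.l_neg smult_r_null smult_closed)
qed

lemma smult_r_diff:
  assumes "r \<in> carrier R" "x \<in> carrier M" "y \<in> carrier M"
  shows "r \<odot>\<^bsub>M\<^esub> (x \<ominus>\<^bsub>M\<^esub> y) = r \<odot>\<^bsub>M\<^esub> x \<ominus>\<^bsub>M\<^esub> r \<odot>\<^bsub>M\<^esub> y"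
  using assms by (simp add: a_minus_def smult_r_distr smult_r_minus)

lemma smult_finsum:
  assumes "finite D" "r \<in> carrier R" "f \<in> D \<rightarrow> carrier M"
  shows "r \<odot>\<^bsub>M\<^esub> finsum M f D = finsum M (\<lambda>i. r \<odot>\<^bsub>M\<^esub> f i) D"
  using assms
proof (induction D rule: finite_induct)
  case (insert a D)
  then have "f \<in> D \<rightarrow> carrier M" "f a \<in> carrier M" by auto
  with insert show ?case by (simp add: M.finsum_insert smult_r_distr smult_closed Pi_def)
qed (simp add: smult_r_null)

lemma finsum_smult:
  assumes "finite D" "x \<in> carrier M" "f \<in> D \<rightarrow> carrier R"
  shows "finsum R f D \<odot>\<^bsub>M\<^esub> x = finsum M (\<lambda>i. f i \<odot>\<^bsub>M\<^esub> x) D"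
  using assms
proof (induction D rule: finite_induct)
  case (insert a D)
  then have "f \<in> D \<rightarrow> carrier R" "f a \<in> carrier R" by auto
  with insert show ?case by (simp add: finsum_insert M.finsum_insert smult_l_distr smult_closed Pi_def)
qed (simp add: smult_l_null)

lemma submodule:
  assumes "S \<subseteq> carrier M" "\<zero>\<^bsub>M\<^esub> \<in> S"
    and add: "\<And>x y. x \<in> S \<Longrightarrow> y \<in> S \<Longrightarrow> x \<oplus>\<^bsub>M\<^esub> y \<in> S"
    and smult: "\<And>r x. r \<in> carrier R \<Longrightarrow> x \<in> S \<Longrightarrow> r \<odot>\<^bsub>M\<^esub> x \<in> S"
  shows "left_module R (M\<lparr>carrier := S\<rparr>)"
proof -
  have neg: "\<exists>y\<in>S. y \<oplus>\<^bsub>M\<^esub> x = \<zero>\<^bsub>M\<^esub>" if "x \<in> S" for x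
  proof
    have x: "x \<in> carrier M" using that assms(1) by auto
    show "(\<ominus> \<one>) \<odot>\<^bsub>M\<^esub> x \<in> S" using smult[OF _ that] by auto
    have "((\<ominus> \<one>) \<odot>\<^bsub>M\<^esub> x) \<oplus>\<^bsub>M\<^esub> (\<one> \<odot>\<^bsub>M\<^esub> x) = (\<ominus> \<one> \<oplus> \<one>) \<odot>\<^bsub>M\<^esub> x"
      using x by (intro smult_l_distr[symmetric]) auto
    also have "\<dots> = \<zero>\<^bsub>M\<^esub>" using x by (simp add: R.l_neg smult_l_null)
    finally show "((\<ominus> \<one>) \<odot>\<^bsub>M\<^esub> x) \<oplus>\<^bsub>M\<^esub> x = \<zero>\<^bsub>M\<^esub>" using x by (simp add: smult_one)
  qed
  have sub: "\<And>x. x \<in> S \<Longrightarrow> x \<in> carrier M" using assms(1) by auto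
  have "abelian_group (M\<lparr>carrier := S\<rparr>)"
  proof (rule abelian_groupI)
    fix x y assume "x \<in> carrier (M\<lparr>carrier := S\<rparr>)" "y \<in> carrier (M\<lparr>carrier := S\<rparr>)"
    then show "x \<oplus>\<^bsub>M\<lparr>carrier := S\<rparr>\<^esub> y = y \<oplus>\<^bsub>M\<lparr>carrier := S\<rparr>\<^esub> x" by (simp add: M.a_comm sub)
  qed (use neg in \<open>auto simp: assms M.a_assoc sub\<close>)
  then show ?thesis
    by (simp add: left_module_def left_module_axioms_def R.ring_axioms smult sub
        smult_l_distr smult_r_distr smult_assoc smult_one)
qed

end

lemma mod_homD:
  assumes "h \<in> mod_hom R M N"
  shows "\<And>x. x \<in> carrier M \<Longrightarrow> h x \<in> carrier N"
    and "\<And>x y. x \<in> carrier M \<Longrightarrow> y \<in> carrier M \<Longrightarrow> h (x \<oplus>\<^bsub>M\<^esub> y) = h x \<oplus>\<^bsub>N\<^esub> h y"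
    and "\<And>r x. r \<in> carrier R \<Longrightarrow> x \<in> carrier M \<Longrightarrow> h (r \<odot>\<^bsub>M\<^esub> x) = r \<odot>\<^bsub>N\<^esub> h x"
  using assms unfolding mod_hom_def by auto

lemma mod_hom_zero:
  assumes "left_module R M" "left_module R N" "h \<in> mod_hom R M N"
  shows "h \<zero>\<^bsub>M\<^esub> = \<zero>\<^bsub>N\<^esub>"
proof -
  interpret M: left_module R M by fact
  interpret N: left_module R N by fact
  have "h \<zero>\<^bsub>M\<^esub> = h (\<zero>\<^bsub>M\<^esub> \<oplus>\<^bsub>M\<^esub> \<zero>\<^bsub>M\<^esub>)" by simp
  also have "\<dots> = h \<zero>\<^bsub>M\<^esub> \<oplus>\<^bsub>N\<^esub> h \<zero>\<^bsub>M\<^esub>" by (intro mod_homD(2)[OF assms(3)]) auto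
  finally show ?thesis
    by (intro N.M.eq_zero_if_double) (auto intro: mod_homD(1)[OF assms(3)])
qed

lemma mod_hom_minus:
  assumes "left_module R M" "left_module R N" "h \<in> mod_hom R M N"
    and "x \<in> carrier M" "y \<in> carrier M"
  shows "h (x \<ominus>\<^bsub>M\<^esub> y) = h x \<ominus>\<^bsub>N\<^esub> h y"
proof -
  interpret M: left_module R M by fact
  interpret N: left_module R N by fact
  note h = mod_homD[OF assms(3)]
  have "h (\<ominus>\<^bsub>M\<^esub> y) \<oplus>\<^bsub>N\<^esub> h y = h (\<ominus>\<^bsub>M\<^esub> y \<oplus>\<^bsub>M\<^esub> y)" using assms by (simp add: h(2))
  also have "\<dots> = \<zero>\<^bsub>N\<^esub>" using assms by (simp add: M.M.l_neg mod_hom_zero)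
  finally have "h (\<ominus>\<^bsub>M\<^esub> y) = \<ominus>\<^bsub>N\<^esub> h y"
    using assms by (intro N.M.minus_equality[symmetric]) (auto intro: h(1))
  then show ?thesis using assms by (simp add: a_minus_def h(2))
qed

section \<open>Direct sums of the modules generated by idempotents\<close>

text \<open>
  The module \<open>\<Oplus>\<^sub>j R g\<^sub>j\<close> for idempotents \<open>g\<^sub>j\<close>: for an idempotent \<open>g\<close> the left ideal \<open>R g\<close> consists of
  the \<open>r\<close> with \<open>r g = r\<close>.
\<close>

definition direct_sum :: "'a ring \<Rightarrow> 'j set \<Rightarrow> ('j \<Rightarrow> 'a) \<Rightarrow> ('a, 'j \<Rightarrow> 'a) module" where
  "direct_sum R J g =
     \<lparr>carrier = {f. (\<forall>j\<in>J. f j \<in> carrier R \<and> f j \<otimes>\<^bsub>R\<^esub> g j = f j) \<and>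
                    (\<forall>j. j \<notin> J \<longrightarrow> f j = \<zero>\<^bsub>R\<^esub>) \<and> finite {j. f j \<noteq> \<zero>\<^bsub>R\<^esub>}},
      mult = undefined,
      one = undefined,
      zero = (\<lambda>_. \<zero>\<^bsub>R\<^esub>),
      add = (\<lambda>f g i. f i \<oplus>\<^bsub>R\<^esub> g i),
      smult = (\<lambda>r f i. r \<otimes>\<^bsub>R\<^esub> f i)\<rparr>"

definition elem_at :: "'a ring \<Rightarrow> 'j \<Rightarrow> 'a \<Rightarrow> 'j \<Rightarrow> 'a" where
  "elem_at R j r = (\<lambda>i. if i = j then r else \<zero>\<^bsub>R\<^esub>)"

text \<open>
  On \<open>\<Oplus>\<^sub>j R g\<^sub>j\<close> this is the homomorphism with \<open>g\<^sub>j \<mapsto> g\<^sub>j y\<^sub>j\<close>.  All maps of the resolution have this form.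
\<close>

definition combination ::
    "'a ring \<Rightarrow> ('a, 'm) module \<Rightarrow> ('j \<Rightarrow> 'm) \<Rightarrow> ('j \<Rightarrow> 'a) \<Rightarrow> 'm" where
  "combination R N y f = finsum N (\<lambda>j. f j \<odot>\<^bsub>N\<^esub> y j) {j. f j \<noteq> \<zero>\<^bsub>R\<^esub>}"

lemma direct_sum_simps [simp]:
  "zero (direct_sum R J g) = (\<lambda>_. \<zero>\<^bsub>R\<^esub>)"
  "add (direct_sum R J g) f f' = (\<lambda>i. f i \<oplus>\<^bsub>R\<^esub> f' i)"
  "smult (direct_sum R J g) r f = (\<lambda>i. r \<otimes>\<^bsub>R\<^esub> f i)"
  by (simp_all add: direct_sum_def)

lemma free_module_simps [simp]:
  "zero (free_module R I) = (\<lambda>_. \<zero>\<^bsub>R\<^esub>)"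
  "add (free_module R I) f f' = (\<lambda>i. f i \<oplus>\<^bsub>R\<^esub> f' i)"
  "smult (free_module R I) r f = (\<lambda>i. r \<otimes>\<^bsub>R\<^esub> f i)"
  by (simp_all add: free_module_def)

lemma direct_sum_memD:
  assumes "f \<in> carrier (direct_sum R J g)"
  shows "j \<in> J \<Longrightarrow> f j \<in> carrier R" "j \<in> J \<Longrightarrow> f j \<otimes>\<^bsub>R\<^esub> g j = f j"
    "j \<notin> J \<Longrightarrow> f j = \<zero>\<^bsub>R\<^esub>" "finite {j. f j \<noteq> \<zero>\<^bsub>R\<^esub>}"
  using assms by (auto simp: direct_sum_def)

lemma (in coefficient_ring) direct_sum_mem_carrier:
  assumes "f \<in> carrier (direct_sum R J g)"
  shows "f j \<in> carrier R"
  using direct_sum_memD[OF assms] by (cases "j \<in> J") auto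

lemma (in coefficient_ring) left_module_direct_sum:
  assumes "\<And>j. j \<in> J \<Longrightarrow> g j \<in> carrier R"
  shows "left_module R (direct_sum R J g)"
proof -
  let ?S = "direct_sum R J g"
  note D = direct_sum_memD
  note C = direct_sum_mem_carrier[where J=J and g=g]
  have fin: "finite {j. f j \<oplus> f' j \<noteq> \<zero>}" if "f \<in> carrier ?S" "f' \<in> carrier ?S" for f f'
    by (rule finite_subset[of _ "{j. f j \<noteq> \<zero>} \<union> {j. f' j \<noteq> \<zero>}"])
      (use that D(4) in auto)
  have fin': "finite {j. r \<otimes> f j \<noteq> \<zero>}" if "f \<in> carrier ?S" "r \<in> carrier R" for f r
    by (rule finite_subset[of _ "{j. f j \<noteq> \<zero>}"]) (use that D(4) in auto)
  have add: "(\<lambda>i. f i \<oplus> f' i) \<in> carrier ?S" if "f \<in> carrier ?S" "f' \<in> carrier ?S" for f f'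
    using that fin[OF that] D[OF that(1)] D[OF that(2)] assms
    by (auto simp: direct_sum_def l_distr)
  have smult: "(\<lambda>i. r \<otimes> f i) \<in> carrier ?S" if "f \<in> carrier ?S" "r \<in> carrier R" for f r
    using that fin'[OF that] D[OF that(1)] assms by (auto simp: direct_sum_def m_assoc)
  have zero: "(\<lambda>_. \<zero>) \<in> carrier ?S" using assms by (auto simp: direct_sum_def)
  have neg: "\<exists>f'\<in>carrier ?S. (\<lambda>i. f' i \<oplus> f i) = (\<lambda>_. \<zero>)" if "f \<in> carrier ?S" for f
  proof (rule bexI[of _ "\<lambda>i. \<ominus> \<one> \<otimes> f i"])
    show "(\<lambda>i. \<ominus> \<one> \<otimes> f i) \<in> carrier ?S" using that by (auto intro: smult)
    show "(\<lambda>i. \<ominus> \<one> \<otimes> f i \<oplus> f i) = (\<lambda>_. \<zero>)"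
      using C[OF that] by (auto simp: l_minus l_neg)
  qed
  have "abelian_group ?S"
  proof (rule abelian_groupI)
    fix f f' assume "f \<in> carrier ?S" "f' \<in> carrier ?S"
    then show "f \<oplus>\<^bsub>?S\<^esub> f' = f' \<oplus>\<^bsub>?S\<^esub> f" using C by (auto intro!: ext a_comm)
  qed (use neg in \<open>auto simp: add zero C a_assoc intro!: ext\<close>)
  then show ?thesis
    by (auto simp: left_module_def left_module_axioms_def ring_axioms smult C l_distr r_distr m_assoc
        intro!: ext)
qed

lemma (in coefficient_ring) direct_sum_minus:
  assumes "\<And>j. j \<in> J \<Longrightarrow> g j \<in> carrier R" "f \<in> carrier (direct_sum R J g)" "f' \<in> carrier (direct_sum R J g)"
  shows "f \<ominus>\<^bsub>direct_sum R J g\<^esub> f' = (\<lambda>i. f i \<ominus> f' i)"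
proof -
  interpret S: left_module R "direct_sum R J g" by (rule left_module_direct_sum) (fact assms)
  let ?f = "\<lambda>i. \<ominus> \<one> \<otimes> f' i"
  have "?f \<in> carrier (direct_sum R J g)" using S.smult_closed[of "\<ominus> \<one>" f'] assms by simp
  moreover have "?f \<oplus>\<^bsub>direct_sum R J g\<^esub> f' = \<zero>\<^bsub>direct_sum R J g\<^esub>"
    using direct_sum_mem_carrier[OF assms(3)] by (auto simp: l_minus l_neg)
  ultimately have "\<ominus>\<^bsub>direct_sum R J g\<^esub> f' = ?f"
    using assms(3) by (intro S.M.minus_equality)
  then show ?thesis
    using direct_sum_mem_carrier[OF assms(2)] direct_sum_mem_carrier[OF assms(3)]
    by (auto simp: a_minus_def l_minus)
qed

lemma (in coefficient_ring) elem_at_mem_direct_sum: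
  assumes "j \<in> J" "r \<in> carrier R" "r \<otimes> g j = r" "\<And>j. j \<in> J \<Longrightarrow> g j \<in> carrier R"
  shows "elem_at R j r \<in> carrier (direct_sum R J g)"
proof -
  have "{i. (if i = j then r else \<zero>) \<noteq> \<zero>} \<subseteq> {j}" by auto
  then have "finite {i. (if i = j then r else \<zero>) \<noteq> \<zero>}" using finite_subset by blast
  then show ?thesis using assms by (auto simp: direct_sum_def elem_at_def)
qed

text \<open>
  An element is the sum of its components, so that a property preserved by sums only needs to be
  checked on the components of the given element; nothing is asked about other elements with a
  single component.
\<close>

lemma (in coefficient_ring) direct_sum_induct [consumes 2, case_names zero add at]:
  assumes f: "f \<in> carrier (direct_sum R J g)" and "g \<in> J \<rightarrow> carrier R"
    and zero: "P (\<lambda>_. \<zero>)"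
    and add: "\<And>f f'. f \<in> carrier (direct_sum R J g) \<Longrightarrow> f' \<in> carrier (direct_sum R J g) \<Longrightarrow>
                P f \<Longrightarrow> P f' \<Longrightarrow> P (\<lambda>i. f i \<oplus> f' i)"
    and at: "\<And>j. j \<in> J \<Longrightarrow> P (elem_at R j (f j))"
  shows "P f"
proof -
  have g: "g j \<in> carrier R" if "j \<in> J" for j using assms(2) that by auto
  have "P f'" if "finite D" "f' \<in> carrier (direct_sum R J g)" "{j. f' j \<noteq> \<zero>} \<subseteq> D"
    "\<And>j. f' j = \<zero> \<or> f' j = f j" for D f'
    using that
  proof (induction D arbitrary: f' rule: finite_induct)
    case empty
    then have "f' = (\<lambda>_. \<zero>)" by auto
    then show ?case using zero by simp
  next
    case (insert a D)
    note f' = direct_sum_memD[OF insert.prems(1)]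
    show ?case
    proof (cases "f' a = \<zero>")
      case True
      with insert show ?thesis by auto
    next
      case False
      then have a: "a \<in> J" "f' a = f a" using f'(3) insert.prems(3) by auto
      let ?f = "f'(a := \<zero>)"
      have "finite {j. ?f j \<noteq> \<zero>}" by (rule finite_subset[OF _ f'(4)]) auto
      then have mem: "?f \<in> carrier (direct_sum R J g)" using f' g by (auto simp: direct_sum_def)
      have "P ?f" by (rule insert.IH[OF mem]) (use insert.prems in auto)
      moreover have "elem_at R a (f' a) \<in> carrier (direct_sum R J g)"
        using f'(1,2)[OF a(1)] g a(1) by (intro elem_at_mem_direct_sum)
      ultimately have "P (\<lambda>i. ?f i \<oplus> elem_at R a (f' a) i)"
        by (intro add[OF mem]) (use at[OF a(1)] a(2) in auto)
      moreover have "(\<lambda>i. ?f i \<oplus> elem_at R a (f' a) i) = f'"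
        using direct_sum_mem_carrier[OF insert.prems(1)] by (auto simp: elem_at_def)
      ultimately show ?thesis by simp
    qed
  qed
  from this[OF direct_sum_memD(4)[OF f] f] show ?thesis by auto
qed

lemma (in coefficient_ring) direct_sum_one: "direct_sum R I (\<lambda>_. \<one>) = free_module R I"
proof -
  have "{i \<in> I. f i \<noteq> \<zero>} = {i. f i \<noteq> \<zero>}" if "\<forall>i. i \<notin> I \<longrightarrow> f i = \<zero>" for f
    using that by auto
  then show ?thesis
    by (auto simp: direct_sum_def free_module_def)
qed

lemma (in left_module) combination_superset:
  assumes "finite D" "{j. f j \<noteq> \<zero>} \<subseteq> D" "y \<in> D \<rightarrow> carrier M" "f \<in> D \<rightarrow> carrier R"
  shows "combination R M y f = finsum M (\<lambda>j. f j \<odot>\<^bsub>M\<^esub> y j) D"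
  unfolding combination_def
  by (rule M.add.finprod_mono_neutral_cong_left)
    (use assms in \<open>auto simp: smult_l_null smult_closed Pi_def\<close>)

lemma (in left_module) combination_hom:
  assumes "\<And>j. j \<in> J \<Longrightarrow> y j \<in> carrier M" "\<And>j. j \<in> J \<Longrightarrow> g j \<in> carrier R"
  shows "combination R M y \<in> mod_hom R (direct_sum R J g) M"
proof -
  let ?S = "direct_sum R J g"
  have sup: "combination R M y f = finsum M (\<lambda>j. f j \<odot>\<^bsub>M\<^esub> y j) D"
    if "finite D" "{j. f j \<noteq> \<zero>} \<subseteq> D" "D \<subseteq> J" "f \<in> carrier ?S" for D f
    using that assms R.direct_sum_mem_carrier[OF that(4)] by (intro combination_superset) auto
  have supp: "{j. f j \<noteq> \<zero>} \<subseteq> J" "finite {j. f j \<noteq> \<zero>}" if "f \<in> carrier ?S" for f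
    using direct_sum_memD[OF that] by auto
  have cl: "f j \<odot>\<^bsub>M\<^esub> y j \<in> carrier M" if "f \<in> carrier ?S" "j \<in> J" for f j
    using that assms R.direct_sum_mem_carrier[OF that(1)] by (auto intro: smult_closed)
  interpret S: left_module R ?S by (rule R.left_module_direct_sum) (fact assms)
  show ?thesis
    unfolding mod_hom_def
  proof (intro CollectI conjI ballI funcsetI)
    fix f assume f: "f \<in> carrier ?S"
    show "combination R M y f \<in> carrier M"
      unfolding combination_def using supp[OF f] cl[OF f] by (intro M.finsum_closed) auto
    fix r assume r: "r \<in> carrier R"
    have rf: "(\<lambda>i. r \<otimes> f i) \<in> carrier ?S" using S.smult_closed[OF r f] by simp
    have "combination R M y (\<lambda>i. r \<otimes> f i) = finsum M (\<lambda>j. (r \<otimes> f j) \<odot>\<^bsub>M\<^esub> y j) {j. f j \<noteq> \<zero>}"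
      using supp[OF f] r by (intro sup[OF _ _ _ rf]) auto
    also have "\<dots> = finsum M (\<lambda>j. r \<odot>\<^bsub>M\<^esub> (f j \<odot>\<^bsub>M\<^esub> y j)) {j. f j \<noteq> \<zero>}"
      using supp[OF f] r assms R.direct_sum_mem_carrier[OF f]
      by (intro M.finsum_cong') (auto intro!: smult_closed smult_assoc)
    also have "\<dots> = r \<odot>\<^bsub>M\<^esub> combination R M y f"
      unfolding combination_def using supp[OF f] r cl[OF f] by (intro smult_finsum[symmetric]) auto
    finally show "combination R M y (r \<odot>\<^bsub>?S\<^esub> f) = r \<odot>\<^bsub>M\<^esub> combination R M y f" by simp
  next
    fix f f' assume f: "f \<in> carrier ?S" and f': "f' \<in> carrier ?S"
    let ?D = "{j. f j \<noteq> \<zero>} \<union> {j. f' j \<noteq> \<zero>}"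
    have D: "?D \<subseteq> J" "finite ?D" using supp[OF f] supp[OF f'] by auto
    have ff': "(\<lambda>i. f i \<oplus> f' i) \<in> carrier ?S" using S.M.a_closed[OF f f'] by simp
    have "combination R M y (\<lambda>i. f i \<oplus> f' i) = finsum M (\<lambda>j. (f j \<oplus> f' j) \<odot>\<^bsub>M\<^esub> y j) ?D"
      using D by (intro sup[OF _ _ _ ff']) auto
    also have "\<dots> = finsum M (\<lambda>j. f j \<odot>\<^bsub>M\<^esub> y j \<oplus>\<^bsub>M\<^esub> f' j \<odot>\<^bsub>M\<^esub> y j) ?D"
      using D assms R.direct_sum_mem_carrier[OF f] R.direct_sum_mem_carrier[OF f']
      by (intro M.finsum_cong') (auto intro!: M.a_closed smult_closed smult_l_distr)
    also have "\<dots> = finsum M (\<lambda>j. f j \<odot>\<^bsub>M\<^esub> y j) ?D \<oplus>\<^bsub>M\<^esub> finsum M (\<lambda>j. f' j \<odot>\<^bsub>M\<^esub> y j) ?D"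
      using D cl[OF f] cl[OF f'] by (intro M.finsum_addf) auto
    also have "\<dots> = combination R M y f \<oplus>\<^bsub>M\<^esub> combination R M y f'"
      using D f f' by (subst (1 2) sup[of ?D]) auto
    finally show "combination R M y (f \<oplus>\<^bsub>?S\<^esub> f') = combination R M y f \<oplus>\<^bsub>M\<^esub> combination R M y f'"
      by simp
  qed
qed

lemma (in left_module) combination_elem_at:
  assumes "r \<in> carrier R" "y j \<in> carrier M"
  shows "combination R M y (elem_at R j r) = r \<odot>\<^bsub>M\<^esub> y j"
proof -
  have "combination R M y (elem_at R j r) = finsum M (\<lambda>i. elem_at R j r i \<odot>\<^bsub>M\<^esub> y i) {j}"
    using assms by (intro combination_superset) (auto simp: elem_at_def)
  also have "\<dots> = r \<odot>\<^bsub>M\<^esub> y j" using assms by (simp add: elem_at_def smult_closed M.finsum_insert)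
  finally show ?thesis .
qed

text \<open>
  \<open>R g\<close> is a direct summand of \<open>R\<close> through multiplication by \<open>g\<close>.  The injection \<open>\<iota>\<close> transports the
  index set into the element type of the module, where projectivity expects the basis of the free
  module to be.
\<close>

lemma (in coefficient_ring) projective_direct_sum:
  fixes J :: "'j set" and \<iota> :: "'j \<Rightarrow> 'j \<Rightarrow> 'a"
  assumes g: "\<And>j. j \<in> J \<Longrightarrow> g j \<in> carrier R" "\<And>j. j \<in> J \<Longrightarrow> g j \<otimes> g j = g j"
    and inj: "inj \<iota>"
  shows "projective R (direct_sum R J g)"
proof -
  let ?S = "direct_sum R J g" and ?F = "free_module R (\<iota> ` J)"
  let ?s = "\<lambda>f i. if i \<in> \<iota> ` J then f (inv_into UNIV \<iota> i) else \<zero>"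
  let ?p = "\<lambda>F j. if j \<in> J then F (\<iota> j) \<otimes> g j else \<zero>"
  have inv: "inv_into UNIV \<iota> (\<iota> j) = j" for j using inj by simp
  note C = direct_sum_mem_carrier[where J=J and g=g]
  have FC: "F i \<in> carrier R" if "F \<in> carrier ?F" for F i
    using that by (cases "i \<in> \<iota> ` J") (auto simp: free_module_def)
  have s: "?s \<in> mod_hom R ?S ?F"
    unfolding mod_hom_def
  proof (intro CollectI conjI ballI funcsetI)
    fix f assume f: "f \<in> carrier ?S"
    have "finite {i \<in> \<iota> ` J. f (inv_into UNIV \<iota> i) \<noteq> \<zero>}"
      by (rule finite_subset[of _ "\<iota> ` {j. f j \<noteq> \<zero>}"])
        (use direct_sum_memD(4)[OF f] inv in auto)
    then show "?s f \<in> carrier ?F"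
      using C[OF f] by (auto simp: free_module_def cong: conj_cong)
  qed auto
  have p: "?p \<in> mod_hom R ?F ?S"
    unfolding mod_hom_def
  proof (intro CollectI conjI ballI funcsetI)
    fix F assume F: "F \<in> carrier ?F"
    have "finite {i \<in> \<iota> ` J. F i \<noteq> \<zero>}" using F by (simp add: free_module_def)
    then have "finite (inv_into UNIV \<iota> ` {i \<in> \<iota> ` J. F i \<noteq> \<zero>})" by simp
    moreover have "{j. ?p F j \<noteq> \<zero>} \<subseteq> inv_into UNIV \<iota> ` {i \<in> \<iota> ` J. F i \<noteq> \<zero>}"
    proof
      fix j assume "j \<in> {j. ?p F j \<noteq> \<zero>}"
      then have "j \<in> J" "F (\<iota> j) \<noteq> \<zero>" using g by (auto split: if_splits)
      then show "j \<in> inv_into UNIV \<iota> ` {i \<in> \<iota> ` J. F i \<noteq> \<zero>}"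
        by (intro image_eqI[of _ _ "\<iota> j"]) (auto simp: inv)
    qed
    ultimately have "finite {j. ?p F j \<noteq> \<zero>}" by (rule rev_finite_subset)
    then show "?p F \<in> carrier ?S" 
      using FC[OF F] g by (auto simp: direct_sum_def m_assoc)
  next
    fix F F' assume F: "F \<in> carrier ?F" "F' \<in> carrier ?F"
    show "?p (F \<oplus>\<^bsub>?F\<^esub> F') = ?p F \<oplus>\<^bsub>?S\<^esub> ?p F'"
      using FC[OF F(1)] FC[OF F(2)] g by (auto simp: l_distr)
  next
    fix r F assume F: "r \<in> carrier R" "F \<in> carrier ?F"
    show "?p (r \<odot>\<^bsub>?F\<^esub> F) = r \<odot>\<^bsub>?S\<^esub> ?p F"
      using FC[OF F(2)] F(1) g by (auto simp: m_assoc)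
  qed
  have "?p (?s f) = f" if "f \<in> carrier ?S" for f
    using direct_sum_memD[OF that] by (auto simp: inv)
  then show ?thesis
    unfolding projective_def using s p left_module_direct_sum[of J g] g by blast
qed

section \<open>Coordinates over a central field\<close>

locale central_scalars = coefficient_ring R for R :: "'a ring" (structure) +
  fixes \<kappa> :: "'k::field \<Rightarrow> 'a"
  assumes scalar_closed [simp, intro]: "\<kappa> l \<in> carrier R"
    and scalar_add: "\<kappa> (l + m) = \<kappa> l \<oplus> \<kappa> m"
    and scalar_mult: "\<kappa> (l * m) = \<kappa> l \<otimes> \<kappa> m"
    and scalar_one [simp]: "\<kappa> 1 = \<one>"
    and scalar_central: "r \<in> carrier R \<Longrightarrow> r \<otimes> \<kappa> l = \<kappa> l \<otimes> r"
begin

lemma scalar_zero [simp]: "\<kappa> 0 = \<zero>"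
  by (rule eq_zero_if_double) (use scalar_add[of 0 0] in simp_all)

end

locale scalar_module = left_module R M + central_scalars R \<kappa>
  for R :: "'a ring" (structure) and M :: "('a, 'm) module" (structure) and \<kappa> :: "'k::field \<Rightarrow> 'a"
begin

definition coefficients :: "'m set \<Rightarrow> ('m \<Rightarrow> 'k) set" where
  "coefficients B = {f. finite {b. f b \<noteq> 0} \<and> {b. f b \<noteq> 0} \<subseteq> B}"

definition linear_combination :: "('m \<Rightarrow> 'k) \<Rightarrow> 'm" where
  "linear_combination f = combination R M (\<lambda>b. b) (\<lambda>b. \<kappa> (f b))"

definition independent :: "'m set \<Rightarrow> bool" where
  "independent B \<longleftrightarrow> (\<forall>f\<in>coefficients B. linear_combination f = \<zero>\<^bsub>M\<^esub> \<longrightarrow> f = (\<lambda>_. 0))"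

lemma coefficients_mono: "f \<in> coefficients B \<Longrightarrow> B \<subseteq> D \<Longrightarrow> f \<in> coefficients D"
  by (auto simp: coefficients_def)

lemma coefficients_add:
  assumes "f \<in> coefficients B" "f' \<in> coefficients B"
  shows "(\<lambda>b. f b + f' b) \<in> coefficients B"
proof -
  have "{b. f b + f' b \<noteq> 0} \<subseteq> {b. f b \<noteq> 0} \<union> {b. f' b \<noteq> 0}" by auto
  moreover have "finite ({b. f b \<noteq> 0} \<union> {b. f' b \<noteq> 0})" "{b. f b \<noteq> 0} \<union> {b. f' b \<noteq> 0} \<subseteq> B"
    using assms by (auto simp: coefficients_def)
  ultimately show ?thesis unfolding coefficients_def using finite_subset by blast
qed

lemma coefficients_scale:
  assumes "f \<in> coefficients B"
  shows "(\<lambda>b. l * f b) \<in> coefficients B"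
proof -
  have "finite {b. l * f b \<noteq> 0}"
    by (rule finite_subset[of _ "{b. f b \<noteq> 0}"]) (use assms in \<open>auto simp: coefficients_def\<close>)
  then show ?thesis using assms by (auto simp: coefficients_def)
qed

lemma coefficients_single: "b \<in> B \<Longrightarrow> single b \<in> coefficients B"
proof -
  assume "b \<in> B"
  moreover have "{i. single b i \<noteq> (0::'k)} = {b}" by (auto simp: single_def)
  ultimately show ?thesis by (auto simp: coefficients_def)
qed

lemma scalar_coefficients:
  assumes "f \<in> coefficients (carrier M)"
  shows "(\<lambda>b. \<kappa> (f b)) \<in> carrier (direct_sum R (carrier M) (\<lambda>_. \<one>))"
proof -
  have "finite {b. \<kappa> (f b) \<noteq> \<zero>}"
    by (rule finite_subset[of _ "{b. f b \<noteq> 0}"])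
      (use assms in \<open>auto simp: coefficients_def intro: ccontr\<close>)
  moreover have "f b = 0" if "b \<notin> carrier M" for b using assms that by (auto simp: coefficients_def)
  ultimately show ?thesis by (auto simp: direct_sum_def)
qed

lemma combination_id_hom:
  "combination R M (\<lambda>b. b) \<in> mod_hom R (direct_sum R (carrier M) (\<lambda>_. \<one>)) M"
  by (rule combination_hom) auto

lemma linear_combination_closed:
  "f \<in> coefficients (carrier M) \<Longrightarrow> linear_combination f \<in> carrier M"
  unfolding linear_combination_def
  by (rule mod_homD(1)[OF combination_id_hom scalar_coefficients])

lemma linear_combination_add:
  assumes "f \<in> coefficients (carrier M)" "f' \<in> coefficients (carrier M)"
  shows "linear_combination (\<lambda>b. f b + f' b) = linear_combination f \<oplus>\<^bsub>M\<^esub> linear_combination f'"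
  using mod_homD(2)[OF combination_id_hom assms[THEN scalar_coefficients]]
  by (simp add: linear_combination_def scalar_add)

lemma linear_combination_scale:
  assumes "f \<in> coefficients (carrier M)"
  shows "linear_combination (\<lambda>b. l * f b) = \<kappa> l \<odot>\<^bsub>M\<^esub> linear_combination f"
  using mod_homD(3)[OF combination_id_hom _ assms[THEN scalar_coefficients], of "\<kappa> l"]
  by (simp add: linear_combination_def scalar_mult)

lemma linear_combination_single:
  assumes "b \<in> carrier M"
  shows "linear_combination (single b) = b"
proof -
  have "(\<lambda>i. \<kappa> (single b i)) = elem_at R b \<one>" by (auto simp: single_def elem_at_def)
  then show ?thesis
    using assms by (simp add: linear_combination_def combination_elem_at smult_one)
qed

lemma independent_unique:
  assumes "independent B" "B \<subseteq> carrier M" "f \<in> coefficients B" "f' \<in> coefficients B"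
    and eq: "linear_combination f = linear_combination f'"
  shows "f = f'"
proof -
  let ?h = "\<lambda>b. f b + (- 1) * f' b" and ?y = "linear_combination f'"
  have f: "f \<in> coefficients (carrier M)" "f' \<in> coefficients (carrier M)"
    using assms coefficients_mono by blast+
  note f2 = coefficients_scale[OF f(2), of "-1"]
  have y: "?y \<in> carrier M" using f linear_combination_closed by auto
  have "linear_combination ?h = linear_combination f \<oplus>\<^bsub>M\<^esub> linear_combination (\<lambda>b. (- 1) * f' b)"
    by (rule linear_combination_add[OF f(1) f2])
  also have "linear_combination (\<lambda>b. (- 1) * f' b) = \<kappa> (- 1) \<odot>\<^bsub>M\<^esub> ?y"
    by (rule linear_combination_scale[OF f(2)])
  also have "linear_combination f \<oplus>\<^bsub>M\<^esub> \<kappa> (- 1) \<odot>\<^bsub>M\<^esub> ?y = \<kappa> 1 \<odot>\<^bsub>M\<^esub> ?y \<oplus>\<^bsub>M\<^esub> \<kappa> (- 1) \<odot>\<^bsub>M\<^esub> ?y"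
    using eq y by (simp add: smult_one)
  also have "\<dots> = \<kappa> (1 + - 1) \<odot>\<^bsub>M\<^esub> ?y"
    unfolding scalar_add using y by (intro smult_l_distr[symmetric]) auto
  also have "\<dots> = \<zero>\<^bsub>M\<^esub>" using y by (simp add: smult_l_null)
  finally have "linear_combination ?h = \<zero>\<^bsub>M\<^esub>" .
  moreover have "?h \<in> coefficients B"
    using coefficients_add[OF assms(3) coefficients_scale[OF assms(4), of "-1"]] .
  ultimately have "?h = (\<lambda>_. 0)" using assms(1) unfolding independent_def by blast
  then have "\<And>b. f b + (- 1) * f' b = 0" by meson
  then show ?thesis by auto
qed

lemma independent_insert:
  assumes B: "independent B" "B \<subseteq> carrier M" and v: "v \<in> carrier M"
    and notin: "\<And>f. f \<in> coefficients B \<Longrightarrow> linear_combination f \<noteq> v"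
  shows "independent (insert v B)"
  unfolding independent_def
proof (intro ballI impI)
  fix f assume f: "f \<in> coefficients (insert v B)" and f0: "linear_combination f = \<zero>\<^bsub>M\<^esub>"
  let ?g = "\<lambda>b. f b + (- f v) * single v b"
  have fM: "f \<in> coefficients (carrier M)" using f B v coefficients_mono[of f "insert v B" "carrier M"] by auto
  have sM: "single v \<in> coefficients (carrier M)" using v by (rule coefficients_single)
  have "?g \<in> coefficients (insert v B)"
    by (intro coefficients_add f coefficients_scale coefficients_single) auto
  moreover have "?g v = 0" by (simp add: single_def)
  ultimately have g: "?g \<in> coefficients B" by (auto simp: coefficients_def)
  show "f = (\<lambda>_. 0)"
  proof (cases "f v = 0")
    case True
    then have "f \<in> coefficients B" using f by (auto simp: coefficients_def)
    then show ?thesis using f0 B by (auto simp: independent_def)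
  next
    case False
    have gM: "?g \<in> coefficients (carrier M)" using g B coefficients_mono by blast
    have "linear_combination ?g = linear_combination f \<oplus>\<^bsub>M\<^esub> linear_combination (\<lambda>b. (- f v) * single v b)"
      by (intro linear_combination_add fM coefficients_scale sM)
    also have "\<dots> = \<kappa> (- f v) \<odot>\<^bsub>M\<^esub> v"
      using f0 v by (subst linear_combination_scale[OF sM])
        (simp add: linear_combination_single smult_closed)
    finally have "linear_combination ?g = \<kappa> (- f v) \<odot>\<^bsub>M\<^esub> v" .
    then have "linear_combination (\<lambda>b. (- inverse (f v)) * ?g b) = \<kappa> (- inverse (f v)) \<odot>\<^bsub>M\<^esub> (\<kappa> (- f v) \<odot>\<^bsub>M\<^esub> v)"
      by (subst linear_combination_scale[OF gM]) simp
    also have "\<dots> = \<kappa> ((- inverse (f v)) * (- f v)) \<odot>\<^bsub>M\<^esub> v"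
      unfolding scalar_mult using v by (intro smult_assoc[symmetric]) auto
    also have "\<dots> = v" using False v by (simp add: smult_one)
    finally show ?thesis using notin[OF coefficients_scale[OF g]] by blast
  qed
qed

text \<open>
  Zorn's lemma: a maximal independent subset of \<open>V\<close> spans, for a vector outside its span could be
  added to it.
\<close>

lemma basis_exists:
  assumes V: "V \<subseteq> carrier M"
  obtains B where "B \<subseteq> V" "independent B" "\<And>v. v \<in> V \<Longrightarrow> \<exists>f\<in>coefficients B. linear_combination f = v"
proof -
  let ?Z = "{B. B \<subseteq> V \<and> independent B}"
  have "{} \<in> ?Z" by (auto simp: independent_def coefficients_def)
  moreover have "\<Union>\<C> \<in> ?Z" if chain: "\<C> \<noteq> {}" "subset.chain ?Z \<C>" for \<C>
  proof -
    have sub: "\<C> \<subseteq> ?Z" using chain(2) by (auto simp: subset.chain_def)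
    have "independent (\<Union>\<C>)"
      unfolding independent_def
    proof (intro ballI impI)
      fix f assume f: "f \<in> coefficients (\<Union>\<C>)" "linear_combination f = \<zero>\<^bsub>M\<^esub>"
      have "finite {b. f b \<noteq> 0}" "{b. f b \<noteq> 0} \<subseteq> \<Union>\<C>"
        using f(1) by (auto simp: coefficients_def)
      then obtain B where B: "B \<in> \<C>" "{b. f b \<noteq> 0} \<subseteq> B"
        by (rule finite_subset_Union_chain[OF _ _ chain])
      then have "f \<in> coefficients B" "independent B" using f sub by (auto simp: coefficients_def)
      with f(2) show "f = (\<lambda>_. 0)" by (auto simp: independent_def)
    qed
    then show ?thesis using sub by auto
  qed
  ultimately have "\<exists>B\<in>?Z. \<forall>D\<in>?Z. B \<subseteq> D \<longrightarrow> D = B"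
    by (intro subset_Zorn_nonempty) auto
  then obtain B where "B \<in> ?Z" and max: "\<forall>D\<in>?Z. B \<subseteq> D \<longrightarrow> D = B"
    by (rule bexE)
  then have B: "B \<subseteq> V" "independent B" by auto
  have "\<exists>f\<in>coefficients B. linear_combination f = v" if v: "v \<in> V" for v
  proof (rule ccontr)
    assume *: "\<not> ?thesis"
    have "independent (insert v B)"
    proof (rule independent_insert[OF B(2)])
      show "linear_combination f \<noteq> v" if "f \<in> coefficients B" for f
        using that * by blast
    qed (use B(1) V v in auto)
    then have "insert v B \<in> ?Z" using B(1) v by simp
    with max have "insert v B = B" by blast
    then have "v \<in> B" by auto
    then show False
      using * coefficients_single[of v B] linear_combination_single[of v] V v by auto
  qed
  then show ?thesis by (rule that[OF B])
qed

text \<open>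
  \<open>B\<close> is a basis of the subspace \<open>V\<close> and \<open>coord v\<close> lists the coordinates of \<open>v\<close>.
\<close>

definition coordinate_system :: "'m set \<Rightarrow> 'm set \<Rightarrow> ('m \<Rightarrow> 'm \<Rightarrow> 'k) \<Rightarrow> bool" where
  "coordinate_system V B coord \<longleftrightarrow> B \<subseteq> V \<and>
    (\<forall>v\<in>V. coord v \<in> coefficients B \<and> linear_combination (coord v) = v) \<and>
    (\<forall>v\<in>V. \<forall>w\<in>V. coord (v \<oplus>\<^bsub>M\<^esub> w) = (\<lambda>b. coord v b + coord w b)) \<and>
    (\<forall>v\<in>V. \<forall>l. coord (\<kappa> l \<odot>\<^bsub>M\<^esub> v) = (\<lambda>b. l * coord v b)) \<and>
    (\<forall>b\<in>B. coord b = single b)"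

lemma coordinate_systemD:
  assumes "coordinate_system V B coord"
  shows "B \<subseteq> V"
    and "v \<in> V \<Longrightarrow> coord v \<in> coefficients B"
    and "v \<in> V \<Longrightarrow> linear_combination (coord v) = v"
    and "v \<in> V \<Longrightarrow> w \<in> V \<Longrightarrow> coord (v \<oplus>\<^bsub>M\<^esub> w) = (\<lambda>b. coord v b + coord w b)"
    and "v \<in> V \<Longrightarrow> coord (\<kappa> l \<odot>\<^bsub>M\<^esub> v) = (\<lambda>b. l * coord v b)"
    and "b \<in> B \<Longrightarrow> coord b = single b"
  using assms unfolding coordinate_system_def by blast+

lemma coordinate_system_exists:
  assumes V: "V \<subseteq> carrier M"
    and V_add: "\<And>v w. v \<in> V \<Longrightarrow> w \<in> V \<Longrightarrow> v \<oplus>\<^bsub>M\<^esub> w \<in> V"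
    and V_scale: "\<And>l v. v \<in> V \<Longrightarrow> \<kappa> l \<odot>\<^bsub>M\<^esub> v \<in> V"
  shows "\<exists>B coord. coordinate_system V B coord"
proof -
  obtain B where B: "B \<subseteq> V" "independent B"
      "\<And>v. v \<in> V \<Longrightarrow> \<exists>f\<in>coefficients B. linear_combination f = v"
    using basis_exists[OF V] by blast
  have BM: "B \<subseteq> carrier M" using B(1) V by auto
  obtain coord where c: "\<And>v. v \<in> V \<Longrightarrow> coord v \<in> coefficients B"
      "\<And>v. v \<in> V \<Longrightarrow> linear_combination (coord v) = v"
    using B(3) by metis
  have cM: "coord v \<in> coefficients (carrier M)" if "v \<in> V" for v
    using c(1)[OF that] BM coefficients_mono by blast
  note u = independent_unique[OF B(2) BM]
  have "coordinate_system V B coord"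
    unfolding coordinate_system_def
  proof (intro conjI ballI allI)
    show "coord (v \<oplus>\<^bsub>M\<^esub> w) = (\<lambda>b. coord v b + coord w b)" if "v \<in> V" "w \<in> V" for v w
      by (rule u) (use that in \<open>auto simp: c V_add linear_combination_add[OF cM cM] intro!: coefficients_add\<close>)
    show "coord (\<kappa> l \<odot>\<^bsub>M\<^esub> v) = (\<lambda>b. l * coord v b)" if "v \<in> V" for l v
      by (rule u) (use that in \<open>auto simp: c V_scale linear_combination_scale[OF cM] intro!: coefficients_scale\<close>)
    show "coord b = single b" if "b \<in> B" for b
      by (rule u) (use that subsetD[OF B(1) that] BM in
            \<open>auto simp: c linear_combination_single intro!: coefficients_single\<close>)
  qed (use B(1) c in auto)
  then show ?thesis by blast
qed

text \<open>
  If \<open>u\<close> acts on \<open>M\<close> as the identity and \<open>R u = k u\<close>, then \<open>r y = r u y\<close> shows that \<open>R\<close> acts on \<open>M\<close>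
  through scalars.  So \<open>y \<mapsto> \<Sum>\<^sub>b y\<^sub>b u\<close>, with \<open>y\<^sub>b\<close> the coordinates of \<open>y\<close> in a basis of \<open>M\<close> over
  \<open>k\<close>, is a homomorphism into the free module on that basis, and \<open>F \<mapsto> \<Sum>\<^sub>b F\<^sub>b b\<close> takes it back to
  \<open>y\<close>, because \<open>u b = b\<close>.
\<close>

lemma projective_if_idempotent_acts_as_identity:
  assumes u: "u \<in> carrier R" and Ru: "\<And>r. r \<in> carrier R \<Longrightarrow> \<exists>l. r \<otimes> u = \<kappa> l \<otimes> u"
    and act: "\<And>y. y \<in> carrier M \<Longrightarrow> u \<odot>\<^bsub>M\<^esub> y = y"
  shows "projective R M"
proof -
  obtain B coord where "coordinate_system (carrier M) B coord"
    using coordinate_system_exists[of "carrier M"] smult_closed by auto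
  note B = coordinate_systemD(1)[OF this] and c = coordinate_systemD(2-5)[OF this]
  let ?s = "\<lambda>y b. \<kappa> (coord y b) \<otimes> u" and ?p = "combination R M (\<lambda>b. b)"
  have supp: "finite {b. coord y b \<noteq> 0}" "{b. coord y b \<noteq> 0} \<subseteq> B" if "y \<in> carrier M" for y
    using c(1)[OF that] by (auto simp: coefficients_def)
  have supp': "{b. ?s y b \<noteq> \<zero>} \<subseteq> {b. coord y b \<noteq> 0}" for y
    using u by auto
  have "?s \<in> mod_hom R M (free_module R B)"
    unfolding mod_hom_def
  proof (intro CollectI conjI ballI funcsetI)
    fix y assume y: "y \<in> carrier M"
    have "finite {b \<in> B. ?s y b \<noteq> \<zero>}"
      by (rule finite_subset[OF _ supp(1)[OF y]]) (use supp'[of y] in auto)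
    moreover have "?s y b = \<zero>" if "b \<notin> B" for b
      using that supp(2)[OF y] supp'[of y] by blast
    ultimately show "?s y \<in> carrier (free_module R B)" using u by (auto simp: free_module_def)
    fix r assume r: "r \<in> carrier R"
    then obtain l where l: "r \<otimes> u = \<kappa> l \<otimes> u" using Ru by blast
    have "r \<odot>\<^bsub>M\<^esub> y = r \<odot>\<^bsub>M\<^esub> (u \<odot>\<^bsub>M\<^esub> y)" using act y by simp
    also have "\<dots> = \<kappa> l \<odot>\<^bsub>M\<^esub> (u \<odot>\<^bsub>M\<^esub> y)" 
      using r u y by (simp add: smult_assoc[symmetric] l)
    finally have "r \<odot>\<^bsub>M\<^esub> y = \<kappa> l \<odot>\<^bsub>M\<^esub> y" using act y by simp
    moreover have "\<kappa> (l * k) \<otimes> u = r \<otimes> (\<kappa> k \<otimes> u)" for k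
    proof -
      have "\<kappa> (l * k) \<otimes> u = \<kappa> k \<otimes> (\<kappa> l \<otimes> u)"
        using u by (simp add: mult.commute[of l] scalar_mult m_assoc)
      also have "\<dots> = r \<otimes> (\<kappa> k \<otimes> u)"
        unfolding l[symmetric] using r u by (simp add: m_assoc[symmetric] scalar_central)
      finally show ?thesis .
    qed
    ultimately show "?s (r \<odot>\<^bsub>M\<^esub> y) = r \<odot>\<^bsub>free_module R B\<^esub> ?s y"
      using y by (simp add: c)
  qed (use u in \<open>auto simp: c scalar_add l_distr\<close>)
  moreover have "?p \<in> mod_hom R (free_module R B) M"
    unfolding direct_sum_one[symmetric] by (rule combination_hom) (use B in auto)
  moreover have "?p (?s y) = y" if y: "y \<in> carrier M" for y
  proof -
    have b: "b \<in> carrier M" if "coord y b \<noteq> 0" for b using that supp(2)[OF y] B by auto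
    have "?p (?s y) = finsum M (\<lambda>b. ?s y b \<odot>\<^bsub>M\<^esub> b) {b. coord y b \<noteq> 0}"
      by (rule combination_superset) (use supp'[of y] supp[OF y] u b in auto)
    also have "\<dots> = finsum M (\<lambda>b. \<kappa> (coord y b) \<odot>\<^bsub>M\<^esub> b) {b. coord y b \<noteq> 0}"
      by (rule M.finsum_cong') (auto simp: u b smult_assoc act smult_closed)
    also have "\<dots> = linear_combination (coord y)"
      unfolding linear_combination_def
      by (rule combination_superset[symmetric]) (use supp[OF y] b in auto)
    finally show ?thesis using c y by simp
  qed
  ultimately show ?thesis unfolding projective_def using left_module_axioms by blast
qed

end

section \<open>Algebras layered along a sequence of vertices\<close>

text \<open>
  The traces left in a ring by a quiver with vertices \<open>1, \<dots>, n\<close> whose arrows raise the vertex by one: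
  \<open>e v\<close> is the path of length 0 at \<open>v\<close>, and \<open>x c\<close> is the arrow \<open>c\<close> from \<open>t c\<close> to \<open>Suc (t c)\<close>.  Arrows
  are numbered, because the elements of \<open>P\<^sub>1\<close> below must be functions on \<open>nat \<times> 'm\<close>.  The last
  assumption says that an element ending at \<open>v\<close> is, up to a multiple of \<open>e v\<close>, a sum of elements with
  a last arrow.
\<close>

locale layered_algebra = central_scalars R \<kappa>
  for R :: "'a ring" (structure) and \<kappa> :: "'k::field \<Rightarrow> 'a" +
  fixes n :: nat and e :: "nat \<Rightarrow> 'a" and C :: "nat set" and t :: "nat \<Rightarrow> nat" and x :: "nat \<Rightarrow> 'a"
  assumes vertex_exists: "1 \<le> n"
    and idem_closed: "v \<in> {1..n} \<Longrightarrow> e v \<in> carrier R"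
    and idem: "v \<in> {1..n} \<Longrightarrow> e v \<otimes> e v = e v"
    and idem_orth: "u \<in> {1..n} \<Longrightarrow> v \<in> {1..n} \<Longrightarrow> u \<noteq> v \<Longrightarrow> e u \<otimes> e v = \<zero>"
    and idem_sum: "finsum R e {1..n} = \<one>"
    and finite_arrows: "finite C"
    and tail_range: "c \<in> C \<Longrightarrow> t c \<in> {1..<n}"
    and arrow_closed: "c \<in> C \<Longrightarrow> x c \<in> carrier R"
    and arrow_tail: "c \<in> C \<Longrightarrow> e (t c) \<otimes> x c = x c"
    and arrow_head: "c \<in> C \<Longrightarrow> x c \<otimes> e (Suc (t c)) = x c"
    and last_arrow_span: "v \<in> {1..n} \<Longrightarrow> r \<in> carrier R \<Longrightarrow> r \<otimes> e v = r \<Longrightarrow>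
      \<exists>l \<alpha>. (\<forall>c\<in>{c\<in>C. Suc (t c) = v}. \<alpha> c \<in> carrier R \<and> \<alpha> c \<otimes> e (t c) = \<alpha> c) \<and>
        r = \<kappa> l \<otimes> e v \<oplus> finsum R (\<lambda>c. \<alpha> c \<otimes> x c) {c\<in>C. Suc (t c) = v}"

context layered_algebra
begin

lemma one_vertex: "1 \<in> {1..n}" using vertex_exists by auto

text \<open>
  No arrow ends at the vertex 1, so that nothing but the path of length 0 can end there.
\<close>

lemma first_idem_scalar:
  assumes "r \<in> carrier R"
  shows "\<exists>l. r \<otimes> e 1 = \<kappa> l \<otimes> e 1"
proof -
  note e1 = idem_closed[OF one_vertex]
  have S: "{c\<in>C. Suc (t c) = 1} = {}" using tail_range by force
  have "r \<otimes> e 1 \<otimes> e 1 = r \<otimes> e 1" using assms e1 by (simp add: m_assoc idem[OF one_vertex] del: One_nat_def)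
  then show ?thesis
    using last_arrow_span[OF one_vertex m_closed[OF assms e1]] e1 unfolding S by auto
qed

end

text \<open>
  Splitting off the last arrow is unique at every vertex except the last one, where the ambiguity is
  confined to elements that start at the vertex 1.
\<close>

locale almost_hereditary_algebra = layered_algebra +
  assumes last_arrow_relation:
    "v \<in> {1..n} \<Longrightarrow>
      (\<forall>c\<in>{c\<in>C. Suc (t c) = v}. \<alpha> c \<in> carrier R \<and> \<alpha> c \<otimes> e (t c) = \<alpha> c) \<Longrightarrow>
      finsum R (\<lambda>c. \<alpha> c \<otimes> x c) {c\<in>C. Suc (t c) = v} = \<zero> \<Longrightarrow>
      c \<in> C \<Longrightarrow> Suc (t c) = v \<Longrightarrow> e 1 \<otimes> \<alpha> c = \<alpha> c \<and> (v < n \<longrightarrow> \<alpha> c = \<zero>)"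

text \<open>
  Here splitting off the last arrow is unique throughout, as in a path algebra without relations.
\<close>

locale hereditary_layered_algebra = layered_algebra +
  assumes last_arrow_free:
    "v \<in> {1..n} \<Longrightarrow>
      (\<forall>c\<in>{c\<in>C. Suc (t c) = v}. \<alpha> c \<in> carrier R \<and> \<alpha> c \<otimes> e (t c) = \<alpha> c) \<Longrightarrow>
      finsum R (\<lambda>c. \<alpha> c \<otimes> x c) {c\<in>C. Suc (t c) = v} = \<zero> \<Longrightarrow>
      c \<in> C \<Longrightarrow> Suc (t c) = v \<Longrightarrow> \<alpha> c = \<zero>"

section \<open>A resolution of length two\<close>

locale layered_module = left_module R M + almost_hereditary_algebra R \<kappa>
  for R :: "'a ring" (structure) and \<kappa> :: "'k::field \<Rightarrow> 'a" and M :: "('a, 'm) module" (structure)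
begin

sublocale scalar_module R M \<kappa> ..

definition vertex_space :: "nat \<Rightarrow> 'm set" where
  "vertex_space v = {y \<in> carrier M. e v \<odot>\<^bsub>M\<^esub> y = y}"

lemma vertex_space_coordinates:
  assumes "v \<in> {1..n}"
  shows "\<exists>B coord. coordinate_system (vertex_space v) B coord"
proof (rule coordinate_system_exists)
  note ev = idem_closed[OF assms]
  show "vertex_space v \<subseteq> carrier M" by (auto simp: vertex_space_def)
  show "\<kappa> l \<odot>\<^bsub>M\<^esub> y \<in> vertex_space v" if "y \<in> vertex_space v" for l y
  proof -
    have y: "y \<in> carrier M" "e v \<odot>\<^bsub>M\<^esub> y = y" using that by (auto simp: vertex_space_def)
    have "e v \<odot>\<^bsub>M\<^esub> (\<kappa> l \<odot>\<^bsub>M\<^esub> y) = \<kappa> l \<odot>\<^bsub>M\<^esub> (e v \<odot>\<^bsub>M\<^esub> y)"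
      using y(1) ev by (simp add: smult_assoc[symmetric] scalar_central)
    then show ?thesis using y by (simp add: vertex_space_def smult_closed)
  qed
  show "y \<oplus>\<^bsub>M\<^esub> z \<in> vertex_space v" if "y \<in> vertex_space v" "z \<in> vertex_space v" for y z
    using that ev by (auto simp: vertex_space_def smult_r_distr)
qed

definition basis_coord :: "nat \<Rightarrow> 'm set \<times> ('m \<Rightarrow> 'm \<Rightarrow> 'k)" where
  "basis_coord v = (SOME p. coordinate_system (vertex_space v) (fst p) (snd p))"

abbreviation "basis v \<equiv> fst (basis_coord v)"
abbreviation "coord v \<equiv> snd (basis_coord v)"

lemma coordinate_system_basis_coord:
  assumes "v \<in> {1..n}"
  shows "coordinate_system (vertex_space v) (basis v) (coord v)"
proof -
  have "\<exists>p. coordinate_system (vertex_space v) (fst p) (snd p)"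
    using vertex_space_coordinates[OF assms] by simp
  from someI_ex[OF this] show ?thesis unfolding basis_coord_def .
qed

lemmas basis_coord = coordinate_systemD[OF coordinate_system_basis_coord]

lemma basis_closed: "v \<in> {1..n} \<Longrightarrow> b \<in> basis v \<Longrightarrow> b \<in> carrier M"
  using basis_coord(1) by (auto simp: vertex_space_def)

lemma idem_basis: "v \<in> {1..n} \<Longrightarrow> b \<in> basis v \<Longrightarrow> e v \<odot>\<^bsub>M\<^esub> b = b"
  using basis_coord(1) by (auto simp: vertex_space_def)

lemma coord_zero:
  assumes "v \<in> {1..n}"
  shows "coord v \<zero>\<^bsub>M\<^esub> = (\<lambda>_. 0)"
proof -
  have z: "\<zero>\<^bsub>M\<^esub> \<in> vertex_space v" using idem_closed[OF assms] by (simp add: vertex_space_def smult_r_null)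
  show ?thesis using basis_coord(5)[OF assms z, of 0] by (simp add: smult_l_null)
qed

lemma idem_smult_vertex_space:
  assumes "v \<in> {1..n}" "y \<in> carrier M"
  shows "e v \<odot>\<^bsub>M\<^esub> y \<in> vertex_space v"
  using assms by (simp add: vertex_space_def smult_closed idem_closed idem smult_assoc[symmetric])

lemma other_idem_vertex_space:
  assumes "u \<in> {1..n}" "v \<in> {1..n}" "u \<noteq> v" "y \<in> vertex_space v"
  shows "e u \<odot>\<^bsub>M\<^esub> y = \<zero>\<^bsub>M\<^esub>"
proof -
  have "e u \<odot>\<^bsub>M\<^esub> y = (e u \<otimes> e v) \<odot>\<^bsub>M\<^esub> y"
    using assms by (simp add: smult_assoc idem_closed vertex_space_def)
  then show ?thesis using assms by (simp add: idem_orth smult_l_null vertex_space_def)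
qed

text \<open>
  The module \<open>P\<^sub>0 = \<Oplus>\<^sub>v R e\<^sub>v \<otimes> V\<^sub>v\<close>, with a copy of \<open>R e\<^sub>v\<close> for each element \<open>b\<close> of the basis of \<open>V\<^sub>v\<close>.
\<close>

definition "index0 = {(v, b). v \<in> {1..n} \<and> b \<in> basis v}"
definition "idem0 = (\<lambda>(v :: nat, b :: 'm). e v)"
definition "P0 = direct_sum R index0 idem0"
definition "\<epsilon> = combination R M (snd :: nat \<times> 'm \<Rightarrow> 'm)"

text \<open>
  The element \<open>\<Sum>\<^sub>v e\<^sub>v \<otimes> e\<^sub>v y\<close> of \<open>P\<^sub>0\<close>, written in the chosen bases.  It is a preimage of \<open>y\<close> that is
  additive in \<open>y\<close>, though not a homomorphism of modules.
\<close>

definition splitting :: "'m \<Rightarrow> nat \<times> 'm \<Rightarrow> 'a" where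
  "splitting y = (\<lambda>(v, b). if v \<in> {1..n} then \<kappa> (coord v (e v \<odot>\<^bsub>M\<^esub> y) b) \<otimes> e v else \<zero>)"

text \<open>
  Likewise \<open>P\<^sub>1 = \<Oplus>\<^sub>c R e\<^sub>t\<^sub>c \<otimes> V\<^sub>h\<^sub>c\<close>.  The differential sends \<open>e\<^sub>t\<^sub>c \<otimes> b\<close> to \<open>x\<^sub>c \<otimes> b - e\<^sub>t\<^sub>c \<otimes> x\<^sub>c b\<close>,
  where the last term is the splitting of \<open>x\<^sub>c b \<in> V\<^sub>t\<^sub>c\<close>.
\<close>

definition "index1 = {(c, b). c \<in> C \<and> b \<in> basis (Suc (t c))}"
definition "idem1 = (\<lambda>(c :: nat, b :: 'm). e (t c))"
definition "P1 = direct_sum R index1 idem1"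
definition "generator1 = (\<lambda>(c, b). elem_at R (Suc (t c), b) (x c) \<ominus>\<^bsub>P0\<^esub> splitting (x c \<odot>\<^bsub>M\<^esub> b))"
definition "d0 = combination R P0 generator1"

lemma tail_head_range: "c \<in> C \<Longrightarrow> t c \<in> {1..n}" "c \<in> C \<Longrightarrow> Suc (t c) \<in> {1..n}"
  using tail_range[of c] by auto

lemma idem0_closed: "j \<in> index0 \<Longrightarrow> idem0 j \<in> carrier R"
  by (auto simp: index0_def idem0_def idem_closed)

lemma idem0_funcset: "idem0 \<in> index0 \<rightarrow> carrier R"
  using idem0_closed by auto

lemma idem1_closed: "j \<in> index1 \<Longrightarrow> idem1 j \<in> carrier R"
  using tail_head_range by (auto simp: index1_def idem1_def idem_closed)

lemma idem1_funcset: "idem1 \<in> index1 \<rightarrow> carrier R"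
  using idem1_closed by auto

sublocale P0: left_module R P0
  unfolding P0_def by (rule left_module_direct_sum) (rule idem0_closed)

sublocale P1: left_module R P1
  unfolding P1_def by (rule left_module_direct_sum) (rule idem1_closed)

lemma P0_simps [simp]:
  "zero P0 = (\<lambda>_. \<zero>)" "add P0 f f' = (\<lambda>i. f i \<oplus> f' i)" "smult P0 r f = (\<lambda>i. r \<otimes> f i)"
  by (simp_all add: P0_def)

lemma P1_simps [simp]:
  "zero P1 = (\<lambda>_. \<zero>)" "add P1 f f' = (\<lambda>i. f i \<oplus> f' i)" "smult P1 r f = (\<lambda>i. r \<otimes> f i)"
  by (simp_all add: P1_def)

lemma P0_minus: "f \<in> carrier P0 \<Longrightarrow> f' \<in> carrier P0 \<Longrightarrow> f \<ominus>\<^bsub>P0\<^esub> f' = (\<lambda>i. f i \<ominus> f' i)"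
  unfolding P0_def by (rule direct_sum_minus) (rule idem0_closed)

lemma P0_mem_carrier: "f \<in> carrier P0 \<Longrightarrow> f j \<in> carrier R"
  unfolding P0_def by (rule direct_sum_mem_carrier)

lemma P1_mem_carrier: "f \<in> carrier P1 \<Longrightarrow> f j \<in> carrier R"
  unfolding P1_def by (rule direct_sum_mem_carrier)

lemma elem_at_P0:
  assumes "v \<in> {1..n}" "b \<in> basis v" "r \<in> carrier R" "r \<otimes> e v = r"
  shows "elem_at R (v, b) r \<in> carrier P0"
  unfolding P0_def
  by (rule elem_at_mem_direct_sum) (use assms idem0_closed in \<open>auto simp: index0_def idem0_def\<close>)

lemma elem_at_P1:
  assumes "c \<in> C" "b \<in> basis (Suc (t c))" "r \<in> carrier R" "r \<otimes> e (t c) = r"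
  shows "elem_at R (c, b) r \<in> carrier P1"
  unfolding P1_def
  by (rule elem_at_mem_direct_sum) (use assms idem1_closed in \<open>auto simp: index1_def idem1_def\<close>)

lemma augmentation_hom: "\<epsilon> \<in> mod_hom R P0 M"
  unfolding \<epsilon>_def P0_def
  by (rule combination_hom) (use idem0_closed basis_closed in \<open>auto simp: index0_def\<close>)

lemma augmentation_elem_at:
  "r \<in> carrier R \<Longrightarrow> v \<in> {1..n} \<Longrightarrow> b \<in> basis v \<Longrightarrow> \<epsilon> (elem_at R (v, b) r) = r \<odot>\<^bsub>M\<^esub> b"
  unfolding \<epsilon>_def by (subst combination_elem_at) (auto simp: basis_closed)

lemma splitting_closed:
  assumes y: "y \<in> carrier M"
  shows "splitting y \<in> carrier P0"
proof -
  have co: "finite {b. coord v (e v \<odot>\<^bsub>M\<^esub> y) b \<noteq> 0}" "{b. coord v (e v \<odot>\<^bsub>M\<^esub> y) b \<noteq> 0} \<subseteq> basis v"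
    if "v \<in> {1..n}" for v
    using basis_coord(2)[OF that idem_smult_vertex_space[OF that y]] by (auto simp: coefficients_def)
  have "{j. splitting y j \<noteq> \<zero>} \<subseteq> (SIGMA v:{1..n}. {b. coord v (e v \<odot>\<^bsub>M\<^esub> y) b \<noteq> 0})"
    by (auto simp: splitting_def idem_closed split: if_splits)
  moreover have "finite (SIGMA v:{1..n}. {b. coord v (e v \<odot>\<^bsub>M\<^esub> y) b \<noteq> 0})"
    by (intro finite_SigmaI) (use co in auto)
  ultimately have "finite {j. splitting y j \<noteq> \<zero>}" by (rule finite_subset)
  moreover have "coord v (e v \<odot>\<^bsub>M\<^esub> y) b = 0" if "v \<in> {1..n}" "b \<notin> basis v" for v b
    using co[of v] that by blast
  ultimately show ?thesis
    by (auto simp: P0_def direct_sum_def splitting_def index0_def idem0_def idem_closed idem m_assoc)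
qed

lemma splitting_add:
  assumes "y \<in> carrier M" "z \<in> carrier M"
  shows "splitting (y \<oplus>\<^bsub>M\<^esub> z) = splitting y \<oplus>\<^bsub>P0\<^esub> splitting z"
proof -
  have "coord v (e v \<odot>\<^bsub>M\<^esub> (y \<oplus>\<^bsub>M\<^esub> z)) = (\<lambda>b. coord v (e v \<odot>\<^bsub>M\<^esub> y) b + coord v (e v \<odot>\<^bsub>M\<^esub> z) b)"
    if v: "v \<in> {1..n}" for v
    using assms basis_coord(4)[OF v idem_smult_vertex_space[OF v] idem_smult_vertex_space[OF v]]
    by (simp add: smult_r_distr idem_closed[OF v])
  then show ?thesis by (auto simp: splitting_def scalar_add l_distr idem_closed intro!: ext)
qed

lemma splitting_other_vertex:
  assumes "y \<in> vertex_space u" "u \<in> {1..n}" "v \<noteq> u"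
  shows "splitting y (v, b) = \<zero>"
  using assms other_idem_vertex_space[of v u y]
  by (auto simp: splitting_def coord_zero idem_closed)

lemma splitting_zero: "splitting \<zero>\<^bsub>M\<^esub> = (\<lambda>_. \<zero>)"
  by (auto simp: splitting_def smult_r_null coord_zero idem_closed intro!: ext)

lemma splitting_scalar_basis:
  assumes v: "v \<in> {1..n}" and b: "b \<in> basis v"
  shows "splitting (\<kappa> l \<odot>\<^bsub>M\<^esub> b) = elem_at R (v, b) (\<kappa> l \<otimes> e v)"
proof -
  have bV: "b \<in> vertex_space v" using basis_coord(1)[OF v] b by auto
  have kb: "e v \<odot>\<^bsub>M\<^esub> (\<kappa> l \<odot>\<^bsub>M\<^esub> b) = \<kappa> l \<odot>\<^bsub>M\<^esub> b"
    using bV v by (simp add: vertex_space_def idem_closed smult_assoc[symmetric] scalar_central)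
      (simp add: idem_closed smult_assoc)
  then have "\<kappa> l \<odot>\<^bsub>M\<^esub> b \<in> vertex_space v" using bV by (simp add: vertex_space_def smult_closed)
  then have "splitting (\<kappa> l \<odot>\<^bsub>M\<^esub> b) (u, b') = elem_at R (v, b) (\<kappa> l \<otimes> e v) (u, b')" for u b'
    using splitting_other_vertex[of "\<kappa> l \<odot>\<^bsub>M\<^esub> b" v u b'] v kb
    by (cases "u = v")
      (auto simp: splitting_def elem_at_def basis_coord(5)[OF v bV] basis_coord(6)[OF v b] single_def idem_closed)
  then show ?thesis by auto
qed

lemma augmentation_splitting_vertex_space:
  assumes v: "v \<in> {1..n}" and y: "y \<in> vertex_space v"
  shows "\<epsilon> (splitting y) = y"
proof -
  have co: "coord v y \<in> coefficients (basis v)" by (rule basis_coord(2)[OF v y])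
  let ?S = "{b. coord v y b \<noteq> 0}"
  have S: "finite ?S" "?S \<subseteq> basis v" using co by (auto simp: coefficients_def)
  have yM: "y \<in> carrier M" "e v \<odot>\<^bsub>M\<^esub> y = y" using y by (auto simp: vertex_space_def)
  have supp: "{j. splitting y j \<noteq> \<zero>} \<subseteq> Pair v ` ?S"
  proof clarify
    fix u b assume *: "splitting y (u, b) \<noteq> \<zero>"
    then have "u = v" using splitting_other_vertex[OF y v] by auto
    moreover from * this have "coord v y b \<noteq> 0"
      using v yM by (auto simp: splitting_def idem_closed)
    ultimately show "(u, b) \<in> Pair v ` ?S" by auto
  qed
  have "\<epsilon> (splitting y) = finsum M (\<lambda>j. splitting y j \<odot>\<^bsub>M\<^esub> snd j) (Pair v ` ?S)"
    unfolding \<epsilon>_def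
    by (rule combination_superset)
      (use S supp P0_mem_carrier[OF splitting_closed[OF yM(1)]] basis_closed[OF v] in auto)
  also have "\<dots> = finsum M (\<lambda>b. splitting y (v, b) \<odot>\<^bsub>M\<^esub> b) ?S"
    by (subst M.finsum_reindex)
      (use S P0_mem_carrier[OF splitting_closed[OF yM(1)]] basis_closed[OF v] in
        \<open>auto simp: inj_on_def intro!: smult_closed\<close>)
  also have "\<dots> = finsum M (\<lambda>b. \<kappa> (coord v y b) \<odot>\<^bsub>M\<^esub> b) ?S"
    by (rule M.finsum_cong')
      (use S v yM basis_closed[OF v] idem_basis[OF v] in
        \<open>auto simp: splitting_def smult_closed smult_assoc idem_closed subset_iff\<close>)
  also have "\<dots> = linear_combination (coord v y)"
    unfolding linear_combination_def
    by (rule combination_superset[symmetric]) (use S basis_closed[OF v] in auto)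
  also have "\<dots> = y" by (rule basis_coord(3)[OF v y])
  finally show ?thesis .
qed

lemma sum_idem_smult:
  assumes "y \<in> carrier M"
  shows "finsum M (\<lambda>v. e v \<odot>\<^bsub>M\<^esub> y) {1..n} = y"
  using finsum_smult[of "{1..n}" y e] assms by (simp add: idem_closed idem_sum smult_one Pi_def del: One_nat_def)

lemma augmentation_splitting:
  assumes y: "y \<in> carrier M"
  shows "\<epsilon> (splitting y) = y"
proof -
  let ?Q = "\<lambda>y. y \<in> carrier M \<and> \<epsilon> (splitting y) = y"
  note h = mod_homD[OF augmentation_hom]
  have "?Q (finsum M (\<lambda>v. e v \<odot>\<^bsub>M\<^esub> y) {1..n})"
  proof (rule M.finsum_closed_under_add)
    show "?Q \<zero>\<^bsub>M\<^esub>"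
      using mod_hom_zero[OF P0.left_module_axioms left_module_axioms augmentation_hom]
      by (simp add: splitting_zero)
    show "?Q (y \<oplus>\<^bsub>M\<^esub> z)" if "?Q y" "?Q z" for y z
      using that h(2)[OF splitting_closed splitting_closed] by (auto simp: splitting_add simp del: P0_simps)
    show "?Q (e v \<odot>\<^bsub>M\<^esub> y)" if "v \<in> {1..n}" for v
      using that y idem_smult_vertex_space[of v y]
      by (auto simp: augmentation_splitting_vertex_space smult_closed idem_closed)
  qed (use y in \<open>auto simp: smult_closed idem_closed\<close>)
  then show ?thesis using sum_idem_smult[OF y] by simp
qed

lemma arrow_basis:
  assumes "c \<in> C" "b \<in> basis (Suc (t c))"
  shows "x c \<odot>\<^bsub>M\<^esub> b \<in> vertex_space (t c)"
  using assms basis_closed[of "Suc (t c)" b] tail_head_range[OF assms(1)]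
  by (simp add: vertex_space_def smult_closed arrow_closed smult_assoc[symmetric] idem_closed arrow_tail)

lemma arrow_basis_closed:
  assumes "c \<in> C" "b \<in> basis (Suc (t c))"
  shows "x c \<odot>\<^bsub>M\<^esub> b \<in> carrier M"
  using arrow_basis[OF assms] by (simp add: vertex_space_def)

lemma elem_at_arrow:
  assumes "c \<in> C" "b \<in> basis (Suc (t c))"
  shows "elem_at R (Suc (t c), b) (x c) \<in> carrier P0"
  using assms tail_head_range[OF assms(1)] by (intro elem_at_P0) (auto simp: arrow_closed arrow_head)

lemma generator1_closed: "j \<in> index1 \<Longrightarrow> generator1 j \<in> carrier P0"
  unfolding index1_def generator1_def
  by (auto intro!: P0.M.minus_closed elem_at_arrow splitting_closed arrow_basis_closed)

lemma differential_hom: "d0 \<in> mod_hom R P1 P0"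
  unfolding d0_def P1_def by (rule P0.combination_hom) (auto intro: generator1_closed idem1_closed)

lemma differential_elem_at:
  assumes "c \<in> C" "b \<in> basis (Suc (t c))" "r \<in> carrier R"
  shows "d0 (elem_at R (c, b) r) = elem_at R (Suc (t c), b) (r \<otimes> x c) \<ominus>\<^bsub>P0\<^esub> r \<odot>\<^bsub>P0\<^esub> splitting (x c \<odot>\<^bsub>M\<^esub> b)"
proof -
  have "d0 (elem_at R (c, b) r) = r \<odot>\<^bsub>P0\<^esub> generator1 (c, b)"
    unfolding d0_def
    by (rule P0.combination_elem_at) (use assms in \<open>auto intro!: generator1_closed simp: index1_def\<close>)
  also have "\<dots> = r \<odot>\<^bsub>P0\<^esub> elem_at R (Suc (t c), b) (x c) \<ominus>\<^bsub>P0\<^esub> r \<odot>\<^bsub>P0\<^esub> splitting (x c \<odot>\<^bsub>M\<^esub> b)"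
    unfolding generator1_def prod.case
    by (rule P0.smult_r_diff) (use assms in \<open>auto intro!: elem_at_arrow splitting_closed arrow_basis_closed\<close>)
  also have "r \<odot>\<^bsub>P0\<^esub> elem_at R (Suc (t c), b) (x c) = elem_at R (Suc (t c), b) (r \<otimes> x c)"
    using assms by (auto simp: elem_at_def)
  finally show ?thesis .
qed


lemma augmentation_differential_elem_at:
  assumes "c \<in> C" "b \<in> basis (Suc (t c))" "r \<in> carrier R"
  shows "\<epsilon> (d0 (elem_at R (c, b) r)) = \<zero>\<^bsub>M\<^esub>"
proof -
  note cl = arrow_closed[OF assms(1)] tail_head_range[OF assms(1)] arrow_basis_closed[OF assms(1,2)]
  have b: "b \<in> carrier M" using basis_closed assms(2) cl(3) by blast
  have 1: "elem_at R (Suc (t c), b) (r \<otimes> x c) \<in> carrier P0"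
    using assms cl arrow_head[OF assms(1)] by (intro elem_at_P0) (auto simp: m_assoc idem_closed)
  have 2: "splitting (x c \<odot>\<^bsub>M\<^esub> b) \<in> carrier P0" by (rule splitting_closed[OF cl(4)])
  have "\<epsilon> (d0 (elem_at R (c, b) r)) =
      \<epsilon> (elem_at R (Suc (t c), b) (r \<otimes> x c)) \<ominus>\<^bsub>M\<^esub> \<epsilon> (r \<odot>\<^bsub>P0\<^esub> splitting (x c \<odot>\<^bsub>M\<^esub> b))"
    unfolding differential_elem_at[OF assms]
    by (rule mod_hom_minus[OF P0.left_module_axioms left_module_axioms augmentation_hom 1
          P0.smult_closed[OF assms(3) 2]])
  also have "\<epsilon> (elem_at R (Suc (t c), b) (r \<otimes> x c)) = (r \<otimes> x c) \<odot>\<^bsub>M\<^esub> b"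
    using assms cl by (intro augmentation_elem_at) auto
  also have "\<epsilon> (r \<odot>\<^bsub>P0\<^esub> splitting (x c \<odot>\<^bsub>M\<^esub> b)) = r \<odot>\<^bsub>M\<^esub> (x c \<odot>\<^bsub>M\<^esub> b)"
    by (simp only: mod_homD(3)[OF augmentation_hom assms(3) 2] augmentation_splitting[OF cl(4)])
  also have "(r \<otimes> x c) \<odot>\<^bsub>M\<^esub> b \<ominus>\<^bsub>M\<^esub> r \<odot>\<^bsub>M\<^esub> (x c \<odot>\<^bsub>M\<^esub> b) = \<zero>\<^bsub>M\<^esub>"
    using assms cl b by (simp add: smult_assoc smult_closed a_minus_def M.r_neg)
  finally show ?thesis .
qed

lemma augmentation_differential:
  assumes "f \<in> carrier P1"
  shows "\<epsilon> (d0 f) = \<zero>\<^bsub>M\<^esub>"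
  using assms[unfolded P1_def] idem1_funcset
proof (induction rule: direct_sum_induct)
  case zero
  have "d0 (\<lambda>_. \<zero>) = (\<lambda>_. \<zero>)"
    using mod_hom_zero[OF P1.left_module_axioms P0.left_module_axioms differential_hom] by simp
  moreover have "\<epsilon> (\<lambda>_. \<zero>) = \<zero>\<^bsub>M\<^esub>"
    using mod_hom_zero[OF P0.left_module_axioms left_module_axioms augmentation_hom] by simp
  ultimately show ?case by simp
next
  case (add f f')
  note f = add(1,2)[folded P1_def]
  have "\<epsilon> (d0 (f \<oplus>\<^bsub>P1\<^esub> f')) = \<epsilon> (d0 f) \<oplus>\<^bsub>M\<^esub> \<epsilon> (d0 f')"
    by (simp only: mod_homD(2)[OF differential_hom f]
        mod_homD(2)[OF augmentation_hom f[THEN mod_homD(1)[OF differential_hom]]])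
  then show ?case using add by simp
next
  case (at j)
  then show ?case
    using P1_mem_carrier[OF assms] augmentation_differential_elem_at by (auto simp: index1_def)
qed

text \<open>
  The elements of \<open>P\<^sub>0\<close> that agree with the splitting of their augmentation modulo the image of the
  differential.  Exactness at \<open>P\<^sub>0\<close> means that all elements are of this kind.
\<close>

definition "reducible f \<longleftrightarrow> f \<in> carrier P0 \<and> f \<ominus>\<^bsub>P0\<^esub> splitting (\<epsilon> f) \<in> d0 ` carrier P1"

lemma differential_image_add:
  assumes "f \<in> d0 ` carrier P1" "f' \<in> d0 ` carrier P1"
  shows "f \<oplus>\<^bsub>P0\<^esub> f' \<in> d0 ` carrier P1"
proof -
  obtain \<alpha> \<alpha>' where "\<alpha> \<in> carrier P1" "f = d0 \<alpha>" "\<alpha>' \<in> carrier P1" "f' = d0 \<alpha>'" using assms by blast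
  then show ?thesis
    using mod_homD(2)[OF differential_hom, of \<alpha> \<alpha>'] P1.M.a_closed[of \<alpha> \<alpha>'] by (metis imageI)
qed

lemma zero_in_differential_image: "\<zero>\<^bsub>P0\<^esub> \<in> d0 ` carrier P1"
  using mod_hom_zero[OF P1.left_module_axioms P0.left_module_axioms differential_hom] P1.M.zero_closed
  by (metis imageI)

lemma reducible_add:
  assumes "reducible f" "reducible f'"
  shows "reducible (f \<oplus>\<^bsub>P0\<^esub> f')"
proof -
  have f: "f \<in> carrier P0" "f' \<in> carrier P0" using assms by (auto simp: reducible_def)
  note h = mod_homD[OF augmentation_hom]
  note sp = splitting_closed[OF h(1)[OF f(1)]] splitting_closed[OF h(1)[OF f(2)]]
  have "(f \<oplus>\<^bsub>P0\<^esub> f') \<ominus>\<^bsub>P0\<^esub> splitting (\<epsilon> (f \<oplus>\<^bsub>P0\<^esub> f')) =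
      (f \<ominus>\<^bsub>P0\<^esub> splitting (\<epsilon> f)) \<oplus>\<^bsub>P0\<^esub> (f' \<ominus>\<^bsub>P0\<^esub> splitting (\<epsilon> f'))"
    unfolding h(2)[OF f] splitting_add[OF h(1)[OF f(1)] h(1)[OF f(2)]]
    by (rule P0.M.minus_add_minus[OF f sp])
  then show ?thesis
    using assms f differential_image_add P0.M.a_closed by (auto simp: reducible_def simp del: P0_simps)
qed

lemma reducible_splitting:
  assumes y: "y \<in> carrier M"
  shows "reducible (splitting y)"
proof -
  note sp = splitting_closed[OF y]
  have "splitting y \<ominus>\<^bsub>P0\<^esub> splitting (\<epsilon> (splitting y)) = \<zero>\<^bsub>P0\<^esub>"
    using sp by (simp only: augmentation_splitting[OF y] a_minus_def P0.M.r_neg)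
  then show ?thesis
    unfolding reducible_def using sp zero_in_differential_image by (simp del: P0_simps)
qed

lemma reducible_zero: "reducible (\<lambda>_. \<zero>)"
  using reducible_splitting[of "\<zero>\<^bsub>M\<^esub>"] by (simp add: splitting_zero)

text \<open>
  Elements that differ by a boundary have the same augmentation.
\<close>

lemma reducible_cong_differential:
  assumes f: "f \<in> carrier P0" and g: "reducible g" and fg: "f \<ominus>\<^bsub>P0\<^esub> g \<in> d0 ` carrier P1"
  shows "reducible f"
proof -
  note h = mod_homD[OF augmentation_hom]
  have gP: "g \<in> carrier P0" using g by (simp add: reducible_def)
  have "\<epsilon> (f \<ominus>\<^bsub>P0\<^esub> g) = \<zero>\<^bsub>M\<^esub>" using fg augmentation_differential by auto
  then have "\<epsilon> f \<ominus>\<^bsub>M\<^esub> \<epsilon> g = \<zero>\<^bsub>M\<^esub>"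
    by (simp add: mod_hom_minus[OF P0.left_module_axioms left_module_axioms augmentation_hom f gP])
  then have eq: "\<epsilon> f = \<epsilon> g" by (rule M.eq_if_minus_zero[OF h(1)[OF f] h(1)[OF gP]])
  have "f \<ominus>\<^bsub>P0\<^esub> splitting (\<epsilon> f) = (f \<ominus>\<^bsub>P0\<^esub> g) \<oplus>\<^bsub>P0\<^esub> (g \<ominus>\<^bsub>P0\<^esub> splitting (\<epsilon> g))"
    unfolding eq by (rule P0.M.minus_telescope[OF f gP splitting_closed[OF h(1)[OF gP]]])
  also have "\<dots> \<in> d0 ` carrier P1"
    using differential_image_add[OF fg] g by (simp add: reducible_def del: P0_simps)
  finally show ?thesis using f by (simp add: reducible_def)
qed

lemma P0_memD:
  assumes "f \<in> carrier P0" "v \<in> {1..n}" "b \<in> basis v"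
  shows "f (v, b) \<in> carrier R" "f (v, b) \<otimes> e v = f (v, b)"
  using direct_sum_memD(1,2)[OF assms(1)[unfolded P0_def], of "(v, b)"] assms(2,3)
  by (auto simp: index0_def idem0_def)

lemma reducible_if_components_reducible:
  assumes f: "f \<in> carrier P0"
    and comp: "\<And>v b. v \<in> {1..n} \<Longrightarrow> b \<in> basis v \<Longrightarrow> reducible (elem_at R (v, b) (f (v, b)))"
  shows "reducible f"
  using f[unfolded P0_def] idem0_funcset
proof (induction rule: direct_sum_induct)
  case (add f f')
  then show ?case using reducible_add by simp
next
  case (at j)
  then show ?case using comp by (auto simp: index0_def)
qed (rule reducible_zero)

text \<open>
  Induction on the vertex \<open>v\<close>.  Up to a scalar multiple of \<open>e\<^sub>v \<otimes> b\<close>, which is a splitting, the element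
  \<open>r \<otimes> b\<close> is a sum of terms \<open>\<alpha>\<^sub>c x\<^sub>c \<otimes> b\<close>.  Such a term is congruent to \<open>\<alpha>\<^sub>c \<otimes> x\<^sub>c b\<close>, whose components
  belong to the vertex \<open>v - 1\<close>.
\<close>

lemma reducible_elem_at:
  assumes "v \<in> {1..n}" "b \<in> basis v" "r \<in> carrier R" "r \<otimes> e v = r"
  shows "reducible (elem_at R (v, b) r)"
  using assms
proof (induction v arbitrary: b r rule: less_induct)
  case (less v)
  let ?S = "{c\<in>C. Suc (t c) = v}"
  note ev = idem_closed[OF less.prems(1)]
  obtain l \<alpha> where \<alpha>: "\<And>c. c \<in> ?S \<Longrightarrow> \<alpha> c \<in> carrier R" "\<And>c. c \<in> ?S \<Longrightarrow> \<alpha> c \<otimes> e (t c) = \<alpha> c"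
      and r: "r = \<kappa> l \<otimes> e v \<oplus> finsum R (\<lambda>c. \<alpha> c \<otimes> x c) ?S"
    using last_arrow_span[OF less.prems(1,3,4)] by blast
  have fin: "finite ?S" using finite_arrows by auto
  have ax: "\<alpha> c \<otimes> x c \<in> carrier R" "\<alpha> c \<otimes> x c \<otimes> e v = \<alpha> c \<otimes> x c" if "c \<in> ?S" for c
    using that \<alpha>[OF that] arrow_closed arrow_head[of c] ev by (auto simp: m_assoc)
  have base: "reducible (elem_at R (v, b) (\<kappa> l \<otimes> e v))"
    unfolding splitting_scalar_basis[OF less.prems(1,2), symmetric]
    by (rule reducible_splitting) (use basis_closed less.prems in \<open>auto intro: smult_closed\<close>)
  \<comment> \<open>Trading \<open>x c \<otimes> b\<close> for \<open>1 \<otimes> x c b\<close> costs a boundary and lowers the vertex to \<open>t c\<close>.\<close>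
  have step: "reducible (elem_at R (v, b) (\<alpha> c \<otimes> x c))" if c: "c \<in> ?S" for c
  proof (rule reducible_cong_differential)
    have cC: "c \<in> C" "v = Suc (t c)" using c by auto
    have bc: "b \<in> basis (Suc (t c))" using less.prems(2) cC by simp
    let ?y = "x c \<odot>\<^bsub>M\<^esub> b"
    let ?g = "\<alpha> c \<odot>\<^bsub>P0\<^esub> splitting ?y"
    have y: "?y \<in> vertex_space (t c)" "?y \<in> carrier M"
      using arrow_basis[OF cC(1) bc] arrow_basis_closed[OF cC(1) bc] .
    have g: "?g \<in> carrier P0" by (rule P0.smult_closed[OF \<alpha>(1)[OF c] splitting_closed[OF y(2)]])
    show "elem_at R (v, b) (\<alpha> c \<otimes> x c) \<in> carrier P0"
      using less.prems ax[OF c] by (intro elem_at_P0)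
    have "elem_at R (v, b) (\<alpha> c \<otimes> x c) \<ominus>\<^bsub>P0\<^esub> ?g = d0 (elem_at R (c, b) (\<alpha> c))"
      unfolding cC(2) by (rule differential_elem_at[OF cC(1) bc \<alpha>(1)[OF c], symmetric])
    also have "\<dots> \<in> d0 ` carrier P1"
      using elem_at_P1[OF cC(1) bc \<alpha>(1)[OF c] \<alpha>(2)[OF c]] by (rule imageI)
    finally show "elem_at R (v, b) (\<alpha> c \<otimes> x c) \<ominus>\<^bsub>P0\<^esub> ?g \<in> d0 ` carrier P1" .
    show "reducible ?g"
    proof (rule reducible_if_components_reducible[OF g])
      fix u b' assume j: "u \<in> {1..n}" "b' \<in> basis u"
      show "reducible (elem_at R (u, b') (?g (u, b')))"
      proof (cases "u = t c")
        case True
        then show ?thesis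
          using less.IH[OF _ j P0_memD[OF g j]] cC(2) by simp
      next
        case False
        then have "splitting ?y (u, b') = \<zero>"
          using splitting_other_vertex[OF y(1)] tail_head_range[OF cC(1)] by simp
        then have "elem_at R (u, b') (?g (u, b')) = (\<lambda>_. \<zero>)"
          using \<alpha>(1)[OF c] by (auto simp: elem_at_def)
        then show ?thesis using reducible_zero by simp
      qed
    qed
  qed
  let ?Q = "\<lambda>r. reducible (elem_at R (v, b) r)"
  have Qadd: "?Q (r \<oplus> s)" if "r \<in> carrier R" "s \<in> carrier R" "?Q r" "?Q s" for r s
  proof -
    have "elem_at R (v, b) (r \<oplus> s) = elem_at R (v, b) r \<oplus>\<^bsub>P0\<^esub> elem_at R (v, b) s"
      by (auto simp: elem_at_def)
    then show ?thesis using reducible_add[OF that(3,4)] by simp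
  qed
  have Q0: "?Q \<zero>"
  proof -
    have "elem_at R (v, b) \<zero> = (\<lambda>_. \<zero>)" by (auto simp: elem_at_def)
    then show ?thesis using reducible_zero by simp
  qed
  have "?Q (finsum R (\<lambda>c. \<alpha> c \<otimes> x c) ?S)"
    by (rule R.finsum_closed_under_add[OF fin ax(1) step Q0 Qadd])
  then show ?case
    unfolding r using base ev ax(1) by (intro Qadd) (auto intro!: R.finsum_closed)
qed

lemma exact_at_P0: "d0 ` carrier P1 = a_kernel P0 M \<epsilon>"
proof
  show "d0 ` carrier P1 \<subseteq> a_kernel P0 M \<epsilon>"
    using augmentation_differential mod_homD(1)[OF differential_hom] by (auto simp: a_kernel_def')
  show "a_kernel P0 M \<epsilon> \<subseteq> d0 ` carrier P1"
  proof
    fix f assume "f \<in> a_kernel P0 M \<epsilon>"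
    then have f: "f \<in> carrier P0" "\<epsilon> f = \<zero>\<^bsub>M\<^esub>" by (auto simp: a_kernel_def')
    have "reducible f"
      by (rule reducible_if_components_reducible[OF f(1)], rule reducible_elem_at) (use P0_memD[OF f(1)] in auto)
    then have "f \<ominus>\<^bsub>P0\<^esub> \<zero>\<^bsub>P0\<^esub> \<in> d0 ` carrier P1"
      using f(2) by (simp add: reducible_def splitting_zero)
    then show "f \<in> d0 ` carrier P1" by (simp only: P0.M.minus_zero_right[OF f(1)])
  qed
qed

lemma augmentation_surj: "\<epsilon> ` carrier P0 = carrier M"
proof
  show "\<epsilon> ` carrier P0 \<subseteq> carrier M" using mod_homD(1)[OF augmentation_hom] by auto
  show "carrier M \<subseteq> \<epsilon> ` carrier P0"
    using augmentation_splitting splitting_closed by (metis imageI subsetI)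
qed

text \<open>
  The component of \<open>d\<^sub>0 \<alpha>\<close> at \<open>v\<close> receives \<open>\<alpha>\<^sub>c x\<^sub>c\<close> from the arrows ending at \<open>v\<close>, and the terms
  \<open>\<alpha>\<^sub>c \<otimes> x\<^sub>c b\<close> from the arrows that start at \<open>v\<close>.  If the latter components of \<open>\<alpha>\<close> vanish, only the
  first kind remains.
\<close>

lemma differential_at_top:
  assumes \<alpha>: "\<alpha> \<in> carrier P1" and v: "v \<in> {1..n}" and b: "b \<in> basis v"
    and above: "\<And>c b'. c \<in> C \<Longrightarrow> t c = v \<Longrightarrow> \<alpha> (c, b') = \<zero>"
  shows "d0 \<alpha> (v, b) = finsum R (\<lambda>c. \<alpha> (c, b) \<otimes> x c) {c\<in>C. Suc (t c) = v}"
  using \<alpha>[unfolded P1_def] idem1_funcset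
proof (induction rule: direct_sum_induct)
  case zero
  have "d0 (\<lambda>_. \<zero>) = (\<lambda>_. \<zero>)"
    using mod_hom_zero[OF P1.left_module_axioms P0.left_module_axioms differential_hom] by simp
  moreover have "finsum R (\<lambda>c. \<zero> \<otimes> x c) {c\<in>C. Suc (t c) = v} = finsum R (\<lambda>_. \<zero>) {c\<in>C. Suc (t c) = v}"
    by (intro R.finsum_cong') (auto simp: arrow_closed)
  ultimately show ?case by (simp add: R.finsum_zero)
next
  case (add f f')
  note f = add(1,2)[folded P1_def]
  let ?S = "{c\<in>C. Suc (t c) = v}"
  have fx: "f (c, b) \<otimes> x c \<in> carrier R" "f' (c, b) \<otimes> x c \<in> carrier R" if "c \<in> ?S" for c
    using that P1_mem_carrier f arrow_closed by auto
  have "d0 (\<lambda>i. f i \<oplus> f' i) (v, b) = d0 f (v, b) \<oplus> d0 f' (v, b)"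
    using mod_homD(2)[OF differential_hom f] by simp
  also have "\<dots> = finsum R (\<lambda>c. f (c, b) \<otimes> x c \<oplus> f' (c, b) \<otimes> x c) ?S"
    unfolding add(3,4) using fx by (intro R.finsum_addf[symmetric]) auto
  also have "\<dots> = finsum R (\<lambda>c. (f (c, b) \<oplus> f' (c, b)) \<otimes> x c) ?S"
    using P1_mem_carrier[OF f(1)] P1_mem_carrier[OF f(2)] arrow_closed
    by (intro R.finsum_cong') (auto simp: l_distr)
  finally show ?case .
next
  case (at j)
  then obtain c b' where j: "j = (c, b')" "c \<in> C" "b' \<in> basis (Suc (t c))" by (auto simp: index1_def)
  define r where "r = \<alpha> j"
  let ?S = "{c\<in>C. Suc (t c) = v}"
  have r: "r \<in> carrier R" unfolding r_def by (rule P1_mem_carrier[OF \<alpha>])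
  note cl = arrow_closed[OF j(2)] tail_head_range[OF j(2)]
  have y: "x c \<odot>\<^bsub>M\<^esub> b' \<in> vertex_space (t c)" "x c \<odot>\<^bsub>M\<^esub> b' \<in> carrier M"
    using arrow_basis[OF j(2,3)] arrow_basis_closed[OF j(2,3)] .
  have 1: "elem_at R (Suc (t c), b') (r \<otimes> x c) \<in> carrier P0"
    using j r cl arrow_head[OF j(2)] by (intro elem_at_P0) (auto simp: m_assoc idem_closed)
  have "r \<otimes> splitting (x c \<odot>\<^bsub>M\<^esub> b') (v, b) = \<zero>"
  proof (cases "t c = v")
    case True
    then have "r = \<zero>" using above j by (simp add: r_def)
    then show ?thesis using P0_mem_carrier[OF splitting_closed[OF y(2)]] by simp
  next
    case False
    then show ?thesis using splitting_other_vertex[OF y(1) cl(2)] r by simp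
  qed
  then have "d0 (elem_at R j r) (v, b) = elem_at R (Suc (t c), b') (r \<otimes> x c) (v, b)"
    using differential_elem_at[OF j(2,3) r] P0_minus[OF 1 P0.smult_closed[OF r splitting_closed[OF y(2)]]]
      r cl P0_mem_carrier[OF 1]
    by (simp add: j a_minus_def)
  also have "\<dots> = finsum R (\<lambda>c'. elem_at R j r (c', b) \<otimes> x c') ?S"
  proof (cases "Suc (t c) = v \<and> b' = b")
    case True
    have "finsum R (\<lambda>c'. elem_at R j r (c', b) \<otimes> x c') ?S =
        finsum R (\<lambda>c'. if c = c' then r \<otimes> x c' else \<zero>) ?S"
      using True j r arrow_closed by (intro R.finsum_cong') (auto simp: elem_at_def)
    also have "\<dots> = r \<otimes> x c"
      using True j r arrow_closed finite_arrows
      by (intro R.finsum_singleton) auto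
    finally show ?thesis using True by (simp add: elem_at_def)
  next
    case False
    then have "finsum R (\<lambda>c'. elem_at R j r (c', b) \<otimes> x c') ?S = finsum R (\<lambda>_. \<zero>) ?S"
      using j r arrow_closed by (intro R.finsum_cong') (auto simp: elem_at_def)
    then show ?thesis using False by (auto simp: elem_at_def R.finsum_zero)
  qed
  finally show ?case unfolding r_def .
qed

definition "K = a_kernel P1 P0 d0"

lemma K_iff: "\<alpha> \<in> K \<longleftrightarrow> \<alpha> \<in> carrier P1 \<and> d0 \<alpha> = \<zero>\<^bsub>P0\<^esub>"
  by (auto simp: K_def a_kernel_def')

lemma kernel_last_arrow_sum:
  assumes \<alpha>: "\<alpha> \<in> K" and v: "v \<in> {1..n}" and b: "b \<in> basis v"
    and above: "\<And>c b'. c \<in> C \<Longrightarrow> t c = v \<Longrightarrow> \<alpha> (c, b') = \<zero>"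
    and c: "c \<in> C" "Suc (t c) = v"
  shows "e 1 \<otimes> \<alpha> (c, b) = \<alpha> (c, b)" "v < n \<Longrightarrow> \<alpha> (c, b) = \<zero>"
proof -
  let ?S = "{c\<in>C. Suc (t c) = v}"
  have \<alpha>P: "\<alpha> \<in> carrier P1" "d0 \<alpha> = (\<lambda>_. \<zero>)" using \<alpha> by (auto simp: K_iff)
  have "finsum R (\<lambda>c. \<alpha> (c, b) \<otimes> x c) ?S = \<zero>"
    using differential_at_top[OF \<alpha>P(1) v b above] \<alpha>P(2) by simp
  moreover have "\<forall>c\<in>?S. \<alpha> (c, b) \<in> carrier R \<and> \<alpha> (c, b) \<otimes> e (t c) = \<alpha> (c, b)"
    using direct_sum_memD(1,2)[OF \<alpha>P(1)[unfolded P1_def]] b by (auto simp: index1_def idem1_def)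
  ultimately show "e 1 \<otimes> \<alpha> (c, b) = \<alpha> (c, b)" "v < n \<Longrightarrow> \<alpha> (c, b) = \<zero>"
    using last_arrow_relation[OF v, of "\<lambda>c. \<alpha> (c, b)" c] c by auto
qed

lemma P1_outside: "\<alpha> \<in> carrier P1 \<Longrightarrow> (c, b) \<notin> index1 \<Longrightarrow> \<alpha> (c, b) = \<zero>"
  unfolding P1_def by (rule direct_sum_memD(3))

text \<open>
  Descending induction on the tail of the arrow: once the components at the arrows starting at \<open>v\<close>
  vanish, those at the arrows ending at \<open>v < n\<close> vanish too.
\<close>

lemma kernel_zero:
  assumes \<alpha>: "\<alpha> \<in> K" and top: "\<And>c b. c \<in> C \<Longrightarrow> Suc (t c) = n \<Longrightarrow> \<alpha> (c, b) = \<zero>"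
  shows "\<alpha> = (\<lambda>_. \<zero>)"
proof -
  have \<alpha>P: "\<alpha> \<in> carrier P1" using \<alpha> by (auto simp: K_iff)
  have "\<alpha> (c, b) = \<zero>" if "c \<in> C" for c b
    using that
  proof (induction "n - t c" arbitrary: c b rule: less_induct)
    case less
    let ?v = "Suc (t c)"
    have v: "?v \<in> {1..n}" using tail_head_range[OF less.prems] by simp
    show ?case
    proof (cases "?v = n \<or> b \<notin> basis ?v")
      case True
      then show ?thesis using top less.prems P1_outside[OF \<alpha>P] by (auto simp: index1_def)
    next
      case False
      have "\<alpha> (c', b') = \<zero>" if "c' \<in> C" "t c' = ?v" for c' b'
        using less.hyps[of c' b'] that v False by auto
      then show ?thesis
        using kernel_last_arrow_sum(2)[OF \<alpha> v, of b c] False less.prems v by auto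
    qed
  qed
  then have "\<alpha> (c, b) = \<zero>" for c b
    using P1_outside[OF \<alpha>P, of c b] by (cases "c \<in> C") (auto simp: index1_def)
  then show ?thesis by auto
qed

lemma left_module_K: "left_module R (P1\<lparr>carrier := K\<rparr>)"
proof (rule P1.submodule)
  note h = mod_homD[OF differential_hom]
  show "K \<subseteq> carrier P1" by (auto simp: K_iff)
  show "\<zero>\<^bsub>P1\<^esub> \<in> K"
    using mod_hom_zero[OF P1.left_module_axioms P0.left_module_axioms differential_hom] P1.M.zero_closed
    by (simp add: K_iff)
  show "\<alpha> \<oplus>\<^bsub>P1\<^esub> \<beta> \<in> K" if "\<alpha> \<in> K" "\<beta> \<in> K" for \<alpha> \<beta>
    using that h(2)[of \<alpha> \<beta>] P1.M.a_closed[of \<alpha> \<beta>] P0.M.zero_closed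
    by (auto simp: K_iff simp del: P0_simps P1_simps)
  show "r \<odot>\<^bsub>P1\<^esub> \<alpha> \<in> K" if "r \<in> carrier R" "\<alpha> \<in> K" for r \<alpha>
    using that h(3)[of r \<alpha>] P1.smult_closed[of r \<alpha>] P0.smult_r_null[of r]
    by (auto simp: K_iff simp del: P0_simps P1_simps)
qed

text \<open>
  \<open>\<alpha> - e\<^sub>1 \<alpha>\<close> lies in the kernel, and its components at the arrows ending at \<open>n\<close> vanish, where no arrow
  starting at \<open>n\<close> interferes.
\<close>

lemma first_idem_acts_on_kernel:
  assumes \<alpha>: "\<alpha> \<in> K"
  shows "e 1 \<odot>\<^bsub>P1\<^esub> \<alpha> = \<alpha>"
proof -
  interpret K: left_module R "P1\<lparr>carrier := K\<rparr>" by (rule left_module_K)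
  note e1 = idem_closed[OF one_vertex]
  have \<alpha>P: "\<alpha> \<in> carrier P1" using \<alpha> by (simp add: K_iff)
  \<comment> \<open>\<open>\<beta> = \<alpha> - e\<^sub>1 \<alpha>\<close>, in a form that shows its membership in the submodule \<open>K\<close>.\<close>
  define \<beta> where "\<beta> = \<alpha> \<oplus>\<^bsub>P1\<^esub> (\<ominus> \<one>) \<odot>\<^bsub>P1\<^esub> (e 1 \<odot>\<^bsub>P1\<^esub> \<alpha>)"
  have "\<beta> \<in> K"
    using K.M.a_closed[OF _ K.smult_closed[OF _ K.smult_closed[of "e 1" \<alpha>]], of \<alpha> "\<ominus> \<one>"] \<alpha> e1
    by (simp add: \<beta>_def del: P1_simps)
  moreover have \<beta>: "\<beta> j = \<alpha> j \<ominus> e 1 \<otimes> \<alpha> j" for j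
    using P1_mem_carrier[OF \<alpha>P] e1 by (simp add: \<beta>_def a_minus_def l_minus)
  have "\<beta> (c, b) = \<zero>" if c: "c \<in> C" "Suc (t c) = n" for c b
  proof (cases "b \<in> basis n")
    case True
    have "\<alpha> (c', b') = \<zero>" if "c' \<in> C" "t c' = n" for c' b'
      using tail_range[OF that(1)] that(2) by simp
    then have "e 1 \<otimes> \<alpha> (c, b) = \<alpha> (c, b)"
      using kernel_last_arrow_sum(1)[OF \<alpha> _ True _ c] vertex_exists by auto
    then show ?thesis using P1_mem_carrier[OF \<alpha>P] by (simp add: \<beta> a_minus_def R.r_neg)
  next
    case False
    then have "\<alpha> (c, b) = \<zero>" using c P1_outside[OF \<alpha>P] by (auto simp: index1_def)
    then show ?thesis using e1 by (simp add: \<beta> a_minus_def)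
  qed
  ultimately have "\<beta> = (\<lambda>_. \<zero>)" by (intro kernel_zero)
  then have eq: "\<alpha> j \<ominus> e 1 \<otimes> \<alpha> j = \<zero>" for j using \<beta>[of j] by simp
  have "e 1 \<otimes> \<alpha> j = \<alpha> j" for j
    by (rule R.eq_if_minus_zero[OF _ _ eq, symmetric]) (use P1_mem_carrier[OF \<alpha>P] e1 in auto)
  then show ?thesis by auto
qed

lemma projective_K: "projective R (P1\<lparr>carrier := K\<rparr>)"
proof -
  interpret K: left_module R "P1\<lparr>carrier := K\<rparr>" by (rule left_module_K)
  interpret K: scalar_module R "P1\<lparr>carrier := K\<rparr>" \<kappa> ..
  show ?thesis
    by (rule K.projective_if_idempotent_acts_as_identity[OF idem_closed[OF one_vertex] first_idem_scalar])
      (use first_idem_acts_on_kernel in auto)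
qed

lemma projective_P0:
  assumes "inj (\<iota> :: nat \<times> 'm \<Rightarrow> nat \<times> 'm \<Rightarrow> 'a)"
  shows "projective R P0"
  unfolding P0_def
proof (rule projective_direct_sum[OF idem0_closed _ assms])
  show "idem0 j \<otimes> idem0 j = idem0 j" if "j \<in> index0" for j
    using that idem[of "fst j"] by (auto simp: index0_def idem0_def)
qed

lemma projective_P1:
  assumes "inj (\<iota> :: nat \<times> 'm \<Rightarrow> nat \<times> 'm \<Rightarrow> 'a)"
  shows "projective R P1"
  unfolding P1_def
proof (rule projective_direct_sum[OF idem1_closed _ assms])
  show "idem1 j \<otimes> idem1 j = idem1 j" if "j \<in> index1" for j
    using that idem[OF tail_head_range(1)[of "fst j"]] by (auto simp: index1_def idem1_def)
qed

text \<open>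
  The two distinct ring elements only serve to embed the index type \<open>nat \<times> 'm\<close> into
  \<open>nat \<times> 'm \<Rightarrow> 'a\<close>, as \<open>projective_direct_sum\<close> requires.
\<close>

theorem projective_dim_le_2:
  assumes uw: "(u :: 'a) \<noteq> w"
  shows "projective_dim R M \<le> 2"
proof -
  define \<iota> where "\<iota> = (\<lambda>j i :: nat \<times> 'm. if i = j then u else w)"
  have inj: "inj \<iota>" unfolding inj_def \<iota>_def using uw by metis
  \<comment> \<open>The zero module, for all degrees above 2.\<close>
  define Z :: "('a, nat \<times> 'm \<Rightarrow> 'a) module" where "Z = direct_sum R {} (\<lambda>_. \<one>)"
  have Zc: "carrier Z = {\<lambda>_. \<zero>}" "zero Z = (\<lambda>_. \<zero>)" by (auto simp: Z_def direct_sum_def)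
  have Zp: "projective R Z" unfolding Z_def by (rule projective_direct_sum[OF _ _ inj]) auto
  interpret Z: left_module R Z using Zp by (simp add: projective_def)
  let ?K = "P1\<lparr>carrier := K\<rparr>"
  interpret K: left_module R ?K by (rule left_module_K)
  define P where "P = (\<lambda>i :: nat. if i = 0 then P0 else if i = 1 then P1 else if i = 2 then ?K else Z)"
  define d where "d = (\<lambda>i :: nat. if i = 0 then d0 else if i = 1 then (\<lambda>f. f) else (\<lambda>_ _. \<zero>))"
  have P: "P 0 = P0" "P (Suc 0) = P1" "P (Suc (Suc 0)) = ?K" "P (Suc (Suc (Suc i))) = Z" for i
    by (auto simp: P_def)
  have d: "d 0 = d0" "d (Suc 0) = (\<lambda>f. f)" "d (Suc (Suc i)) = (\<lambda>_ _. \<zero>)" for i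
    by (auto simp: d_def)
  have zero_hom: "(\<lambda>_ _. \<zero>) \<in> mod_hom R Z N"
    if "left_module R N" "zero N = (\<lambda>_. \<zero>)" for N :: "('a, nat \<times> 'm \<Rightarrow> 'a) module"
  proof -
    interpret N: left_module R N by fact
    show ?thesis
      using N.M.zero_closed N.M.l_zero[OF N.M.zero_closed] N.smult_r_null
      by (auto simp: mod_hom_def that(2))
  qed
  have K0: "(\<lambda>_. \<zero>) \<in> K" using K.M.zero_closed by simp
  have "projective_resolution R M 2 P d \<epsilon>"
    unfolding projective_resolution_def
  proof (intro conjI allI impI)
    fix i
    show "projective R (P i)"
      using projective_P0[OF inj] projective_P1[OF inj] projective_K Zp by (simp add: P_def)
    show "carrier (P i) = {\<zero>\<^bsub>P i\<^esub>}" if "2 < i" using that Zc by (simp add: P_def)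
    consider "i = 0" | "i = 1" | "i = 2" | k where "i = Suc (Suc (Suc k))"
      by (metis One_nat_def Suc_1 not0_implies_Suc)
    then show "d i \<in> mod_hom R (P (Suc i)) (P i)"
    proof cases
      case 1
      then show ?thesis using differential_hom by (simp add: P d)
    next
      case 2
      then show ?thesis by (auto simp: P d mod_hom_def K_iff)
    next
      case 3
      then show ?thesis using zero_hom[OF left_module_K] by (simp add: P d numeral_2_eq_2)
    next
      case 4
      then show ?thesis using zero_hom[OF Z.left_module_axioms Zc(2)] by (simp add: P d)
    qed
    show "d (Suc i) ` carrier (P (Suc (Suc i))) = a_kernel (P (Suc i)) (P i) (d i)"
    proof -
      consider "i = 0" | "i = 1" | k where "i = Suc (Suc k)"
        by (metis One_nat_def not0_implies_Suc)
      then show ?thesis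
      proof cases
        case 1
        then show ?thesis by (simp add: P d K_def)
      next
        case 2
        then show ?thesis using K0 by (auto simp: P d Zc a_kernel_def')
      next
        case 3
        then show ?thesis
          by (cases k) (auto simp: P d Zc a_kernel_def')
      qed
    qed
  qed (use augmentation_hom augmentation_surj exact_at_P0 in \<open>simp_all add: P d\<close>)
  then have "enat 2 \<in> {enat n |n. \<exists>(P :: nat \<Rightarrow> ('a, nat \<times> 'm \<Rightarrow> 'a) module) d \<epsilon>. projective_resolution R M n P d \<epsilon>}"
    by blast
  then have "projective_dim R M \<le> enat 2" unfolding projective_dim_def by (rule Inf_lower)
  then show ?thesis by (simp add: numeral_eq_enat)
qed

end

lemma (in almost_hereditary_algebra) left_global_dim_le_2:
  assumes "(u :: 'a) \<noteq> w"
  shows "left_global_dim TYPE('m) R \<le> 2"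
  unfolding left_global_dim_def
proof (rule SUP_least)
  fix M :: "('a, 'm) module" assume "M \<in> {M. left_module R M}"
  then interpret M: left_module R M by simp
  interpret layered_module n e C t x R \<kappa> M ..
  show "projective_dim R M \<le> 2" by (rule projective_dim_le_2[OF assms])
qed

section \<open>Quotients by ideals between the extreme vertices\<close>

lemma ring_hom_finsum:
  assumes "ring R" "ring S" "h \<in> ring_hom R S" "finite D" "f \<in> D \<rightarrow> carrier R"
  shows "h (finsum R f D) = finsum S (\<lambda>i. h (f i)) D"
  using assms(4,5)
proof (induction D rule: finite_induct)
  interpret R: ring R by fact
  interpret S: ring S by fact
  interpret h: ring_hom_ring R S h using assms by (intro ring_hom_ringI2)
  case empty
  then show ?case by simp
next
  interpret R: ring R by fact
  interpret S: ring S by fact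
  interpret h: ring_hom_ring R S h using assms by (intro ring_hom_ringI2)
  case (insert i D)
  then have "f i \<in> carrier R" "f \<in> D \<rightarrow> carrier R" by auto
  with insert show ?case by (simp add: R.finsum_insert S.finsum_insert Pi_def)
qed

text \<open>
  Lift a relation \<open>\<Sum> \<alpha>\<^sub>c x\<^sub>c = 0\<close> at \<open>v\<close> to \<open>z = \<Sum> a\<^sub>c x\<^sub>c \<in> I\<close>.  As \<open>e\<^sub>1 z = z\<close>, the combination with
  coefficients \<open>a\<^sub>c - e\<^sub>1 a\<^sub>c\<close> vanishes, and freeness gives \<open>a\<^sub>c = e\<^sub>1 a\<^sub>c\<close>.  For \<open>v < n\<close> both \<open>z e\<^sub>n = z\<close>
  and \<open>z e\<^sub>v = z\<close> hold; so \<open>z = 0\<close> and the \<open>a\<^sub>c\<close> vanish.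
\<close>

theorem (in hereditary_layered_algebra) quotient_almost_hereditary:
  assumes I: "ideal I R"
    and I_first: "\<And>z. z \<in> I \<Longrightarrow> e 1 \<otimes> z = z" and I_last: "\<And>z. z \<in> I \<Longrightarrow> z \<otimes> e n = z"
  shows "almost_hereditary_algebra (R Quot I) (\<lambda>l. I +> \<kappa> l) n (\<lambda>v. I +> e v) C t (\<lambda>c. I +> x c)"
proof -
  interpret I: ideal I R by fact
  interpret Q: ring "R Quot I" by (rule I.quotient_is_ring)
  let ?Q = "R Quot I" and ?\<pi> = "\<lambda>r. I +> r"
  have \<pi>: "?\<pi> \<in> ring_hom R ?Q" by (rule I.rcos_ring_hom)
  have closed: "\<And>r. r \<in> carrier R \<Longrightarrow> ?\<pi> r \<in> carrier ?Q"
    and mult: "\<And>r s. r \<in> carrier R \<Longrightarrow> s \<in> carrier R \<Longrightarrow> ?\<pi> r \<otimes>\<^bsub>?Q\<^esub> ?\<pi> s = ?\<pi> (r \<otimes> s)"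
    and add: "\<And>r s. r \<in> carrier R \<Longrightarrow> s \<in> carrier R \<Longrightarrow> ?\<pi> r \<oplus>\<^bsub>?Q\<^esub> ?\<pi> s = ?\<pi> (r \<oplus> s)"
    and one: "?\<pi> \<one> = \<one>\<^bsub>?Q\<^esub>"
    using \<pi> by (auto simp: ring_hom_def)
  have surj: "\<exists>r\<in>carrier R. q = ?\<pi> r" if "q \<in> carrier ?Q" for q
    using that by (auto simp: FactRing_def A_RCOSETS_def')
  have zero: "?\<pi> \<zero> = \<zero>\<^bsub>?Q\<^esub>"
    by (rule ring_hom_zero[OF \<pi> ring_axioms Q.ring_axioms])
  have kernel: "r \<in> I" if "r \<in> carrier R" "?\<pi> r = \<zero>\<^bsub>?Q\<^esub>" for r
    using that I.rcos_const_imp_mem by (simp add: FactRing_def)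
  have sum: "?\<pi> (finsum R f D) = finsum ?Q (\<lambda>i. ?\<pi> (f i)) D" if "finite D" "f \<in> D \<rightarrow> carrier R" for f D
    by (rule ring_hom_finsum[OF ring_axioms Q.ring_axioms \<pi> that])
  have fin: "finite {c\<in>C. Suc (t c) = v}" for v using finite_arrows by auto
  have range: "t c \<in> {1..n}" "Suc (t c) \<in> {1..n}" if "c \<in> C" for c using tail_range[OF that] by auto
  have lift: "\<exists>a. a \<in> carrier R \<and> a \<otimes> e v = a \<and> q = ?\<pi> a"
    if q: "q \<in> carrier ?Q" "q \<otimes>\<^bsub>?Q\<^esub> ?\<pi> (e v) = q" and v: "v \<in> {1..n}" for q v
  proof -
    obtain r where r: "r \<in> carrier R" "q = ?\<pi> r" using surj[OF q(1)] by blast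
    then have "q = ?\<pi> (r \<otimes> e v)" using q(2) idem_closed[OF v] by (simp add: mult)
    moreover have "r \<otimes> e v \<otimes> e v = r \<otimes> e v" using r idem_closed[OF v] idem[OF v] by (simp add: m_assoc)
    ultimately show ?thesis using r idem_closed[OF v] by blast
  qed
  show ?thesis
  proof (unfold_locales)
    show "\<exists>l \<alpha>. (\<forall>c\<in>{c\<in>C. Suc (t c) = v}. \<alpha> c \<in> carrier ?Q \<and> \<alpha> c \<otimes>\<^bsub>?Q\<^esub> ?\<pi> (e (t c)) = \<alpha> c) \<and>
        q = ?\<pi> (\<kappa> l) \<otimes>\<^bsub>?Q\<^esub> ?\<pi> (e v) \<oplus>\<^bsub>?Q\<^esub> finsum ?Q (\<lambda>c. \<alpha> c \<otimes>\<^bsub>?Q\<^esub> ?\<pi> (x c)) {c\<in>C. Suc (t c) = v}"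
      if v: "v \<in> {1..n}" and q: "q \<in> carrier ?Q" "q \<otimes>\<^bsub>?Q\<^esub> ?\<pi> (e v) = q" for v q
    proof -
      let ?S = "{c\<in>C. Suc (t c) = v}"
      obtain r where r: "r \<in> carrier R" "r \<otimes> e v = r" "q = ?\<pi> r" using lift[OF q v] by blast
      obtain l \<alpha> where \<alpha>: "\<forall>c\<in>?S. \<alpha> c \<in> carrier R \<and> \<alpha> c \<otimes> e (t c) = \<alpha> c"
        and eq: "r = \<kappa> l \<otimes> e v \<oplus> finsum R (\<lambda>c. \<alpha> c \<otimes> x c) ?S"
        using last_arrow_span[OF v r(1,2)] by blast
      have ax: "(\<lambda>c. \<alpha> c \<otimes> x c) \<in> ?S \<rightarrow> carrier R" using \<alpha> arrow_closed by auto
      have "q = ?\<pi> (\<kappa> l) \<otimes>\<^bsub>?Q\<^esub> ?\<pi> (e v) \<oplus>\<^bsub>?Q\<^esub> finsum ?Q (\<lambda>c. ?\<pi> (\<alpha> c \<otimes> x c)) ?S"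
        unfolding r(3) eq using ax idem_closed[OF v] finsum_closed[OF ax]
        by (simp add: sum[OF fin ax, symmetric] mult add)
      also have "finsum ?Q (\<lambda>c. ?\<pi> (\<alpha> c \<otimes> x c)) ?S = finsum ?Q (\<lambda>c. ?\<pi> (\<alpha> c) \<otimes>\<^bsub>?Q\<^esub> ?\<pi> (x c)) ?S"
        using \<alpha> arrow_closed by (intro Q.finsum_cong') (auto simp: mult closed)
      finally have "q = ?\<pi> (\<kappa> l) \<otimes>\<^bsub>?Q\<^esub> ?\<pi> (e v) \<oplus>\<^bsub>?Q\<^esub> finsum ?Q (\<lambda>c. ?\<pi> (\<alpha> c) \<otimes>\<^bsub>?Q\<^esub> ?\<pi> (x c)) ?S" .
      moreover have "\<forall>c\<in>?S. ?\<pi> (\<alpha> c) \<in> carrier ?Q \<and> ?\<pi> (\<alpha> c) \<otimes>\<^bsub>?Q\<^esub> ?\<pi> (e (t c)) = ?\<pi> (\<alpha> c)"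
        using \<alpha> range idem_closed by (auto simp: mult closed)
      ultimately show ?thesis by (intro exI[of _ l] exI[of _ "\<lambda>c. ?\<pi> (\<alpha> c)"] conjI)
    qed
    show "?\<pi> (e 1) \<otimes>\<^bsub>?Q\<^esub> \<alpha> c = \<alpha> c \<and> (v < n \<longrightarrow> \<alpha> c = \<zero>\<^bsub>?Q\<^esub>)"
      if v: "v \<in> {1..n}"
        and \<alpha>: "\<forall>c\<in>{c\<in>C. Suc (t c) = v}. \<alpha> c \<in> carrier ?Q \<and> \<alpha> c \<otimes>\<^bsub>?Q\<^esub> ?\<pi> (e (t c)) = \<alpha> c"
        and eq: "finsum ?Q (\<lambda>c. \<alpha> c \<otimes>\<^bsub>?Q\<^esub> ?\<pi> (x c)) {c\<in>C. Suc (t c) = v} = \<zero>\<^bsub>?Q\<^esub>"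
        and c: "c \<in> C" "Suc (t c) = v" for v \<alpha> c
    proof -
      let ?S = "{c\<in>C. Suc (t c) = v}"
      have "\<forall>c\<in>?S. \<exists>a. a \<in> carrier R \<and> a \<otimes> e (t c) = a \<and> \<alpha> c = ?\<pi> a"
        using lift \<alpha> range by blast
      then obtain a where "\<forall>c\<in>?S. a c \<in> carrier R \<and> a c \<otimes> e (t c) = a c \<and> \<alpha> c = ?\<pi> (a c)"
        by (rule bchoice[THEN exE])
      then have a: "\<And>c. c \<in> ?S \<Longrightarrow> a c \<in> carrier R" "\<And>c. c \<in> ?S \<Longrightarrow> a c \<otimes> e (t c) = a c"
          "\<And>c. c \<in> ?S \<Longrightarrow> \<alpha> c = ?\<pi> (a c)"
        by blast+
      have ax: "(\<lambda>c. a c \<otimes> x c) \<in> ?S \<rightarrow> carrier R" using a arrow_closed by auto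
      define z where "z = finsum R (\<lambda>c. a c \<otimes> x c) ?S"
      have zR: "z \<in> carrier R" unfolding z_def by (rule finsum_closed[OF ax])
      have "?\<pi> z = finsum ?Q (\<lambda>c. ?\<pi> (a c \<otimes> x c)) ?S" unfolding z_def by (rule sum[OF fin ax])
      also have "\<dots> = finsum ?Q (\<lambda>c. \<alpha> c \<otimes>\<^bsub>?Q\<^esub> ?\<pi> (x c)) ?S"
        using a arrow_closed by (intro Q.finsum_cong') (auto simp: mult closed)
      finally have zI: "z \<in> I" using eq kernel[OF zR] by simp
      note e1 = idem_closed[OF one_vertex] and ev = idem_closed[OF v]
      have "finsum R (\<lambda>c. (a c \<ominus> e 1 \<otimes> a c) \<otimes> x c) ?S =
          finsum R (\<lambda>c. a c \<otimes> x c \<oplus> (\<ominus> e 1) \<otimes> (a c \<otimes> x c)) ?S"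
        using a arrow_closed e1
        by (intro finsum_cong') (auto simp: a_minus_def l_distr l_minus m_assoc)
      also have "\<dots> = z \<oplus> finsum R (\<lambda>c. (\<ominus> e 1) \<otimes> (a c \<otimes> x c)) ?S"
        unfolding z_def using a arrow_closed e1 by (intro finsum_addf) auto
      also have "finsum R (\<lambda>c. (\<ominus> e 1) \<otimes> (a c \<otimes> x c)) ?S = (\<ominus> e 1) \<otimes> z"
        unfolding z_def using ax e1 fin by (intro finsum_rdistr[symmetric]) auto
      also have "z \<oplus> (\<ominus> e 1) \<otimes> z = \<zero>"
        using I_first[OF zI] zR e1 by (simp add: l_minus r_neg)
      finally have "finsum R (\<lambda>c. (a c \<ominus> e 1 \<otimes> a c) \<otimes> x c) ?S = \<zero>" .
      moreover have "\<forall>c\<in>?S. a c \<ominus> e 1 \<otimes> a c \<in> carrier R \<and> (a c \<ominus> e 1 \<otimes> a c) \<otimes> e (t c) = a c \<ominus> e 1 \<otimes> a c"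
        using a e1 idem_closed[OF range(1)]
        by (auto simp: a_minus_def l_distr l_minus m_assoc)
      ultimately have "a c \<ominus> e 1 \<otimes> a c = \<zero>"
        using last_arrow_free[OF v, of "\<lambda>c. a c \<ominus> e 1 \<otimes> a c" c] c by blast
      moreover have cS: "c \<in> ?S" using c by simp
      note ac = a(1)[OF cS]
      ultimately have "a c = e 1 \<otimes> a c" by (intro eq_if_minus_zero[OF ac m_closed[OF e1 ac]])
      then have "?\<pi> (e 1) \<otimes>\<^bsub>?Q\<^esub> \<alpha> c = \<alpha> c"
        unfolding a(3)[OF cS] mult[OF e1 ac] by (rule arg_cong[of _ _ ?\<pi>, OF sym])
      moreover have "\<alpha> c = \<zero>\<^bsub>?Q\<^esub>" if "v < n"
      proof -
        have "z \<otimes> e v = finsum R (\<lambda>c. (a c \<otimes> x c) \<otimes> e v) ?S"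
          unfolding z_def using ax ev fin by (intro finsum_ldistr) auto
        also have "\<dots> = z"
          unfolding z_def using a arrow_closed ev arrow_head by (intro finsum_cong') (auto simp: m_assoc)
        finally have "z = (z \<otimes> e n) \<otimes> e v" using I_last[OF zI] by simp
        also have "\<dots> = z \<otimes> (e n \<otimes> e v)"
          using zR ev idem_closed[of n] vertex_exists by (intro m_assoc) auto
        also have "\<dots> = \<zero>" using idem_orth[of n v] that v vertex_exists zR by simp
        finally have "finsum R (\<lambda>c. a c \<otimes> x c) ?S = \<zero>" by (simp only: z_def)
        moreover have "\<forall>c\<in>?S. a c \<in> carrier R \<and> a c \<otimes> e (t c) = a c" using a(1,2) by blast
        ultimately have "a c = \<zero>" using last_arrow_free[OF v _ _ c] by blast
        then show ?thesis using a(3)[OF cS] zero by simp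
      qed
      ultimately show ?thesis by blast
    qed
    show "finsum ?Q (\<lambda>v. ?\<pi> (e v)) {1..n} = \<one>\<^bsub>?Q\<^esub>"
      using sum[of "{1..n}" e] idem_closed idem_sum one by (simp add: Pi_def del: One_nat_def)
    show "q \<otimes>\<^bsub>?Q\<^esub> ?\<pi> (\<kappa> l) = ?\<pi> (\<kappa> l) \<otimes>\<^bsub>?Q\<^esub> q" if "q \<in> carrier ?Q" for q l
      using surj[OF that] by (auto simp: mult scalar_central)
    show "?\<pi> (e v) \<otimes>\<^bsub>?Q\<^esub> ?\<pi> (e v) = ?\<pi> (e v)" if "v \<in> {1..n}" for v
      using mult[OF idem_closed[OF that] idem_closed[OF that]] idem[OF that] by simp
    show "?\<pi> (e u) \<otimes>\<^bsub>?Q\<^esub> ?\<pi> (e v) = \<zero>\<^bsub>?Q\<^esub>" if "u \<in> {1..n}" "v \<in> {1..n}" "u \<noteq> v" for u v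
      using mult[OF idem_closed[OF that(1)] idem_closed[OF that(2)]] idem_orth[OF that] zero by simp
    show "?\<pi> (e (t c)) \<otimes>\<^bsub>?Q\<^esub> ?\<pi> (x c) = ?\<pi> (x c)" if "c \<in> C" for c
      using mult[OF idem_closed[OF range(1)] arrow_closed] arrow_tail that by simp
    show "?\<pi> (x c) \<otimes>\<^bsub>?Q\<^esub> ?\<pi> (e (Suc (t c))) = ?\<pi> (x c)" if "c \<in> C" for c
      using mult[OF arrow_closed idem_closed[OF range(2)]] arrow_head that by simp
    show "t c \<in> {1..<n}" if "c \<in> C" for c by (rule tail_range[OF that])
    show "?\<pi> (\<kappa> (l + m)) = ?\<pi> (\<kappa> l) \<oplus>\<^bsub>?Q\<^esub> ?\<pi> (\<kappa> m)" for l m by (simp add: add scalar_add)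
    show "?\<pi> (\<kappa> (l * m)) = ?\<pi> (\<kappa> l) \<otimes>\<^bsub>?Q\<^esub> ?\<pi> (\<kappa> m)" for l m by (simp add: mult scalar_mult)
  qed (simp_all add: closed one idem_closed arrow_closed finite_arrows vertex_exists del: One_nat_def atLeastAtMost_iff)
qed

text \<open>
  \<open>e\<^sub>1 R e\<^sub>n\<close> is an ideal, because \<open>R e\<^sub>1 = k e\<^sub>1\<close> and \<open>e\<^sub>n R = k e\<^sub>n\<close>: a longer product would need an arrow
  into the first vertex or out of the last one.
\<close>

lemma (in layered_algebra) genideal_within_corner:
  assumes e_n: "\<And>r. r \<in> carrier R \<Longrightarrow> \<exists>l. e n \<otimes> r = \<kappa> l \<otimes> e n"
    and S: "S \<subseteq> carrier R" "\<And>s. s \<in> S \<Longrightarrow> e 1 \<otimes> s = s" "\<And>s. s \<in> S \<Longrightarrow> s \<otimes> e n = s"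
    and z: "z \<in> genideal R S"
  shows "e 1 \<otimes> z = z" "z \<otimes> e n = z"
proof -
  let ?H = "{z \<in> carrier R. e 1 \<otimes> z = z \<and> z \<otimes> e n = z}"
  note e1 = idem_closed[OF one_vertex]
  have en: "e n \<in> carrier R" using idem_closed[of n] vertex_exists by auto
  have scale: "\<kappa> l \<otimes> z \<in> ?H" if "z \<in> ?H" for l z
  proof -
    have z: "z \<in> carrier R" "e 1 \<otimes> z = z" "z \<otimes> e n = z" using that by auto
    have "e 1 \<otimes> (\<kappa> l \<otimes> z) = \<kappa> l \<otimes> (e 1 \<otimes> z)"
      using z(1) e1 by (simp add: m_assoc[symmetric] scalar_central)
    then show ?thesis using z e1 en by (simp add: m_assoc)
  qed
  have "ideal ?H R"
  proof (rule idealI[OF ring_axioms])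
    show "subgroup ?H (add_monoid R)"
      by (rule add.subgroupI)
        (use e1 en in \<open>auto simp: r_distr l_distr r_minus l_minus a_inv_def[symmetric] intro: exI[of _ "\<zero>"]\<close>)
    show "r \<otimes> z \<in> ?H" if "z \<in> ?H" "r \<in> carrier R" for r z
    proof -
      obtain l where l: "r \<otimes> e 1 = \<kappa> l \<otimes> e 1" using first_idem_scalar[OF \<open>r \<in> carrier R\<close>] by blast
      have z: "z \<in> carrier R" "e 1 \<otimes> z = z" using that by auto
      have "r \<otimes> z = (r \<otimes> e 1) \<otimes> z" using that z e1 by (simp add: m_assoc)
      also have "\<dots> = \<kappa> l \<otimes> z" unfolding l using z e1 by (simp add: m_assoc)
      finally show ?thesis using scale[OF that(1)] by simp
    qed
    show "z \<otimes> r \<in> ?H" if "z \<in> ?H" "r \<in> carrier R" for r z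
    proof -
      obtain l where l: "e n \<otimes> r = \<kappa> l \<otimes> e n" using e_n[OF \<open>r \<in> carrier R\<close>] by blast
      have z: "z \<in> carrier R" "z \<otimes> e n = z" using that by auto
      have "z \<otimes> r = z \<otimes> (e n \<otimes> r)" using that z en by (simp add: m_assoc[symmetric])
      also have "\<dots> = \<kappa> l \<otimes> (z \<otimes> e n)" 
        unfolding l using z(1) en by (simp add: m_assoc[symmetric] scalar_central)
      finally show ?thesis using scale[OF that(1)] z by simp
    qed
  qed
  then have "genideal R S \<subseteq> ?H" by (rule genideal_minimal) (use S in auto)
  then show "e 1 \<otimes> z = z" "z \<otimes> e n = z" using z by auto
qed

section \<open>Opposite rings\<close>

lemma opposite_ring_simps [simp]:
  "carrier (opposite_ring R) = carrier R" "mult (opposite_ring R) x y = y \<otimes>\<^bsub>R\<^esub> x"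
  "one (opposite_ring R) = \<one>\<^bsub>R\<^esub>" "zero (opposite_ring R) = \<zero>\<^bsub>R\<^esub>" "add (opposite_ring R) = add R"
  by (simp_all add: opposite_ring_def)

lemma add_monoid_opposite_ring [simp]: "add_monoid (opposite_ring R) = add_monoid R"
  by simp

lemma finsum_opposite_ring [simp]: "finsum (opposite_ring R) = finsum R"
  by (simp add: finsum_def fun_eq_iff)

lemma ring_opposite_ring:
  assumes "ring R"
  shows "ring (opposite_ring R)"
proof -
  interpret ring R by fact
  have "abelian_group (opposite_ring R)"
    by (rule comm_group_abelian_groupI) (use a_comm_group in simp)
  then show ?thesis
    by (intro ringI monoidI) (auto simp: m_assoc l_distr r_distr)
qed

lemma ideal_opposite_ring:
  assumes "ideal I R"
  shows "ideal I (opposite_ring R)"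
proof -
  interpret ideal I R by fact
  show ?thesis
    by (rule idealI[OF ring_opposite_ring[OF ring_axioms]])
      (use a_subgroup in \<open>auto simp: I_l_closed I_r_closed\<close>)
qed

lemma opposite_ring_Quot: "opposite_ring (R Quot I) = opposite_ring R Quot I"
proof -
  have coset: "a_r_coset (opposite_ring R) I = a_r_coset R I"
    by (auto simp: fun_eq_iff a_r_coset_def')
  have "rcoset_mult R I Z W = rcoset_mult (opposite_ring R) I W Z" for Z W
    by (auto simp: rcoset_mult_def coset)
  moreover have "a_rcosets\<^bsub>opposite_ring R\<^esub> I = a_rcosets\<^bsub>R\<^esub> I"
    by (simp add: A_RCOSETS_def)
  moreover have "set_add (opposite_ring R) = set_add R" by (auto simp: fun_eq_iff set_add_def)
  ultimately show ?thesis
    by (intro ring.equality) (auto simp: FactRing_def coset fun_eq_iff)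
qed

section \<open>Algebras on a basis of words\<close>

lemma basis_mult_eq:
  assumes "finite F" "{x. f x \<noteq> 0} \<subseteq> F" "finite G" "{y. g y \<noteq> 0} \<subseteq> G"
  shows "basis_mult c f g z = (\<Sum>x\<in>F. \<Sum>y\<in>G. if c x y = Some z then f x * g y else 0)"
proof -
  have "(\<Sum>x\<in>F. \<Sum>y\<in>G. if c x y = Some z then f x * g y else 0) =
      (\<Sum>(x, y)\<in>F \<times> G. if c x y = Some z then f x * g y else 0)"
    by (rule sum.cartesian_product)
  also have "\<dots> = (\<Sum>(x, y) \<in> {(x, y). f x \<noteq> 0 \<and> g y \<noteq> 0 \<and> c x y = Some z}. f x * g y)"
    by (rule sum.mono_neutral_cong_right) (use assms in \<open>auto split: if_splits\<close>)
  finally show ?thesis by (simp add: basis_mult_def)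
qed

text \<open>
  This is what allows one treatment for left and right modules.
\<close>

lemma opposite_basis_algebra:
  "opposite_ring (basis_algebra B c U) = basis_algebra B (\<lambda>x y. c y x) U"
proof -
  have "basis_mult c g f z = basis_mult (\<lambda>x y. c y x) f g z" for f g :: "'a \<Rightarrow> 'b" and z
    unfolding basis_mult_def
    by (rule sum.reindex_bij_witness[of _ prod.swap prod.swap]) auto
  then show ?thesis by (auto simp: opposite_ring_def basis_algebra_def fun_eq_iff)
qed

text \<open>
  The basis behaves like the paths of a quiver with vertices \<open>1, \<dots>, n\<close> whose letters \<open>b k\<close> raise the
  vertex by one, and every basis element of positive length has a unique last letter.  Nothing refers
  to lists, so that the paths of a quiver qualify with either order of composition.
\<close>

locale layered_basis =
  fixes B :: "'p set" and c :: "'p \<Rightarrow> 'p \<Rightarrow> 'p option" and source target :: "'p \<Rightarrow> nat"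
    and n :: nat and i :: "nat \<Rightarrow> 'p" and C :: "nat set" and t :: "nat \<Rightarrow> nat" and b :: "nat \<Rightarrow> 'p"
  assumes pos: "1 \<le> n"
    and assoc: "Option.bind (c p q) (\<lambda>y. c y r) = Option.bind (c q r) (c p)"
    and closed: "p \<in> B \<Longrightarrow> q \<in> B \<Longrightarrow> c p q = Some r \<Longrightarrow> r \<in> B"
    and source_range: "p \<in> B \<Longrightarrow> source p \<in> {1..n}"
    and target_range: "p \<in> B \<Longrightarrow> target p \<in> {1..n}"
    and unit_closed: "v \<in> {1..n} \<Longrightarrow> i v \<in> B"
    and unit_ends: "v \<in> {1..n} \<Longrightarrow> source (i v) = v" "v \<in> {1..n} \<Longrightarrow> target (i v) = v"
    and left_unit: "p \<in> B \<Longrightarrow> v \<in> {1..n} \<Longrightarrow> c (i v) p = (if v = source p then Some p else None)"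
    and right_unit: "p \<in> B \<Longrightarrow> v \<in> {1..n} \<Longrightarrow> c p (i v) = (if v = target p then Some p else None)"
    and finite_letters: "finite C"
    and letter_range: "k \<in> C \<Longrightarrow> t k \<in> {1..<n}"
    and letter_closed: "k \<in> C \<Longrightarrow> b k \<in> B"
    and letter_ends: "k \<in> C \<Longrightarrow> source (b k) = t k" "k \<in> C \<Longrightarrow> target (b k) = Suc (t k)"
    and append_letter: "p \<in> B \<Longrightarrow> k \<in> C \<Longrightarrow> target p = t k \<Longrightarrow> 
      \<exists>q\<in>B. c p (b k) = Some q \<and> target q = Suc (t k)"
    and append_letter_None: "p \<in> B \<Longrightarrow> k \<in> C \<Longrightarrow> target p \<noteq> t k \<Longrightarrow> c p (b k) = None"
    and append_letter_unique: "p \<in> B \<Longrightarrow> p' \<in> B \<Longrightarrow> k \<in> C \<Longrightarrow> k' \<in> C \<Longrightarrow>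
      c p (b k) = Some q \<Longrightarrow> c p' (b k') = Some q \<Longrightarrow> p = p' \<and> k = k'"
    and append_letter_not_unit: "p \<in> B \<Longrightarrow> k \<in> C \<Longrightarrow> v \<in> {1..n} \<Longrightarrow> c p (b k) \<noteq> Some (i v)"
    and last_letter: "q \<in> B \<Longrightarrow> q = i (target q) \<or> (\<exists>p\<in>B. \<exists>k\<in>C. c p (b k) = Some q)"
begin

definition U where "U = i ` {1..n}"

definition alg :: "('p \<Rightarrow> 'k::field) ring" where "alg = basis_algebra B c U"

lemma alg_simps:
  "carrier alg = {f. finite {x. f x \<noteq> 0} \<and> {x. f x \<noteq> 0} \<subseteq> B}"
  "mult alg = basis_mult c" "one alg = (\<lambda>x. if x \<in> U then 1 else 0)" "zero alg = (\<lambda>_. 0)"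
  "add alg = (\<lambda>f g x. f x + g x)"
  by (simp_all add: alg_def basis_algebra_def)

lemma mult_closed:
  assumes f: "finite {x. f x \<noteq> 0}" "{x. f x \<noteq> 0} \<subseteq> B" and g: "finite {x. g x \<noteq> 0}" "{x. g x \<noteq> 0} \<subseteq> B"
  shows "finite {z. basis_mult c f g z \<noteq> 0}" "{z. basis_mult c f g z \<noteq> 0} \<subseteq> B"
proof -
  let ?P = "(\<lambda>(x, y). the (c x y)) ` ({x. f x \<noteq> 0} \<times> {y. g y \<noteq> 0})"
  have *: "\<exists>x y. f x \<noteq> 0 \<and> g y \<noteq> 0 \<and> c x y = Some z" if "basis_mult c f g z \<noteq> 0" for z
  proof (rule ccontr)
    assume "\<not> ?thesis"
    then have "{(x, y). f x \<noteq> 0 \<and> g y \<noteq> 0 \<and> c x y = Some z} = {}" by auto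
    then have "basis_mult c f g z = 0" unfolding basis_mult_def by (simp only: sum.empty)
    then show False using that by simp
  qed
  have "{z. basis_mult c f g z \<noteq> 0} \<subseteq> ?P" using * by force
  then show "finite {z. basis_mult c f g z \<noteq> 0}" by (rule finite_subset) (use f g in auto)
  show "{z. basis_mult c f g z \<noteq> 0} \<subseteq> B" using * closed f g by blast
qed

text \<open>
  The product of \<open>f\<close> and \<open>g\<close>, paired with a function \<open>\<phi>\<close> on the basis.  Coefficients of either bracketing
  of a threefold product are such pairings, which reduces associativity to that of the basis.
\<close>

lemma sum_mult_pairing:
  fixes f g \<phi> :: "'p \<Rightarrow> 'k::field"
  assumes f: "finite F" "{x. f x \<noteq> 0} \<subseteq> F" and g: "finite G" "{y. g y \<noteq> 0} \<subseteq> G"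
    and W: "finite W" "{u. basis_mult c f g u \<noteq> 0} \<subseteq> W"
  shows "(\<Sum>u\<in>W. basis_mult c f g u * \<phi> u) =
    (\<Sum>x\<in>F. \<Sum>y\<in>G. f x * g y * (case c x y of None \<Rightarrow> 0 | Some u \<Rightarrow> \<phi> u))"
proof -
  let ?W = "W \<union> (\<lambda>(x, y). the (c x y)) ` (F \<times> G)"
  have fin: "finite ?W" using f g W by auto
  have pick: "(\<Sum>u\<in>?W. (if c x y = Some u then f x * g y else 0) * \<phi> u) =
      f x * g y * (case c x y of None \<Rightarrow> 0 | Some u \<Rightarrow> \<phi> u)" if "x \<in> F" "y \<in> G" for x y
  proof (cases "c x y")
    case (Some u0)
    then have u0: "u0 \<in> ?W" using that by (intro UnI2 image_eqI[of _ _ "(x, y)"]) auto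
    have "(\<Sum>u\<in>?W. (if c x y = Some u then f x * g y else 0) * \<phi> u) =
        (\<Sum>u\<in>?W. if u = u0 then f x * g y * \<phi> u0 else 0)"
      by (rule sum.cong) (auto simp: Some)
    also have "\<dots> = f x * g y * \<phi> u0" using fin u0 by simp
    finally show ?thesis by (simp add: Some)
  qed simp
  have "(\<Sum>u\<in>W. basis_mult c f g u * \<phi> u) = (\<Sum>u\<in>?W. basis_mult c f g u * \<phi> u)"
    by (rule sum.mono_neutral_left) (use fin W in auto)
  also have "\<dots> = (\<Sum>u\<in>?W. \<Sum>x\<in>F. \<Sum>y\<in>G. (if c x y = Some u then f x * g y else 0) * \<phi> u)"
    by (simp only: basis_mult_eq[OF f g] sum_distrib_right)
  also have "\<dots> = (\<Sum>x\<in>F. \<Sum>u\<in>?W. \<Sum>y\<in>G. (if c x y = Some u then f x * g y else 0) * \<phi> u)"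
    by (rule sum.swap)
  also have "\<dots> = (\<Sum>x\<in>F. \<Sum>y\<in>G. \<Sum>u\<in>?W. (if c x y = Some u then f x * g y else 0) * \<phi> u)"
    by (intro sum.cong refl sum.swap)
  also have "\<dots> = (\<Sum>x\<in>F. \<Sum>y\<in>G. f x * g y * (case c x y of None \<Rightarrow> 0 | Some u \<Rightarrow> \<phi> u))"
    by (intro sum.cong refl pick)
  finally show ?thesis .
qed

lemma mult_assoc:
  fixes f g h :: "'p \<Rightarrow> 'k::field"
  assumes "f \<in> carrier alg" "g \<in> carrier alg" "h \<in> carrier alg"
  shows "basis_mult c (basis_mult c f g) h = basis_mult c f (basis_mult c g h)"
proof
  fix z
  let ?F = "{x. f x \<noteq> 0}" and ?G = "{x. g x \<noteq> 0}" and ?H = "{x. h x \<noteq> 0}"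
  have F: "finite ?F" "?F \<subseteq> B" and G: "finite ?G" "?G \<subseteq> B" and H: "finite ?H" "?H \<subseteq> B"
    using assms by (auto simp: alg_simps)
  note fg = mult_closed(1)[OF F G] and gh = mult_closed(1)[OF G H]
  let ?FG = "{u. basis_mult c f g u \<noteq> 0}" and ?GH = "{u. basis_mult c g h u \<noteq> 0}"
  have "basis_mult c (basis_mult c f g) h z =
      (\<Sum>u\<in>?FG. \<Sum>w\<in>?H. if c u w = Some z then basis_mult c f g u * h w else 0)"
    by (rule basis_mult_eq) (use fg H in auto)
  also have "\<dots> = (\<Sum>u\<in>?FG. basis_mult c f g u * (\<Sum>w\<in>?H. if c u w = Some z then h w else 0))"
    by (auto simp: sum_distrib_left intro!: sum.cong)
  also have "\<dots> = (\<Sum>x\<in>?F. \<Sum>y\<in>?G. f x * g y *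
      (case c x y of None \<Rightarrow> 0 | Some u \<Rightarrow> (\<Sum>w\<in>?H. if c u w = Some z then h w else 0)))"
    by (rule sum_mult_pairing) (use F G fg in auto)
  also have "\<dots> = (\<Sum>x\<in>?F. \<Sum>y\<in>?G. \<Sum>w\<in>?H.
      if Option.bind (c x y) (\<lambda>u. c u w) = Some z then f x * g y * h w else 0)"
    by (auto simp: sum_distrib_left intro!: sum.cong split: option.split)
  also have "\<dots> = (\<Sum>x\<in>?F. \<Sum>y\<in>?G. \<Sum>w\<in>?H.
      if Option.bind (c y w) (c x) = Some z then g y * h w * f x else 0)"
    unfolding assoc by (intro sum.cong refl) (simp add: mult.commute mult.left_commute)
  also have "\<dots> = (\<Sum>y\<in>?G. \<Sum>x\<in>?F. \<Sum>w\<in>?H.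
      if Option.bind (c y w) (c x) = Some z then g y * h w * f x else 0)"
    by (rule sum.swap)
  also have "\<dots> = (\<Sum>y\<in>?G. \<Sum>w\<in>?H. \<Sum>x\<in>?F.
      if Option.bind (c y w) (c x) = Some z then g y * h w * f x else 0)"
    by (intro sum.cong refl sum.swap)
  also have "\<dots> = (\<Sum>y\<in>?G. \<Sum>w\<in>?H. g y * h w *
      (case c y w of None \<Rightarrow> 0 | Some u \<Rightarrow> (\<Sum>x\<in>?F. if c x u = Some z then f x else 0)))"
    by (auto simp: sum_distrib_left intro!: sum.cong split: option.split)
  also have "\<dots> = (\<Sum>u\<in>?GH. basis_mult c g h u * (\<Sum>x\<in>?F. if c x u = Some z then f x else 0))"
    by (rule sum_mult_pairing[symmetric]) (use G H gh in auto)
  also have "\<dots> = (\<Sum>u\<in>?GH. \<Sum>x\<in>?F. if c x u = Some z then f x * basis_mult c g h u else 0)"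
    by (auto simp: sum_distrib_left mult.commute intro!: sum.cong)
  also have "\<dots> = (\<Sum>x\<in>?F. \<Sum>u\<in>?GH. if c x u = Some z then f x * basis_mult c g h u else 0)"
    by (rule sum.swap)
  also have "\<dots> = basis_mult c f (basis_mult c g h) z"
    by (rule basis_mult_eq[symmetric]) (use gh F in auto)
  finally show "basis_mult c (basis_mult c f g) h z = basis_mult c f (basis_mult c g h) z" .
qed

lemma mult_add:
  fixes f g h :: "'p \<Rightarrow> 'k::field"
  assumes "f \<in> carrier alg" "g \<in> carrier alg" "h \<in> carrier alg"
  shows "basis_mult c (\<lambda>x. f x + g x) h z = basis_mult c f h z + basis_mult c g h z"
    and "basis_mult c h (\<lambda>x. f x + g x) z = basis_mult c h f z + basis_mult c h g z"
proof -
  let ?D = "{x. f x \<noteq> 0} \<union> {x. g x \<noteq> 0}" and ?H = "{x. h x \<noteq> 0}"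
  have D: "finite ?D" "{x. f x \<noteq> 0} \<subseteq> ?D" "{x. g x \<noteq> 0} \<subseteq> ?D" "{x. f x + g x \<noteq> 0} \<subseteq> ?D"
    and H: "finite ?H" "?H \<subseteq> ?H" using assms by (auto simp: alg_simps)
  show "basis_mult c (\<lambda>x. f x + g x) h z = basis_mult c f h z + basis_mult c g h z"
    unfolding basis_mult_eq[OF D(1,2) H] basis_mult_eq[OF D(1,3) H] basis_mult_eq[OF D(1,4) H]
      sum.distrib[symmetric]
    by (intro sum.cong refl) (simp add: distrib_right)
  show "basis_mult c h (\<lambda>x. f x + g x) z = basis_mult c h f z + basis_mult c h g z"
    unfolding basis_mult_eq[OF H D(1,2)] basis_mult_eq[OF H D(1,3)] basis_mult_eq[OF H D(1,4)]
      sum.distrib[symmetric]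
    by (intro sum.cong refl) (simp add: distrib_left)
qed

lemma mult_single_right:
  fixes f :: "'p \<Rightarrow> 'k::field"
  assumes f: "f \<in> carrier alg"
  shows "p \<in> B \<Longrightarrow> c p q = Some z \<Longrightarrow> (\<And>p'. p' \<in> B \<Longrightarrow> c p' q = Some z \<Longrightarrow> p' = p) \<Longrightarrow>
      basis_mult c f (single q) z = f p"
    and "(\<And>p. p \<in> B \<Longrightarrow> c p q \<noteq> Some z) \<Longrightarrow> basis_mult c f (single q) z = 0"
proof -
  let ?F = "{x. f x \<noteq> 0}"
  have F: "finite ?F" "?F \<subseteq> B" using f by (auto simp: alg_simps)
  have eq: "basis_mult c f (single q) z = (\<Sum>x\<in>?F. if c x q = Some z then f x else 0)"
    by (subst basis_mult_eq[of ?F _ "{q}"]) (use F in \<open>auto simp: single_def intro!: sum.cong\<close>)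
  show "basis_mult c f (single q) z = f p" if p: "p \<in> B" "c p q = Some z"
    and uniq: "\<And>p'. p' \<in> B \<Longrightarrow> c p' q = Some z \<Longrightarrow> p' = p"
  proof -
    have "c x q = Some z \<longleftrightarrow> x = p" if "x \<in> ?F" for x
      using F(2) that p(2) uniq[of x] by blast
    then have "basis_mult c f (single q) z = (\<Sum>x\<in>?F. if x = p then f p else 0)"
      unfolding eq by (intro sum.cong) auto
    also have "\<dots> = f p" using F by auto
    finally show ?thesis .
  qed
  show "basis_mult c f (single q) z = 0" if "\<And>p. p \<in> B \<Longrightarrow> c p q \<noteq> Some z"
    unfolding eq by (rule sum.neutral) (use F that in auto)
qed

lemma unit_eq_Some_iff:
  assumes "p \<in> B" "v \<in> {1..n}"
  shows "c p (i v) = Some z \<longleftrightarrow> p = z \<and> target z = v"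
    and "c (i v) p = Some z \<longleftrightarrow> p = z \<and> source z = v"
  unfolding right_unit[OF assms] left_unit[OF assms] by auto

lemma mult_unit_right:
  fixes f :: "'p \<Rightarrow> 'k::field"
  assumes f: "f \<in> carrier alg" and v: "v \<in> {1..n}"
  shows "basis_mult c f (single (i v)) z = (if z \<in> B \<and> target z = v then f z else 0)"
proof (cases "z \<in> B \<and> target z = v")
  case True
  have "basis_mult c f (single (i v)) z = f z"
    by (rule mult_single_right(1)[OF f]) (use True unit_eq_Some_iff(1)[OF _ v] in blast)+
  then show ?thesis using True by simp
next
  case False
  have "basis_mult c f (single (i v)) z = 0"
    by (rule mult_single_right(2)[OF f]) (use False in \<open>auto simp: unit_eq_Some_iff(1)[OF _ v]\<close>)
  then show ?thesis using False by auto
qed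

lemma mult_unit_left:
  fixes f :: "'p \<Rightarrow> 'k::field"
  assumes f: "f \<in> carrier alg" and v: "v \<in> {1..n}"
  shows "basis_mult c (single (i v)) f z = (if z \<in> B \<and> source z = v then f z else 0)"
proof -
  let ?F = "{x. f x \<noteq> 0}"
  have F: "finite ?F" "?F \<subseteq> B" using f by (auto simp: alg_simps)
  have "basis_mult c (single (i v)) f z = (\<Sum>x\<in>?F. if c (i v) x = Some z then f x else 0)"
    by (subst basis_mult_eq[of "{i v}" _ ?F]) (use F in \<open>auto simp: single_def intro!: sum.cong\<close>)
  also have "\<dots> = (\<Sum>x\<in>?F. if x = z then (if source z = v then f z else 0) else 0)"
    by (rule sum.cong) (use F unit_eq_Some_iff(2)[OF _ v] in \<open>auto simp: subset_iff\<close>)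
  also have "\<dots> = (if z \<in> B \<and> source z = v then f z else 0)" using F by auto
  finally show ?thesis .
qed

definition scalar :: "'k::field \<Rightarrow> 'p \<Rightarrow> 'k" where
  "scalar l = (\<lambda>z. if z \<in> U then l else 0)"

lemma U_closed: "U \<subseteq> B" using unit_closed by (auto simp: U_def)

lemma mult_unit_eq_Some_iff:
  assumes "p \<in> B" "q \<in> U"
  shows "c p q = Some z \<longleftrightarrow> p = z \<and> q = i (target p)"
    and "c q p = Some z \<longleftrightarrow> p = z \<and> q = i (source p)"
proof -
  obtain u where u: "u \<in> {1..n}" "q = i u" using assms by (auto simp: U_def)
  have "q = i (target p) \<longleftrightarrow> u = target p" "q = i (source p) \<longleftrightarrow> u = source p"
    using unit_ends(1) u target_range[OF assms(1)] source_range[OF assms(1)] by metis+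
  then show "c p q = Some z \<longleftrightarrow> p = z \<and> q = i (target p)"
    and "c q p = Some z \<longleftrightarrow> p = z \<and> q = i (source p)"
    using left_unit[OF assms(1) u(1)] right_unit[OF assms(1) u(1)] u(2) by auto
qed

lemma scalar_closed: "scalar l \<in> carrier alg"
proof -
  have "{x. scalar l x \<noteq> 0} \<subseteq> U" "finite U" by (auto simp: scalar_def U_def)
  then show ?thesis using U_closed finite_subset by (auto simp: alg_simps)
qed

lemma mult_scalar:
  fixes f :: "'p \<Rightarrow> 'k::field"
  assumes f: "f \<in> carrier alg"
  shows "basis_mult c (scalar l) f = (\<lambda>z. l * f z)" and "basis_mult c f (scalar l) = (\<lambda>z. l * f z)"
proof -
  let ?F = "{x. f x \<noteq> 0}"
  have F: "finite ?F" "?F \<subseteq> B" using f by (auto simp: alg_simps)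
  have U: "finite U" "{x. scalar l x \<noteq> 0} \<subseteq> U" by (auto simp: scalar_def U_def)
  have s: "i (source x) \<in> U" "i (target x) \<in> U" if "x \<in> B" for x
    using source_range[OF that] target_range[OF that] by (auto simp: U_def)
  show "basis_mult c (scalar l) f = (\<lambda>z. l * f z)"
  proof
    fix z
    have "basis_mult c (scalar l) f z = (\<Sum>u\<in>U. \<Sum>x\<in>?F. if c u x = Some z then scalar l u * f x else 0)"
      by (rule basis_mult_eq[OF U F(1)]) simp
    also have "\<dots> = (\<Sum>x\<in>?F. \<Sum>u\<in>U. if c u x = Some z then scalar l u * f x else 0)" by (rule sum.swap)
    also have "\<dots> = (\<Sum>x\<in>?F. \<Sum>u\<in>U. if u = i (source x) then if x = z then l * f x else 0 else 0)"
      by (intro sum.cong refl) (use F mult_unit_eq_Some_iff(2) in \<open>auto simp: scalar_def\<close>)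
    also have "\<dots> = (\<Sum>x\<in>?F. if x = z then l * f x else 0)"
      by (intro sum.cong refl) (use F U s in \<open>auto simp: subset_iff\<close>)
    also have "\<dots> = l * f z" using F by auto
    finally show "basis_mult c (scalar l) f z = l * f z" .
  qed
  show "basis_mult c f (scalar l) = (\<lambda>z. l * f z)"
  proof
    fix z
    have "basis_mult c f (scalar l) z = (\<Sum>x\<in>?F. \<Sum>u\<in>U. if c x u = Some z then f x * scalar l u else 0)"
      by (rule basis_mult_eq[OF F(1) _ U]) simp
    also have "\<dots> = (\<Sum>x\<in>?F. \<Sum>u\<in>U. if u = i (target x) then if x = z then l * f x else 0 else 0)"
      by (intro sum.cong refl) (use F mult_unit_eq_Some_iff(1) in \<open>auto simp: scalar_def\<close>)
    also have "\<dots> = (\<Sum>x\<in>?F. if x = z then l * f x else 0)"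
      by (intro sum.cong refl) (use F U s in \<open>auto simp: subset_iff\<close>)
    also have "\<dots> = l * f z" using F by auto
    finally show "basis_mult c f (scalar l) z = l * f z" .
  qed
qed

lemma one_eq_scalar: "one alg = scalar 1"
  by (simp add: alg_simps scalar_def)

lemma ring_alg: "ring (alg :: ('p \<Rightarrow> 'k::field) ring)"
proof (rule ringI)
  have add: "(\<lambda>x. f x + g x) \<in> carrier alg" if "f \<in> carrier alg" "g \<in> carrier alg" for f g :: "'p \<Rightarrow> 'k"
  proof -
    have "{x. f x + g x \<noteq> 0} \<subseteq> {x. f x \<noteq> 0} \<union> {x. g x \<noteq> 0}" by auto
    moreover have "finite ({x. f x \<noteq> 0} \<union> {x. g x \<noteq> 0})" "{x. f x \<noteq> 0} \<union> {x. g x \<noteq> 0} \<subseteq> B"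
      using that by (auto simp: alg_simps)
    ultimately have "finite {x. f x + g x \<noteq> 0}" "{x. f x + g x \<noteq> 0} \<subseteq> B"
      using finite_subset by blast+
    then show ?thesis by (simp add: alg_simps)
  qed
  show "abelian_group (alg :: ('p \<Rightarrow> 'k) ring)"
  proof (rule abelian_groupI)
    show "\<exists>g\<in>carrier alg. g \<oplus>\<^bsub>alg\<^esub> f = \<zero>\<^bsub>alg\<^esub>" if "f \<in> carrier alg" for f :: "'p \<Rightarrow> 'k"
      using that by (intro bexI[of _ "\<lambda>x. - f x"]) (auto simp: alg_simps)
  qed (use add in \<open>auto simp: alg_simps add.assoc add.commute\<close>)
  show "Group.monoid (alg :: ('p \<Rightarrow> 'k) ring)"
  proof (rule monoidI)
    show "f \<otimes>\<^bsub>alg\<^esub> g \<in> carrier alg" if "f \<in> carrier alg" "g \<in> carrier alg" for f g :: "'p \<Rightarrow> 'k"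
      using that mult_closed[of f g] by (simp add: alg_simps)
    show "(f \<otimes>\<^bsub>alg\<^esub> g) \<otimes>\<^bsub>alg\<^esub> h = f \<otimes>\<^bsub>alg\<^esub> (g \<otimes>\<^bsub>alg\<^esub> h)"
      if "f \<in> carrier alg" "g \<in> carrier alg" "h \<in> carrier alg" for f g h :: "'p \<Rightarrow> 'k"
      using mult_assoc[OF that] by (simp add: alg_simps)
    show "\<one>\<^bsub>alg\<^esub> \<in> carrier (alg :: ('p \<Rightarrow> 'k) ring)" by (simp add: one_eq_scalar scalar_closed)
    show "\<one>\<^bsub>alg\<^esub> \<otimes>\<^bsub>alg\<^esub> f = f" "f \<otimes>\<^bsub>alg\<^esub> \<one>\<^bsub>alg\<^esub> = f" if "f \<in> carrier alg" for f :: "'p \<Rightarrow> 'k"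
      using mult_scalar[OF that, of 1] by (simp_all add: one_eq_scalar alg_simps(2))
  qed
qed (auto simp: mult_add alg_simps(2,5))

lemma single_closed: "p \<in> B \<Longrightarrow> single p \<in> carrier (alg :: ('p \<Rightarrow> 'k::field) ring)"
proof -
  assume "p \<in> B"
  moreover have "{x. single p x \<noteq> (0::'k)} = {p}" by (auto simp: single_def)
  ultimately show ?thesis by (auto simp: alg_simps)
qed

lemma finsum_alg:
  fixes f :: "'i \<Rightarrow> 'p \<Rightarrow> 'k::field"
  assumes "finite D" "f \<in> D \<rightarrow> carrier alg"
  shows "finsum alg f D z = (\<Sum>j\<in>D. f j z)"
  using assms
proof (induction D rule: finite_induct)
  interpret ring "alg :: ('p \<Rightarrow> 'k) ring" by (rule ring_alg)
  case empty
  show ?case by (simp add: alg_simps)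
next
  interpret ring "alg :: ('p \<Rightarrow> 'k) ring" by (rule ring_alg)
  case (insert j D)
  then have "f j \<in> carrier alg" "f \<in> D \<rightarrow> carrier alg" by auto
  with insert show ?case by (simp add: finsum_insert alg_simps(5))
qed

lemma mult_letter:
  fixes f :: "'p \<Rightarrow> 'k::field"
  assumes f: "f \<in> carrier alg" and k: "k \<in> C" and p: "p \<in> B" "k' \<in> C" "c p (b k') = Some z"
  shows "basis_mult c f (single (b k)) z = (if k = k' then f p else 0)"
proof (cases "k = k'")
  case True
  have "basis_mult c f (single (b k)) z = f p"
    by (rule mult_single_right(1)[OF f p(1)]) (use True p append_letter_unique k in blast)+
  then show ?thesis using True by simp
next
  case False
  have "basis_mult c f (single (b k)) z = 0"
    by (rule mult_single_right(2)[OF f]) (use False p append_letter_unique k in blast)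
  then show ?thesis using False by simp
qed

lemma mult_letter_unit:
  fixes f :: "'p \<Rightarrow> 'k::field"
  assumes "f \<in> carrier alg" "k \<in> C" "v \<in> {1..n}"
  shows "basis_mult c f (single (b k)) (i v) = 0"
  by (rule mult_single_right(2)[OF assms(1)]) (use append_letter_not_unit assms in blast)

lemma one_eq_sum_units:
  "finsum alg (\<lambda>v. single (i v)) {1..n} = (one alg :: 'p \<Rightarrow> 'k::field)"
proof
  fix z
  have "finsum alg (\<lambda>v. single (i v)) {1..n} z = (\<Sum>v\<in>{1..n}. (single (i v) z :: 'k))"
    by (rule finsum_alg) (auto intro!: single_closed unit_closed)
  also have "\<dots> = (if z \<in> U then 1 else 0)"
  proof (cases "z \<in> U")
    case True
    then obtain u where u: "u \<in> {1..n}" "z = i u" by (auto simp: U_def)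
    have "(\<Sum>v\<in>{1..n}. (single (i v) z :: 'k)) = (\<Sum>v\<in>{1..n}. if v = u then 1 else 0)"
    proof (rule sum.cong)
      fix v assume v: "v \<in> {1..n}"
      have "i u = i v \<longleftrightarrow> v = u" using unit_ends(1)[OF v] unit_ends(1)[OF u(1)] by metis
      then show "single (i v) z = (if v = u then 1 else 0 :: 'k)" by (auto simp: single_def u(2))
    qed simp
    then show ?thesis using u True by simp
  next
    case False
    then have "(\<Sum>v\<in>{1..n}. (single (i v) z :: 'k)) = 0"
      by (intro sum.neutral) (auto simp: single_def U_def)
    then show ?thesis using False by simp
  qed
  finally show "finsum alg (\<lambda>v. single (i v)) {1..n} z = (one alg z :: 'k)" by (simp add: alg_simps)
qed

lemma single_mult_single:
  assumes "c p q = Some z"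
  shows "basis_mult c (single p) (single q) = (single z :: 'p \<Rightarrow> 'k::field)"
proof
  fix w
  show "basis_mult c (single p) (single q) w = (single z w :: 'k)"
    by (subst basis_mult_eq[of "{p}" _ "{q}"]) (use assms in \<open>auto simp: single_def\<close>)
qed

lemma single_mult_single_None:
  assumes "c p q = None"
  shows "basis_mult c (single p) (single q) = (\<lambda>_. 0 :: 'k::field)"
proof
  fix w
  show "basis_mult c (single p) (single q) w = (0 :: 'k)"
    by (subst basis_mult_eq[of "{p}" _ "{q}"]) (use assms in \<open>auto simp: single_def\<close>)
qed

lemma unit_mult_unit:
  assumes "u \<in> {1..n}" "v \<in> {1..n}"
  shows "c (i u) (i v) = (if u = v then Some (i v) else None)"
  using left_unit[OF unit_closed[OF assms(2)] assms(1)] unit_ends(1)[OF assms(2)] by simp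

lemma letter_vertices: "k \<in> C \<Longrightarrow> t k \<in> {1..n}" "k \<in> C \<Longrightarrow> Suc (t k) \<in> {1..n}"
  using letter_range by force+

lemma target_append_letter:
  assumes "p \<in> B" "k \<in> C" "c p (b k) = Some q"
  shows "target p = t k" "target q = Suc (t k)"
  using append_letter[OF assms(1,2)] append_letter_None[OF assms(1,2)] assms(3) by force+

text \<open>
  The left cofactor of the letter \<open>b k\<close> in \<open>f\<close>.
\<close>

definition strip_letter :: "('p \<Rightarrow> 'k::field) \<Rightarrow> nat \<Rightarrow> 'p \<Rightarrow> 'k" where
  "strip_letter f k = (\<lambda>p. if p \<in> B \<and> target p = t k then f (the (c p (b k))) else 0)"

lemma strip_letter_closed:
  fixes f :: "'p \<Rightarrow> 'k::field"
  assumes f: "f \<in> carrier alg" and k: "k \<in> C"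
  shows "strip_letter f k \<in> carrier alg"
proof -
  let ?S = "{p \<in> B. target p = t k \<and> f (the (c p (b k))) \<noteq> 0}"
  have app: "c p (b k) = Some (the (c p (b k)))" if "p \<in> B" "target p = t k" for p
    using append_letter[OF that(1) k that(2)] by auto
  have "inj_on (\<lambda>p. the (c p (b k))) ?S"
  proof (rule inj_onI)
    fix p p' assume p: "p \<in> ?S" "p' \<in> ?S" and "the (c p (b k)) = the (c p' (b k))"
    then have "c p (b k) = Some (the (c p (b k)))" "c p' (b k) = Some (the (c p (b k)))"
      using app[of p] app[of p'] by simp_all
    then show "p = p'" using append_letter_unique[of p p' k k] p k by blast
  qed
  moreover have "finite ((\<lambda>p. the (c p (b k))) ` ?S)"
    by (rule finite_subset[of _ "{z. f z \<noteq> 0}"]) (use f in \<open>auto simp: alg_simps\<close>)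
  ultimately have "finite ?S" by (rule finite_imageD[rotated])
  moreover have "{p. strip_letter f k p \<noteq> 0} = ?S" by (auto simp: strip_letter_def)
  ultimately show ?thesis by (auto simp: alg_simps)
qed

lemma last_letter_decomposition:
  fixes f :: "'p \<Rightarrow> 'k::field"
  assumes v: "v \<in> {1..n}" and f: "f \<in> carrier alg" and fv: "basis_mult c f (single (i v)) = f"
  shows "f z = scalar (f (i v)) z * single (i v) z +
    (\<Sum>k\<in>{k\<in>C. Suc (t k) = v}. basis_mult c (strip_letter f k) (single (b k)) z)"
proof -
  let ?S = "{k\<in>C. Suc (t k) = v}"
  have S: "finite ?S" using finite_letters by auto
  have iv: "i v \<in> U" using v by (auto simp: U_def)
  have supp: "z \<in> B \<and> target z = v" if "f z \<noteq> 0"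
    using that mult_unit_right[OF f v, of z] fv by (auto split: if_splits)
  consider "z = i v" | "z \<noteq> i v" "f z = 0" "\<And>p k. p \<in> B \<Longrightarrow> k \<in> ?S \<Longrightarrow> c p (b k) \<noteq> Some z"
    | p k where "p \<in> B" "k \<in> ?S" "c p (b k) = Some z"
  proof -
    have "f z = 0" if ne: "z \<noteq> i v" and none: "\<And>p k. p \<in> B \<Longrightarrow> k \<in> ?S \<Longrightarrow> c p (b k) \<noteq> Some z"
    proof (rule ccontr)
      assume "f z \<noteq> 0"
      then have z: "z \<in> B" "target z = v" using supp by auto
      then obtain p k where pk: "p \<in> B" "k \<in> C" "c p (b k) = Some z"
        using last_letter[OF z(1)] ne by auto
      then show False using none[of p k] target_append_letter(2)[OF pk] z by auto
    qed
    then show ?thesis using that by blast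
  qed
  then show ?thesis
  proof cases
    case 1
    have "(\<Sum>k\<in>?S. basis_mult c (strip_letter f k) (single (b k)) z) = 0"
      unfolding 1 by (rule sum.neutral) (use mult_letter_unit[OF strip_letter_closed[OF f]] v in auto)
    then show ?thesis using iv by (simp add: 1 scalar_def single_def)
  next
    case 2
    have "(\<Sum>k\<in>?S. basis_mult c (strip_letter f k) (single (b k)) z) = 0"
      by (intro sum.neutral ballI mult_single_right(2) strip_letter_closed f) (use 2(3) in auto)
    then show ?thesis using 2(1,2) by (simp add: single_def)
  next
    case 3
    have k: "k \<in> C" using 3(2) by simp
    have "z \<noteq> i v" using append_letter_not_unit[OF 3(1) k v] 3(3) by auto
    moreover have "(\<Sum>j\<in>?S. basis_mult c (strip_letter f j) (single (b j)) z) =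
        (\<Sum>j\<in>?S. if j = k then strip_letter f k p else 0)"
      by (rule sum.cong) (use mult_letter[OF strip_letter_closed[OF f] _ 3(1) k 3(3)] in auto)
    moreover have "strip_letter f k p = f z"
      using 3(1,3) target_append_letter(1)[OF 3(1) k 3(3)] by (simp add: strip_letter_def)
    ultimately show ?thesis using S 3(2) by (simp add: single_def)
  qed
qed

text \<open>
  Cofactors of the letters are read off from coefficients, by unique factorization: the coefficient
  of \<open>p \<cdot> b k\<close> in \<open>\<Sum> \<alpha>\<^sub>k b\<^sub>k\<close> is that of \<open>p\<close> in \<open>\<alpha>\<^sub>k\<close>.
\<close>

theorem hereditary_layered_alg:
  "hereditary_layered_algebra (alg :: ('p \<Rightarrow> 'k::field) ring) scalar n (\<lambda>v. single (i v)) C t (\<lambda>k. single (b k))"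
proof -
  interpret ring "alg :: ('p \<Rightarrow> 'k) ring" by (rule ring_alg)
  have fin: "finite {k\<in>C. Suc (t k) = v}" for v using finite_letters by auto
  show ?thesis
  proof (unfold_locales, goal_cases)
    case (1 l)
    show ?case by (rule scalar_closed)
  next
    case (2 l m)
    show ?case by (auto simp: scalar_def alg_simps)
  next
    case (3 l m)
    show ?case by (simp add: alg_simps(2) mult_scalar(1)[OF scalar_closed]) (auto simp: scalar_def)
  next
    case 4
    show ?case by (simp add: one_eq_scalar)
  next
    case (5 r l)
    show ?case using mult_scalar[OF 5] by (simp add: alg_simps(2))
  next
    case 6
    show ?case by (rule pos)
  next
    case (7 v)
    show ?case by (rule single_closed[OF unit_closed[OF 7]])
  next
    case (8 v)
    show ?case using single_mult_single[of "i v" "i v" "i v"] unit_mult_unit[OF 8 8] by (simp add: alg_simps(2))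
  next
    case (9 u v)
    show ?case
      using single_mult_single_None[of "i u" "i v"] unit_mult_unit[OF 9(1,2)] 9(3) by (simp add: alg_simps(2,4))
  next
    case 10
    show ?case by (rule one_eq_sum_units)
  next
    case 11
    show ?case by (rule finite_letters)
  next
    case (12 k)
    show ?case by (rule letter_range[OF 12])
  next
    case (13 k)
    show ?case by (rule single_closed[OF letter_closed[OF 13]])
  next
    case (14 k)
    show ?case
      using single_mult_single[of "i (t k)" "b k" "b k"] left_unit[OF letter_closed letter_vertices(1)] letter_ends 14
      by (simp add: alg_simps(2))
  next
    case (15 k)
    show ?case
      using single_mult_single[of "b k" "i (Suc (t k))" "b k"] right_unit[OF letter_closed letter_vertices(2)] letter_ends 15
      by (simp add: alg_simps(2))
  next
    case (16 v r)
    let ?S = "{k\<in>C. Suc (t k) = v}"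
    have a: "strip_letter r k \<in> carrier alg" if "k \<in> ?S" for k using strip_letter_closed[OF 16(2)] that by auto
    have eq: "strip_letter r k \<otimes>\<^bsub>alg\<^esub> single (i (t k)) = strip_letter r k" if "k \<in> ?S" for k
      using mult_unit_right[OF a[OF that] letter_vertices(1)] that
      by (auto simp: alg_simps(2) strip_letter_def)
    have cl: "(\<lambda>k. strip_letter r k \<otimes>\<^bsub>alg\<^esub> single (b k)) \<in> ?S \<rightarrow> carrier alg"
      using a single_closed[OF letter_closed] by (auto intro!: m_closed)
    have "r = scalar (r (i v)) \<otimes>\<^bsub>alg\<^esub> single (i v) \<oplus>\<^bsub>alg\<^esub>
        finsum alg (\<lambda>k. strip_letter r k \<otimes>\<^bsub>alg\<^esub> single (b k)) ?S"
    proof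
      fix z
      have "scalar (r (i v)) z * single (i v) z = r (i v) * single (i v) z"
        using 16(1) by (auto simp: scalar_def single_def U_def)
      then show "r z = (scalar (r (i v)) \<otimes>\<^bsub>alg\<^esub> single (i v) \<oplus>\<^bsub>alg\<^esub>
          finsum alg (\<lambda>k. strip_letter r k \<otimes>\<^bsub>alg\<^esub> single (b k)) ?S) z"
        using last_letter_decomposition[OF 16(1,2), of z] 16(3)
          mult_scalar(1)[OF single_closed[OF unit_closed[OF 16(1)]], of "r (i v)"]
        by (simp add: alg_simps(2,5) finsum_alg[OF fin cl[unfolded alg_simps(2)]])
    qed
    then show ?case using a eq by blast
  next
    case (17 v \<alpha> k)
    let ?S = "{k\<in>C. Suc (t k) = v}"
    have kS: "k \<in> ?S" using 17 by simp
    have cl: "(\<lambda>k. \<alpha> k \<otimes>\<^bsub>alg\<^esub> single (b k)) \<in> ?S \<rightarrow> carrier alg"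
      using 17(2) single_closed[OF letter_closed] by (auto intro!: m_closed)
    have ak: "\<alpha> k \<in> carrier alg" "basis_mult c (\<alpha> k) (single (i (t k))) = \<alpha> k"
      using 17(2) kS by (auto simp: alg_simps(2))
    have "\<alpha> k p = 0" for p
    proof (cases "p \<in> B \<and> target p = t k")
      case True
      then obtain q where q: "c p (b k) = Some q" using append_letter[of p k] 17(4) by auto
      have "0 = finsum alg (\<lambda>k. \<alpha> k \<otimes>\<^bsub>alg\<^esub> single (b k)) ?S q" using 17(3) by (simp add: alg_simps(4))
      also have "\<dots> = (\<Sum>j\<in>?S. basis_mult c (\<alpha> j) (single (b j)) q)"
        using finsum_alg[OF fin cl] by (simp add: alg_simps(2))
      also have "\<dots> = (\<Sum>j\<in>?S. if j = k then \<alpha> k p else 0)"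
      proof (rule sum.cong)
        fix j assume j: "j \<in> ?S"
        then have aj: "\<alpha> j \<in> carrier alg" "j \<in> C" using 17(2) by blast+
        then show "basis_mult c (\<alpha> j) (single (b j)) q = (if j = k then \<alpha> k p else 0)"
          using mult_letter[OF aj _ 17(4) q] True by simp
      qed simp
      also have "\<dots> = \<alpha> k p" using fin kS by simp
      finally show ?thesis by simp
    next
      case False
      then show ?thesis using mult_unit_right[OF ak(1) letter_vertices(1)[OF 17(4)], of p] ak(2) by auto
    qed
    then show ?case by (auto simp: alg_simps(4))
  qed
qed

end

section \<open>Paths in the quiver of a presentation\<close>

lemma Nil_eq_upt_iff [simp]: "[] = [u..<w] \<longleftrightarrow> w \<le> u"
  by (subst eq_commute) auto

lemma tail_quiver [simp]: "tail (quiver n a) = arrow_index"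
  and head_quiver [simp]: "head (quiver n a) g = Suc (arrow_index g)"
  by (simp_all add: quiver_def)

text \<open>
  Every arrow raises the vertex by one, so that a path is determined by its arrows and the vertices
  along it are consecutive numbers.
\<close>

lemma cas_quiver_iff:
  "pre_digraph.cas (quiver n a) u p w \<longleftrightarrow> u \<le> w \<and> map arrow_index p = [u..<w]"
proof (induction p arbitrary: u)
  case Nil
  then show ?case by (auto simp: pre_digraph.cas.simps)
next
  case (Cons g p)
  have "pre_digraph.cas (quiver n a) u (g # p) w \<longleftrightarrow>
      arrow_index g = u \<and> Suc u \<le> w \<and> map arrow_index p = [Suc u..<w]"
    by (auto simp: pre_digraph.cas.simps Cons.IH)
  also have "\<dots> \<longleftrightarrow> u \<le> w \<and> map arrow_index (g # p) = [u..<w]"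
    by (cases "u < w") (auto simp: upt_conv_Cons)
  finally show ?case .
qed

lemma arcs_quiver_index: "g \<in> arcs (quiver n a) \<Longrightarrow> arrow_index g \<in> {1..<n}"
  by (auto simp: quiver_def)

lemma paths_quiver_iff:
  "(u, p, w) \<in> paths (quiver n a) \<longleftrightarrow>
    1 \<le> u \<and> u \<le> w \<and> w \<le> n \<and> set p \<subseteq> arcs (quiver n a) \<and> map arrow_index p = [u..<w]"
proof -
  have "w \<le> n" if "u \<le> w" "u \<le> n" and p: "set p \<subseteq> arcs (quiver n a)" "map arrow_index p = [u..<w]"
  proof (cases "u < w")
    case True
    then have "w - 1 \<in> set (map arrow_index p)" using p(2) by auto
    then obtain g where "g \<in> arcs (quiver n a)" "arrow_index g = w - 1" using p(1) by auto
    then show ?thesis using arcs_quiver_index by fastforce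
  qed (use that in simp)
  then show ?thesis
    by (auto simp: paths_def pre_digraph.awalk_def cas_quiver_iff) (auto simp: quiver_def)
qed

lemma finite_arcs_quiver: "finite (arcs (quiver n a))"
proof -
  have "arcs (quiver n a) \<subseteq> E ` {1..<n} \<union> (\<lambda>(m, i). A m i) ` ({1..<n} \<times> {1..a})"
    by (auto simp: quiver_def)
  then show ?thesis by (rule finite_subset) auto
qed

lemma upt_append_upt: "u \<le> v \<Longrightarrow> v \<le> w \<Longrightarrow> [u..<v] @ [v..<w] = [u..<w]"
  by (metis le_add_diff_inverse upt_add_eq_append)

lemma path_comp_assoc:
  "Option.bind (path_comp p q) (\<lambda>y. path_comp y r) = Option.bind (path_comp q r) (path_comp p)"
  by (cases p; cases q; cases r) auto

lemma path_comp_closed: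
  assumes "p \<in> paths (quiver n a)" "q \<in> paths (quiver n a)" "path_comp p q = Some r"
  shows "r \<in> paths (quiver n a)"
proof -
  obtain u p' v v' q' w where "p = (u, p', v)" "q = (v', q', w)" by (metis prod_cases3)
  then show ?thesis
    using assms by (auto simp: paths_quiver_iff upt_append_upt split: if_splits)
qed

abbreviation arrow_path :: "arrow \<Rightarrow> (nat, arrow) path" where
  "arrow_path g \<equiv> (arrow_index g, [g], Suc (arrow_index g))"

lemma arrow_path_closed: "g \<in> arcs (quiver n a) \<Longrightarrow> arrow_path g \<in> paths (quiver n a)"
  using arcs_quiver_index[of g n a] by (auto simp: paths_quiver_iff)

lemma path_last_arrow:
  assumes "(u, p, w) \<in> paths (quiver n a)" "p \<noteq> []"
  obtains p' g where "(u, p', arrow_index g) \<in> paths (quiver n a)" "g \<in> arcs (quiver n a)"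
    "p = p' @ [g]" "w = Suc (arrow_index g)"
proof -
  obtain p' g where p: "p = p' @ [g]" using assms(2) by (metis rev_exhaust)
  have *: "1 \<le> u" "u \<le> w" "w \<le> n" "set p \<subseteq> arcs (quiver n a)" "map arrow_index p = [u..<w]"
    using assms(1) by (auto simp: paths_quiver_iff)
  have "u < w" using *(2,5) p by (cases "u < w") auto
  then obtain w' where w: "w = Suc w'" "u \<le> w'" by (cases w) auto
  then have "map arrow_index p' = [u..<w']" "arrow_index g = w'" using *(5) p by auto
  then have "(u, p', arrow_index g) \<in> paths (quiver n a)"
    unfolding paths_quiver_iff using *(1,3,4) w p by simp
  then show ?thesis
    by (rule that) (use *(4) p w \<open>arrow_index g = w'\<close> in simp_all)
qed

lemma path_first_arrow:
  assumes "(u, p, w) \<in> paths (quiver n a)" "p \<noteq> []"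
  obtains p' g where "(Suc (arrow_index g), p', w) \<in> paths (quiver n a)" "g \<in> arcs (quiver n a)"
    "p = g # p'" "u = arrow_index g"
proof -
  obtain p' g where p: "p = g # p'" using assms(2) by (cases p) auto
  have *: "1 \<le> u" "u \<le> w" "w \<le> n" "set p \<subseteq> arcs (quiver n a)" "map arrow_index p = [u..<w]"
    using assms(1) by (auto simp: paths_quiver_iff)
  have "u < w" using *(2,5) p by (cases "u < w") auto
  then have "map arrow_index p' = [Suc u..<w]" "arrow_index g = u" using *(5) p by (auto simp: upt_conv_Cons)
  then have "(Suc (arrow_index g), p', w) \<in> paths (quiver n a)"
    unfolding paths_quiver_iff using *(3,4) \<open>u < w\<close> p by simp
  then show ?thesis
    by (rule that) (use *(4) p \<open>arrow_index g = u\<close> in simp_all)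
qed

lemma layered_basis_paths:
  assumes n: "1 \<le> n" and \<gamma>: "bij_betw \<gamma> C (arcs (quiver n a))" and C: "finite C"
  shows "layered_basis (paths (quiver n a)) path_comp fst (\<lambda>p. snd (snd p)) n (\<lambda>v. (v, [], v))
    C (\<lambda>k. arrow_index (\<gamma> k)) (\<lambda>k. arrow_path (\<gamma> k))"
proof -
  have arc: "\<gamma> k \<in> arcs (quiver n a)" if "k \<in> C" for k using \<gamma> that by (auto simp: bij_betw_def)
  have inj: "k = k'" if "\<gamma> k = \<gamma> k'" "k \<in> C" "k' \<in> C" for k k' using \<gamma> that by (auto simp: bij_betw_def inj_on_def)
  show ?thesis
  proof
    show "r \<in> paths (quiver n a)" if "p \<in> paths (quiver n a)" "q \<in> paths (quiver n a)" "path_comp p q = Some r" for p q r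
      by (rule path_comp_closed[OF that])
    show "arrow_index (\<gamma> k) \<in> {1..<n}" if "k \<in> C" for k by (rule arcs_quiver_index[OF arc[OF that]])
    show "arrow_path (\<gamma> k) \<in> paths (quiver n a)" if "k \<in> C" for k by (rule arrow_path_closed[OF arc[OF that]])
    show "\<exists>q\<in>paths (quiver n a). path_comp p (arrow_path (\<gamma> k)) = Some q \<and> snd (snd q) = Suc (arrow_index (\<gamma> k))"
      if "p \<in> paths (quiver n a)" "k \<in> C" "snd (snd p) = arrow_index (\<gamma> k)" for p k
    proof -
      obtain u p' v where p: "p = (u, p', v)" by (metis prod_cases3)
      then have "path_comp p (arrow_path (\<gamma> k)) = Some (u, p' @ [\<gamma> k], Suc (arrow_index (\<gamma> k)))" using that(3) by simp
      then show ?thesis using path_comp_closed[OF that(1) arrow_path_closed[OF arc[OF that(2)]]] by auto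
    qed
    show "p = p' \<and> k = k'" if "k \<in> C" "k' \<in> C"
      "path_comp p (arrow_path (\<gamma> k)) = Some q" "path_comp p' (arrow_path (\<gamma> k')) = Some q" for p p' k k' q
      using that inj by (cases p; cases p') (auto split: if_splits)
    show "q = (snd (snd q), [], snd (snd q)) \<or> (\<exists>p\<in>paths (quiver n a). \<exists>k\<in>C. path_comp p (arrow_path (\<gamma> k)) = Some q)"
      if q: "q \<in> paths (quiver n a)" for q
    proof -
      obtain u p w where q': "q = (u, p, w)" by (metis prod_cases3)
      show ?thesis
      proof (cases "p = []")
        case True
        then show ?thesis using q q' by (auto simp: paths_quiver_iff)
      next
        case False
        obtain p' g where p: "(u, p', arrow_index g) \<in> paths (quiver n a)" "g \<in> arcs (quiver n a)"
            "p = p' @ [g]" "w = Suc (arrow_index g)"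
          by (rule path_last_arrow[OF q[unfolded q'] False])
        obtain k where "k \<in> C" "g = \<gamma> k" using p(2) \<gamma> by (auto simp: bij_betw_def)
        then have "k \<in> C" "path_comp (u, p', arrow_index g) (arrow_path (\<gamma> k)) = Some q"
          using p q' by simp_all
        then show ?thesis using p(1) by blast
      qed
    qed
  qed (use n C path_comp_assoc in \<open>auto simp: paths_quiver_iff split: if_splits\<close>)
qed

text \<open>
  Reading paths from right to left turns first arrows into last ones.  The vertices are renumbered by
  \<open>v \<mapsto> n + 1 - v\<close>, so that arrows still raise the vertex by one.
\<close>

lemma layered_basis_reversed_paths:
  assumes n: "1 \<le> n" and \<gamma>: "bij_betw \<gamma> C (arcs (quiver n a))" and C: "finite C"
  shows "layered_basis (paths (quiver n a)) (\<lambda>p q. path_comp q p)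
    (\<lambda>p. n + 1 - snd (snd p)) (\<lambda>p. n + 1 - fst p) n (\<lambda>v. (n + 1 - v, [], n + 1 - v))
    C (\<lambda>k. n - arrow_index (\<gamma> k)) (\<lambda>k. arrow_path (\<gamma> k))"
proof -
  have arc: "\<gamma> k \<in> arcs (quiver n a)" if "k \<in> C" for k using \<gamma> that by (auto simp: bij_betw_def)
  have ind: "1 \<le> arrow_index (\<gamma> k)" "arrow_index (\<gamma> k) < n" if "k \<in> C" for k
    using arcs_quiver_index[OF arc[OF that]] by auto
  have inj: "k = k'" if "\<gamma> k = \<gamma> k'" "k \<in> C" "k' \<in> C" for k k' using \<gamma> that by (auto simp: bij_betw_def inj_on_def)
  show ?thesis
  proof
    show "Option.bind (path_comp q p) (path_comp r) = Option.bind (path_comp r q) (\<lambda>y. path_comp y p)" for p q r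
      by (rule path_comp_assoc[symmetric])
    show "r \<in> paths (quiver n a)" if "p \<in> paths (quiver n a)" "q \<in> paths (quiver n a)" "path_comp q p = Some r" for p q r
      by (rule path_comp_closed[OF that(2,1,3)])
    show "n - arrow_index (\<gamma> k) \<in> {1..<n}" if "k \<in> C" for k using ind[OF that] by auto
    show "arrow_path (\<gamma> k) \<in> paths (quiver n a)" if "k \<in> C" for k by (rule arrow_path_closed[OF arc[OF that]])
    show "n + 1 - fst (arrow_path (\<gamma> k)) = Suc (n - arrow_index (\<gamma> k))" if "k \<in> C" for k
      using ind[OF that] by auto
    show "\<exists>q\<in>paths (quiver n a). path_comp (arrow_path (\<gamma> k)) p = Some q \<and> n + 1 - fst q = Suc (n - arrow_index (\<gamma> k))"
      if "p \<in> paths (quiver n a)" "k \<in> C" "n + 1 - fst p = n - arrow_index (\<gamma> k)" for p k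
    proof -
      obtain u p' v where p: "p = (u, p', v)" by (metis prod_cases3)
      then have "u = Suc (arrow_index (\<gamma> k))" using that ind[OF that(2)] by (auto simp: paths_quiver_iff)
      then have "path_comp (arrow_path (\<gamma> k)) p = Some (arrow_index (\<gamma> k), \<gamma> k # p', v)" using p by simp
      then show ?thesis
        using path_comp_closed[OF arrow_path_closed[OF arc[OF that(2)]] that(1)] ind[OF that(2)] by auto
    qed
    show "path_comp (arrow_path (\<gamma> k)) p = None"
      if "p \<in> paths (quiver n a)" "k \<in> C" "n + 1 - fst p \<noteq> n - arrow_index (\<gamma> k)" for p k
      using that by (cases p) (auto simp: paths_quiver_iff)
    show "p = p' \<and> k = k'" if "k \<in> C" "k' \<in> C"
      "path_comp (arrow_path (\<gamma> k)) p = Some q" "path_comp (arrow_path (\<gamma> k')) p' = Some q" for p p' k k' q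
      using that inj by (cases p; cases p') (auto split: if_splits)
    show "path_comp (arrow_path (\<gamma> k)) p \<noteq> Some (n + 1 - v, [], n + 1 - v)" for k p v
      by (cases p) auto
    show "path_comp (n + 1 - v, [], n + 1 - v) p = (if v = n + 1 - fst p then Some p else None)"
      if "p \<in> paths (quiver n a)" "v \<in> {1..n}" for p v
      using that by (cases p) (auto simp: paths_quiver_iff)
    show "path_comp p (n + 1 - v, [], n + 1 - v) = (if v = n + 1 - snd (snd p) then Some p else None)"
      if "p \<in> paths (quiver n a)" "v \<in> {1..n}" for p v
      using that by (cases p) (auto simp: paths_quiver_iff)
    show "q = (n + 1 - (n + 1 - fst q), [], n + 1 - (n + 1 - fst q)) \<or>
        (\<exists>p\<in>paths (quiver n a). \<exists>k\<in>C. path_comp (arrow_path (\<gamma> k)) p = Some q)"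
      if q: "q \<in> paths (quiver n a)" for q
    proof -
      obtain u p w where q': "q = (u, p, w)" by (metis prod_cases3)
      show ?thesis
      proof (cases "p = []")
        case True
        then show ?thesis using q q' by (auto simp: paths_quiver_iff)
      next
        case False
        obtain p' g where p: "(Suc (arrow_index g), p', w) \<in> paths (quiver n a)" "g \<in> arcs (quiver n a)"
            "p = g # p'" "u = arrow_index g"
          by (rule path_first_arrow[OF q[unfolded q'] False])
        obtain k where "k \<in> C" "g = \<gamma> k" using p(2) \<gamma> by (auto simp: bij_betw_def)
        then have "k \<in> C" "path_comp (arrow_path (\<gamma> k)) (Suc (arrow_index g), p', w) = Some q"
          using p q' by simp_all
        then show ?thesis using p(1) by blast
      qed
    qed
  qed (use n C in \<open>auto simp: paths_quiver_iff split: if_splits\<close>)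
qed

section \<open>Relations between the extreme vertices\<close>

text \<open>
  All relations of the construction are combinations of paths that run from the first to the last
  vertex, and the bound on the global dimension depends on nothing else.
\<close>

definition spanned_by_full_paths :: "nat \<Rightarrow> nat \<Rightarrow> ((nat, arrow) path \<Rightarrow> 'k::field) \<Rightarrow> bool" where
  "spanned_by_full_paths n a f \<longleftrightarrow> finite {p. f p \<noteq> 0} \<and>
    (\<forall>p. f p \<noteq> 0 \<longrightarrow> p \<in> paths (quiver n a) \<and> fst p = 1 \<and> snd (snd p) = n)"

lemma spanned_by_full_paths_single:
  assumes "(1, p, n) \<in> paths (quiver n a)"
  shows "spanned_by_full_paths n a (single (1, p, n) :: _ \<Rightarrow> 'k::field)"
proof -
  have supp: "single (1, p, n) q \<noteq> (0 :: 'k) \<longleftrightarrow> q = (1, p, n)" for q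
    by (simp add: single_def)
  show ?thesis
    unfolding spanned_by_full_paths_def supp using assms by simp
qed

lemma spanned_by_full_paths_diff:
  assumes "spanned_by_full_paths n a f" "spanned_by_full_paths n a g"
  shows "spanned_by_full_paths n a (\<lambda>z. f z - g z)"
proof -
  have "{p. f p - g p \<noteq> 0} \<subseteq> {p. f p \<noteq> 0} \<union> {p. g p \<noteq> 0}" by auto
  then have "finite {p. f p - g p \<noteq> 0}"
    by (rule finite_subset) (use assms in \<open>auto simp: spanned_by_full_paths_def\<close>)
  moreover have "f p \<noteq> 0 \<or> g p \<noteq> 0" if "f p - g p \<noteq> 0" for p using that by auto
  ultimately show ?thesis using assms unfolding spanned_by_full_paths_def by blast
qed

lemma spanned_by_full_paths_sum:
  assumes "finite D" "\<And>w. w \<in> D \<Longrightarrow> spanned_by_full_paths n a (f w)"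
  shows "spanned_by_full_paths n a (\<lambda>z. \<Sum>w\<in>D. l w * f w z)"
proof -
  have ex: "\<exists>w\<in>D. f w p \<noteq> 0" if "(\<Sum>w\<in>D. l w * f w p) \<noteq> 0" for p
    using that by (metis (no_types, lifting) mult_eq_0_iff sum.not_neutral_contains_not_neutral)
  have "{p. (\<Sum>w\<in>D. l w * f w p) \<noteq> 0} \<subseteq> (\<Union>w\<in>D. {p. f w p \<noteq> 0})" using ex by auto
  then have "finite {p. (\<Sum>w\<in>D. l w * f w p) \<noteq> 0}"
    by (rule finite_subset) (use assms in \<open>auto simp: spanned_by_full_paths_def\<close>)
  then show ?thesis using assms(2) ex unfolding spanned_by_full_paths_def by blast
qed

lemma map_index_e_arrows [simp]: "map arrow_index (e_arrows s t) = [s..<t]"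
  by (simp add: e_arrows_def o_def)

lemma e_arrows_closed: "1 \<le> s \<Longrightarrow> t \<le> n \<Longrightarrow> set (e_arrows s t) \<subseteq> arcs (quiver n a)"
  by (auto simp: e_arrows_def quiver_def)

lemma T_relations_full:
  assumes "f \<in> T_relations n a"
  shows "spanned_by_full_paths n a f"
proof -
  obtain m i where mi: "1 < m" "m < n" "1 \<le> i" "i \<le> a"
    and f: "f = (\<lambda>z. single (1, A 1 i # e_arrows 2 n, n) z
         - single (1, e_arrows 1 m @ A m i # e_arrows (m + 1) n, n) z)"
    using assms by (auto simp: T_relations_def)
  have arcs: "A 1 i \<in> arcs (quiver n a)" "A m i \<in> arcs (quiver n a)" using mi by (auto simp: quiver_def)
  have 1: "1 # [2..<n] = [1..<n]" using mi upt_conv_Cons[of 1 n] by (simp add: numeral_2_eq_2)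
  have 2: "[1..<m] @ m # [m + 1..<n] = [1..<n]"
    using mi upt_append_upt[of 1 m n] upt_conv_Cons[of m n] by simp
  have "(1, A 1 i # e_arrows 2 n, n) \<in> paths (quiver n a)"
    using arcs e_arrows_closed[of 2 n n a] mi 1 by (auto simp: paths_quiver_iff)
  moreover have "(1, e_arrows 1 m @ A m i # e_arrows (m + 1) n, n) \<in> paths (quiver n a)"
    using arcs e_arrows_closed[of 1 m n a] e_arrows_closed[of "m + 1" n n a] mi 2 by (auto simp: paths_quiver_iff)
  ultimately show ?thesis
    unfolding f by (intro spanned_by_full_paths_diff spanned_by_full_paths_single)
qed

lemma word_path_closed:
  assumes "length w < n" "set w \<subseteq> {1..a}"
  shows "word_path n w \<in> paths (quiver n a)"
proof -
  let ?p = "map2 A [1..<length w + 1] w"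
  have "map arrow_index ?p = map fst (zip [1..<length w + 1] w)" by (auto simp: o_def)
  also have "\<dots> = [1..<length w + 1]" by simp
  finally have "map arrow_index (?p @ e_arrows (length w + 1) n) = [1..<length w + 1] @ [length w + 1..<n]"
    by simp
  also have "\<dots> = [1..<n]" by (rule upt_append_upt) (use assms in auto)
  finally have "map arrow_index (?p @ e_arrows (length w + 1) n) = [1..<n]" .
  moreover have "set ?p \<subseteq> arcs (quiver n a)"
  proof
    fix g assume "g \<in> set ?p"
    then obtain m i where "g = A m i" "(m, i) \<in> set (zip [1..<length w + 1] w)" by auto
    then have "m \<in> set [1..<length w + 1]" "i \<in> set w" by (auto dest: set_zip_leftD set_zip_rightD)
    then show "g \<in> arcs (quiver n a)" using assms \<open>g = A m i\<close> by (auto simp: quiver_def)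
  qed
  ultimately show ?thesis
    using e_arrows_closed[of "length w + 1" n n a] assms by (auto simp: word_path_def paths_quiver_iff)
qed

lemma lift_relation_full:
  assumes "finite {w. y w \<noteq> 0}" "\<And>w. y w \<noteq> 0 \<Longrightarrow> length w < n \<and> set w \<subseteq> {1..a}"
  shows "spanned_by_full_paths n a (lift_relation n y)"
  unfolding lift_relation_def
proof (rule spanned_by_full_paths_sum)
  show "spanned_by_full_paths n a (single (word_path n w))" if "w \<in> {w. y w \<noteq> 0}" for w
    using word_path_closed[of w n a] assms(2)[of w] that
    unfolding word_path_def by (intro spanned_by_full_paths_single) auto
qed (fact assms(1))

lemma num_vertices_pos: "1 \<le> num_vertices Y"
  by (simp add: num_vertices_def Let_def)

lemma length_less_num_vertices:
  assumes "finite Y" "\<And>y. y \<in> Y \<Longrightarrow> finite {w. y w \<noteq> 0}" "y \<in> Y" "y w \<noteq> 0"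
  shows "length w < num_vertices Y"
proof -
  let ?W = "{w. \<exists>y\<in>Y. y w \<noteq> 0}"
  have "?W = (\<Union>y\<in>Y. {w. y w \<noteq> 0})" by auto
  then have "finite ?W" using assms(1,2) by auto
  moreover have "w \<in> ?W" using assms(3,4) by auto
  ultimately have "length w \<le> Max (length ` ?W)" by simp
  then show ?thesis using \<open>w \<in> ?W\<close> by (auto simp: num_vertices_def Let_def)
qed

theorem global_dim_full_path_relations:
  fixes S :: "((nat, arrow) path \<Rightarrow> 'k::field) set"
  assumes n: "1 \<le> n" and S: "\<And>f. f \<in> S \<Longrightarrow> spanned_by_full_paths n a f"
  shows "left_global_dim TYPE('m) (quiver_algebra (quiver n a) S) \<le> 2"
    and "right_global_dim TYPE('m) (quiver_algebra (quiver n a) S) \<le> 2"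
proof -
  let ?Q = "quiver n a"
  define N where "N = card (arcs ?Q)"
  obtain \<gamma> where \<gamma>: "bij_betw \<gamma> {0..<N} (arcs ?Q)"
    using ex_bij_betw_nat_finite[OF finite_arcs_quiver] unfolding N_def by blast
  interpret L: layered_basis "paths ?Q" path_comp fst "\<lambda>p. snd (snd p)" n "\<lambda>v. (v, [], v)"
    "{0..<N}" "\<lambda>k. arrow_index (\<gamma> k)" "\<lambda>k. arrow_path (\<gamma> k)"
    by (rule layered_basis_paths[OF n \<gamma>]) simp
  interpret L': layered_basis "paths ?Q" "\<lambda>p q. path_comp q p" "\<lambda>p. n + 1 - snd (snd p)" "\<lambda>p. n + 1 - fst p" n
    "\<lambda>v. (n + 1 - v, [], n + 1 - v)" "{0..<N}" "\<lambda>k. n - arrow_index (\<gamma> k)" "\<lambda>k. arrow_path (\<gamma> k)"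
    by (rule layered_basis_reversed_paths[OF n \<gamma>]) simp
  have U: "{(v, [], v) | v. v \<in> verts ?Q} = L.U" by (auto simp: L.U_def quiver_def)
  have U': "L'.U = L.U"
    unfolding L.U_def L'.U_def
  proof (intro equalityI subsetI)
    fix p assume "p \<in> (\<lambda>v. (v, [], v) :: (nat, arrow) path) ` {1..n}"
    then obtain v where "v \<in> {1..n}" "p = (v, [], v)" by auto
    then show "p \<in> (\<lambda>v. (n + 1 - v, [], n + 1 - v)) ` {1..n}"
      by (intro image_eqI[of _ _ "n + 1 - v"]) auto
  next
    fix p assume "p \<in> (\<lambda>v. (n + 1 - v, [], n + 1 - v) :: (nat, arrow) path) ` {1..n}"
    then obtain v where "v \<in> {1..n}" "p = (n + 1 - v, [], n + 1 - v)" by auto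
    then show "p \<in> (\<lambda>v. (v, [], v)) ` {1..n}"
      by (intro image_eqI[of _ _ "n + 1 - v"]) auto
  qed
  let ?\<Lambda> = "path_algebra ?Q :: ((nat, arrow) path \<Rightarrow> 'k) ring"
  have \<Lambda>: "L.alg = ?\<Lambda>" by (simp add: L.alg_def path_algebra_def U)
  have \<Lambda>': "L'.alg = opposite_ring ?\<Lambda>"
    unfolding L'.alg_def path_algebra_def U U' opposite_basis_algebra by (rule refl)
  have scalar: "L'.scalar = (L.scalar :: 'k \<Rightarrow> _)" 
    unfolding L.scalar_def L'.scalar_def U' by (rule refl)
  let ?e = "\<lambda>v. single (v, [], v) :: (nat, arrow) path \<Rightarrow> 'k"
  interpret H: hereditary_layered_algebra ?\<Lambda> L.scalar n ?e "{0..<N}" "\<lambda>k. arrow_index (\<gamma> k)"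
    "\<lambda>k. single (arrow_path (\<gamma> k))"
    unfolding \<Lambda>[symmetric] by (rule L.hereditary_layered_alg)
  interpret H': hereditary_layered_algebra "opposite_ring ?\<Lambda>" L.scalar n "\<lambda>v. ?e (n + 1 - v)" "{0..<N}"
    "\<lambda>k. n - arrow_index (\<gamma> k)" "\<lambda>k. single (arrow_path (\<gamma> k))"
    unfolding \<Lambda>'[symmetric] scalar[symmetric] by (rule L'.hereditary_layered_alg)
  have mult: "f \<otimes>\<^bsub>?\<Lambda>\<^esub> g = basis_mult path_comp f g" for f g
    by (simp add: path_algebra_def basis_algebra_def)
  have SL: "f \<in> carrier ?\<Lambda>" if "f \<in> S" for f
    unfolding path_algebra_def basis_algebra_def
    using S[OF that] by (auto simp: spanned_by_full_paths_def)
  have n1: "1 \<in> {1..n}" "n \<in> {1..n}" using n by auto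
  have first: "?e 1 \<otimes>\<^bsub>?\<Lambda>\<^esub> f = f" if "f \<in> S" for f
    unfolding mult
  proof
    fix z
    have "f z = 0 \<or> z \<in> paths ?Q \<and> fst z = 1"
      using S[OF that] unfolding spanned_by_full_paths_def by blast
    then show "basis_mult path_comp (?e 1) f z = f z"
      unfolding L.mult_unit_left[OF SL[OF that, folded \<Lambda>] n1(1)] by auto
  qed
  have last: "f \<otimes>\<^bsub>?\<Lambda>\<^esub> ?e n = f" if "f \<in> S" for f
    unfolding mult
  proof
    fix z
    have "f z = 0 \<or> z \<in> paths ?Q \<and> snd (snd z) = n"
      using S[OF that] unfolding spanned_by_full_paths_def by blast
    then show "basis_mult path_comp f (?e n) z = f z"
      unfolding L.mult_unit_right[OF SL[OF that, folded \<Lambda>] n1(2)] by auto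
  qed
  have e_n: "\<exists>l. ?e n \<otimes>\<^bsub>?\<Lambda>\<^esub> r = L.scalar l \<otimes>\<^bsub>?\<Lambda>\<^esub> ?e n" if r: "r \<in> carrier ?\<Lambda>" for r
  proof -
    have "r \<in> carrier (opposite_ring ?\<Lambda>)" using r by simp
    then obtain l where "r \<otimes>\<^bsub>opposite_ring ?\<Lambda>\<^esub> ?e (n + 1 - 1) = L.scalar l \<otimes>\<^bsub>opposite_ring ?\<Lambda>\<^esub> ?e (n + 1 - 1)"
      using H'.first_idem_scalar by blast
    then have "?e n \<otimes>\<^bsub>?\<Lambda>\<^esub> r = ?e n \<otimes>\<^bsub>?\<Lambda>\<^esub> L.scalar l" by (simp only: opposite_ring_simps add_diff_cancel_right')
    also have "\<dots> = L.scalar l \<otimes>\<^bsub>?\<Lambda>\<^esub> ?e n" by (rule H.scalar_central[OF H.idem_closed[OF n1(2)]])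
    finally show ?thesis by blast
  qed
  define I where "I = genideal ?\<Lambda> S"
  have S_closed: "S \<subseteq> carrier ?\<Lambda>" using SL by blast
  have I: "ideal I ?\<Lambda>" unfolding I_def by (rule H.genideal_ideal[OF S_closed])
  have corner: "?e 1 \<otimes>\<^bsub>?\<Lambda>\<^esub> z = z" "z \<otimes>\<^bsub>?\<Lambda>\<^esub> ?e n = z" if "z \<in> I" for z
    using H.genideal_within_corner[OF e_n S_closed first last that[unfolded I_def]] by blast+
  \<comment> \<open>The elements of the quotient are cosets, hence sets, and a type of sets is never a singleton.\<close>
  have ne: "({} :: ((nat, arrow) path \<Rightarrow> 'k) set) \<noteq> UNIV" by simp
  have A: "quiver_algebra ?Q S = ?\<Lambda> Quot I" by (simp add: quiver_algebra_def I_def)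
  interpret Q: almost_hereditary_algebra "?\<Lambda> Quot I" "\<lambda>l. I +>\<^bsub>?\<Lambda>\<^esub> L.scalar l" n "\<lambda>v. I +>\<^bsub>?\<Lambda>\<^esub> ?e v"
    "{0..<N}" "\<lambda>k. arrow_index (\<gamma> k)" "\<lambda>k. I +>\<^bsub>?\<Lambda>\<^esub> single (arrow_path (\<gamma> k))"
    by (rule H.quotient_almost_hereditary[OF I corner])
  show "left_global_dim TYPE('m) (quiver_algebra ?Q S) \<le> 2"
    unfolding A by (rule Q.left_global_dim_le_2[OF ne])
  have "almost_hereditary_algebra (opposite_ring ?\<Lambda> Quot I) (\<lambda>l. I +>\<^bsub>opposite_ring ?\<Lambda>\<^esub> L.scalar l) n
      (\<lambda>v. I +>\<^bsub>opposite_ring ?\<Lambda>\<^esub> ?e (n + 1 - v)) {0..<N} (\<lambda>k. n - arrow_index (\<gamma> k))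
      (\<lambda>k. I +>\<^bsub>opposite_ring ?\<Lambda>\<^esub> single (arrow_path (\<gamma> k)))"
    by (rule H'.quotient_almost_hereditary[OF ideal_opposite_ring[OF I]]) (use corner in simp_all)
  then interpret Q': almost_hereditary_algebra "opposite_ring (?\<Lambda> Quot I)" "\<lambda>l. I +>\<^bsub>opposite_ring ?\<Lambda>\<^esub> L.scalar l" n
    "\<lambda>v. I +>\<^bsub>opposite_ring ?\<Lambda>\<^esub> ?e (n + 1 - v)" "{0..<N}" "\<lambda>k. n - arrow_index (\<gamma> k)"
    "\<lambda>k. I +>\<^bsub>opposite_ring ?\<Lambda>\<^esub> single (arrow_path (\<gamma> k))"
    unfolding opposite_ring_Quot .
  show "right_global_dim TYPE('m) (quiver_algebra ?Q S) \<le> 2"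
    unfolding A right_global_dim_def by (rule Q'.left_global_dim_le_2[OF ne])
qed

theorem proposition1p2:
  fixes a :: nat and Y :: "(nat list \<Rightarrow> 'k::field) set"
  assumes "finite Y" and "Y \<subseteq> carrier (free_algebra {1..a})"
  shows "left_global_dim TYPE('m) (presentation_quiver_algebra a Y) \<le> 2 \<and>
         right_global_dim TYPE('m) (presentation_quiver_algebra a Y) \<le> 2"
proof -
  let ?n = "num_vertices Y"
  have supp: "finite {w. y w \<noteq> 0}" "{w. y w \<noteq> 0} \<subseteq> lists {1..a}" if "y \<in> Y" for y
    using assms(2) that by (auto simp: free_algebra_def basis_algebra_def)
  have full: "spanned_by_full_paths ?n a f" if "f \<in> T_relations ?n a \<union> lift_relation ?n ` Y" for f
    using that
  proof
    assume "f \<in> lift_relation ?n ` Y"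
    then obtain y where y: "y \<in> Y" "f = lift_relation ?n y" by auto
    show ?thesis
      unfolding y(2)
    proof (rule lift_relation_full[OF supp(1)[OF y(1)]])
      show "length w < ?n \<and> set w \<subseteq> {1..a}" if "y w \<noteq> 0" for w
        using length_less_num_vertices[OF assms(1) supp(1) y(1) that] supp(2)[OF y(1)] that
        by (auto simp: lists_eq_set)
    qed
  qed (rule T_relations_full)
  show ?thesis
    unfolding presentation_quiver_algebra_def Let_def
    by (intro conjI global_dim_full_path_relations[OF num_vertices_pos full])
qed

end
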